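(* Fix an integer $d>0$ and fixed balls $B_1,\dots,B_d$ in $\mathcal{R}$. Let $Z_i=\frac{1}{|i|_p}U_i$, where $U_1,\dots,U_d$ are independent Haar-uniform random variables on $\mathcal{R}$. Then $$\lim_{n\to\infty}\Pr_{M\in U_n(\mathcal{O})}\Big[\mathrm{tr}(M^i)-1_{p\mid i}\,\sigma(\mathrm{tr}(M^{i/p}))\in B_i,\ i=1,\dots,d\Big]=\prod_{i=1}^d\Pr[Z_i\in B_i],$$ where $M$ is Haar-random in $U_n(\mathcal{O})$.
   Context: $p$ is an odd prime and $q$ a power of $p$. $\mathcal{F}/\mathbb{Q}_p$ is a finite unramified extension with ring of integers $\mathcal{O}$, uniformizer $\pi$ and residue field $\mathbb{F}_q$. $\mathcal{K}/\mathcal{F}$ is an unramified quadratic extension with ring of integers $\mathcal{R}$ and nontrivial automorphism $\tau$. $U_n(\mathcal{O})=\{M\in GL_n(\mathcal{R}): M\tau(M^t)=I\}$. $\sigma$ is the Frobenius automorphism of $\mathcal{K}$ over $\mathbb{Q}_p$ ($\sigma(x)\equiv x^p\pmod\pi$ on $\mathcal{R}$). $|i|_p=p^{-v_p(i)}$, and $1_{p\mid i}$ is $1$ if $p\mid i$ and $0$ otherwise. *)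

theory Defs
  imports
    "HOL-Probability.Probability"
    "HOL-Algebra.Embedded_Algebras"
    "HOL-Algebra.Algebraic_Closure_Type"
    "Jordan_Normal_Form.Matrix"
begin

text \<open>
  The ambient field $K$ is a whole type \<open>'k\<close>, equipped with a real-valued absolute
  value \<open>nrm\<close>; subfields of $K$ are sets. The HOL-Algebra notions (subfields, degrees,
  automorphisms) are taken in the ring \<open>ring_of_type_algebra\<close> whose carrier is \<open>UNIV\<close>.
\<close>

definition padic_abs :: "nat \<Rightarrow> rat \<Rightarrow> rat" where
  "padic_abs p x = (if x = 0 then 0 else
     (case quotient_of x of (a, b) \<Rightarrow>
        of_nat p powi (int (multiplicity (int p) b) - int (multiplicity (int p) a))))"

definition nonarch_abs :: "('k::field \<Rightarrow> real) \<Rightarrow> bool" where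
  "nonarch_abs nrm \<longleftrightarrow>
     (\<forall>x. 0 \<le> nrm x) \<and> (\<forall>x. nrm x = 0 \<longleftrightarrow> x = 0) \<and>
     (\<forall>x y. nrm (x * y) = nrm x * nrm y) \<and>
     (\<forall>x y. nrm (x + y) \<le> max (nrm x) (nrm y))"

definition abs_dist :: "('k::field \<Rightarrow> real) \<Rightarrow> 'k \<Rightarrow> 'k \<Rightarrow> real" where
  "abs_dist nrm x y = nrm (x - y)"

definition abs_topology :: "('k::field \<Rightarrow> real) \<Rightarrow> 'k set \<Rightarrow> 'k topology" where
  "abs_topology nrm L = Metric_space.mtopology L (abs_dist nrm)"

text \<open>\<open>Q\<close> is the field $\mathbb{Q}_p$: the completion of the rationals for the $p$-adic absolute value.\<close>

definition padic_numbers :: "nat \<Rightarrow> ('k::field_char_0 \<Rightarrow> real) \<Rightarrow> 'k set \<Rightarrow> bool" where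
  "padic_numbers p nrm Q \<longleftrightarrow>
     subfield Q ring_of_type_algebra \<and>
     (\<forall>x. nrm (of_rat x) = of_rat (padic_abs p x)) \<and>
     Metric_space.mcomplete Q (abs_dist nrm) \<and>
     (abs_topology nrm Q) closure_of (range of_rat) = Q"

definition finite_extension :: "'k::field set \<Rightarrow> 'k set \<Rightarrow> bool" where
  "finite_extension E L \<longleftrightarrow>
     subfield E ring_of_type_algebra \<and> subfield L ring_of_type_algebra \<and> E \<subseteq> L \<and>
     ring.finite_dimension ring_of_type_algebra E L"

text \<open>
  Ramification index one, i.e. the value groups of \<open>E\<close> and \<open>L\<close> agree. The residue fields
  of finite extensions of $\mathbb{Q}_p$ are finite, so separability of the residue extension
  is automatic.
\<close>

definition unramified :: "('k::field \<Rightarrow> real) \<Rightarrow> 'k set \<Rightarrow> 'k set \<Rightarrow> bool" where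
  "unramified nrm E L \<longleftrightarrow> nrm ` (L - {0}) = nrm ` (E - {0})"

definition integers :: "('k::field \<Rightarrow> real) \<Rightarrow> 'k set \<Rightarrow> 'k set" where
  "integers nrm L = {x \<in> L. nrm x \<le> 1}"

definition max_ideal :: "('k::field \<Rightarrow> real) \<Rightarrow> 'k set \<Rightarrow> 'k set" where
  "max_ideal nrm L = {x \<in> L. nrm x < 1}"

definition uniformizer :: "('k::field \<Rightarrow> real) \<Rightarrow> 'k set \<Rightarrow> 'k \<Rightarrow> bool" where
  "uniformizer nrm L \<pi> \<longleftrightarrow> max_ideal nrm L = (\<lambda>x. \<pi> * x) ` integers nrm L"

definition residue_field :: "('k::field \<Rightarrow> real) \<Rightarrow> 'k set \<Rightarrow> 'k set set" where
  "residue_field nrm L =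
     integers nrm L //
       {(x, y). x \<in> integers nrm L \<and> y \<in> integers nrm L \<and> x - y \<in> max_ideal nrm L}"

definition field_automorphism_over :: "'k::field set \<Rightarrow> ('k \<Rightarrow> 'k) \<Rightarrow> bool" where
  "field_automorphism_over E f \<longleftrightarrow>
     f \<in> ring_iso ring_of_type_algebra ring_of_type_algebra \<and> (\<forall>x\<in>E. f x = x)"

locale unramified_quadratic =
  fixes p q :: nat
    and nrm :: "'k::field_char_0 \<Rightarrow> real"
    and Qp F :: "'k set"
    and \<pi> :: 'k
    and \<tau> \<sigma> :: "'k \<Rightarrow> 'k"
  assumes p_prime: "Factorial_Ring.prime p" and p_odd: "odd p"
    and q_power: "\<exists>k>0. q = p ^ k"
    and nrm: "nonarch_abs nrm"
    and Qp: "padic_numbers p nrm Qp"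
    and F_finite: "finite_extension Qp F"
    and F_unramified: "unramified nrm Qp F"
    and F_uniformizer: "uniformizer nrm F \<pi>"
    and F_residue: "card (residue_field nrm F) = q"
    and K_quadratic: "ring.dimension ring_of_type_algebra 2 F UNIV"
    and K_unramified: "unramified nrm F UNIV"
    and tau: "field_automorphism_over F \<tau>" "\<tau> \<noteq> id"
    and sigma: "field_automorphism_over Qp \<sigma>"
    and sigma_frobenius: "\<forall>x \<in> integers nrm UNIV. \<exists>y \<in> integers nrm UNIV. \<sigma> x - x ^ p = \<pi> * y"

definition mat_trace :: "'k::comm_monoid_add mat \<Rightarrow> 'k" where
  "mat_trace M = (\<Sum>i<dim_row M. M $$ (i, i))"

definition mat_over :: "nat \<Rightarrow> 'k set \<Rightarrow> 'k mat set" where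
  "mat_over n R = {M \<in> carrier_mat n n. \<forall>i<n. \<forall>j<n. M $$ (i, j) \<in> R}"

definition GL_over :: "nat \<Rightarrow> 'k::comm_ring_1 set \<Rightarrow> 'k mat set" where
  "GL_over n R = {M \<in> mat_over n R. \<exists>N \<in> mat_over n R. inverts_mat M N \<and> inverts_mat N M}"

definition unitary_group :: "nat \<Rightarrow> 'k::comm_ring_1 set \<Rightarrow> ('k \<Rightarrow> 'k) \<Rightarrow> 'k mat set" where
  "unitary_group n R \<tau> = {M \<in> GL_over n R. M * map_mat \<tau> (transpose_mat M) = 1\<^sub>m n}"

text \<open>The maximum of the entrywise distances; \<open>0\<close> is inserted only to cover \<open>n = 0\<close>.\<close>

definition mat_dist :: "('k::field \<Rightarrow> real) \<Rightarrow> nat \<Rightarrow> 'k mat \<Rightarrow> 'k mat \<Rightarrow> real" where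
  "mat_dist nrm n A B =
     Max (insert 0 ((\<lambda>(i, j). nrm (A $$ (i, j) - B $$ (i, j))) ` ({..<n} \<times> {..<n})))"

definition mat_topology :: "('k::field \<Rightarrow> real) \<Rightarrow> nat \<Rightarrow> 'k mat set \<Rightarrow> 'k mat topology" where
  "mat_topology nrm n G = Metric_space.mtopology G (mat_dist nrm n)"

definition borel_sigma :: "'g topology \<Rightarrow> 'g measure" where
  "borel_sigma T = sigma (topspace T) {U. openin T U}"

text \<open>
  Normalized Haar measure of a compact group with underlying space \<open>T\<close> and group
  operation \<open>mul\<close>. Regularity is not listed since every finite Borel measure on a metrizable
  space, as considered here, is outer regular, and on a compact one it is Radon.
\<close>

definition haar_probability :: "'g topology \<Rightarrow> ('g \<Rightarrow> 'g \<Rightarrow> 'g) \<Rightarrow> 'g measure \<Rightarrow> bool" where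
  "haar_probability T mul P \<longleftrightarrow>
     prob_space P \<and> space P = topspace T \<and> sets P = sets (borel_sigma T) \<and>
     (\<forall>g \<in> topspace T. \<forall>A \<in> sets P. emeasure P (mul g ` A) = emeasure P A)"

definition is_ball :: "('k::field \<Rightarrow> real) \<Rightarrow> 'k set \<Rightarrow> 'k set \<Rightarrow> bool" where
  "is_ball nrm R B \<longleftrightarrow>
     (\<exists>a \<in> R. \<exists>r > 0. B = Metric_space.mball R (abs_dist nrm) a r \<or>
                       B = Metric_space.mcball R (abs_dist nrm) a r)"

end

theory Submission
  imports Defs
begin

text \<open>
  Let \<open>M\<close> be Haar-random and let $h_u = 1 + a\,u u^*$ be the unitary reflection attached to a uniformly
  random integral vector \<open>u\<close>, with $a$ depending on $u^* u$ only. Then $h_u M$ is again Haar-random, and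
  since it is a rank-one update of \<open>M\<close>, the traces of its powers are determined by those of \<open>M\<close> and by
  the values $a\,u^* M^j u$ through Newton's identities. If these values are uniform modulo $p^k$, then,
  successively for $i = 1, \dots, d$, the \<open>i\<close>-th quantity is $i$ times a uniform variable plus a term
  depending on the earlier ones, and this term lies in $i \mathcal{R}$ by Dwork's congruence.

  The values $u^* M^j u$, $0 \le j \le d$, are nearly uniform for most \<open>M\<close>: replacing \<open>u\<close> by $u + w$ changes
  them by a linear function of \<open>u\<close> that is onto as soon as $w, M w, \dots, M^{2d} w$ are independent
  modulo \<open>p\<close>, which makes the collision probability of the values nearly minimal. The first
  dependence among the $M^j w$ is destroyed by almost every reflection fixing the earlier vectors,
  so it has probability exponentially small in \<open>n\<close>.
\<close>

text \<open>Each ball is a union of residue classes modulo p^k for all large k, so with k fixed both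
  sides become averages over finite sets of representatives; K being unramified over Q_p, p is a
  uniformizer and these levels are all there are. The order of the unitary group modulo p^k is never
  computed. Only its translation invariance is used, and the explicit randomness is that of u, whose
  coordinates are independent and uniform.

  The value u^* u is fixed by \<tau>, so the d + 1 values range over O x R^d, not over R^(d+1). This
  does no harm: Newton's identities read only j > 0, and u^* u enters solely through the scalar a,
  which is always a unit.

  The exponents up to 2d arise because the cross term pairs u^* M^j w with w^* M^j u, the conjugate
  of u^* M^(-j) w; the exponents from -d to d are shifted by d. Collision probability turns into
  uniformity by Cauchy-Schwarz, at the cost of a factor that does not depend on n.\<close>

unbundle no vec_syntax
unbundle no inner_syntax
no_notation fps_nth (infixl \<open>$\<close> 75)

subsection \<open>The absolute value\<close>

text \<open>Subfields and automorphisms are given in the HOL-Algebra ring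
  \<open>ring_of_type_algebra\<close>; this lemma and the next two translate them into type-class
  arithmetic.\<close>

lemma type_subfieldD:
  fixes L :: "'k::field set"
  assumes L: "subfield L ring_of_type_algebra"
  shows "0 \<in> L" "1 \<in> L"
    and "x \<in> L \<Longrightarrow> y \<in> L \<Longrightarrow> x + y \<in> L"
    and "x \<in> L \<Longrightarrow> y \<in> L \<Longrightarrow> x * y \<in> L"
    and "x \<in> L \<Longrightarrow> - x \<in> L"
    and "x \<in> L \<Longrightarrow> inverse x \<in> L"
proof -
  interpret ring "ring_of_type_algebra :: 'k ring"
    by (rule ring_from_type_algebra)
  note E = subringE[OF subfieldE(1)[OF L]]
  show "0 \<in> L" "1 \<in> L" using E(2,3) by (auto simp: ring_of_type_algebra_def)
  show "x \<in> L \<Longrightarrow> y \<in> L \<Longrightarrow> x + y \<in> L" using E(7)[of x y] by (simp add: ring_of_type_algebra_def)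
  show "x \<in> L \<Longrightarrow> y \<in> L \<Longrightarrow> x * y \<in> L" using E(6)[of x y] by (simp add: ring_of_type_algebra_def)
  show "- x \<in> L" if "x \<in> L"
  proof -
    have "x + (\<ominus>\<^bsub>ring_of_type_algebra\<^esub> x) = 0"
      using r_neg[of x] by (simp add: ring_of_type_algebra_def)
    then have "\<ominus>\<^bsub>ring_of_type_algebra\<^esub> x = - x" by (simp add: add_eq_0_iff)
    then show ?thesis using E(5)[OF that] by simp
  qed
  show "inverse x \<in> L" if "x \<in> L"
  proof (cases "x = 0")
    case True
    then show ?thesis using that by simp
  next
    case False
    then have x: "x \<in> L - {\<zero>\<^bsub>ring_of_type_algebra\<^esub>}" using that by (simp add: ring_of_type_algebra_def)
    have "x * (inv\<^bsub>ring_of_type_algebra\<^esub> x) = 1"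
      using subfield_m_inv(2)[OF L x] by (simp add: ring_of_type_algebra_def)
    then have "inv\<^bsub>ring_of_type_algebra\<^esub> x = inverse x" by (metis inverse_unique)
    then show ?thesis using subfield_m_inv(1)[OF L x] by simp
  qed
qed

lemma type_subfield_closed:
  fixes L :: "'k::field set"
  assumes L: "subfield L ring_of_type_algebra"
  shows "x \<in> L \<Longrightarrow> y \<in> L \<Longrightarrow> x - y \<in> L" "x \<in> L \<Longrightarrow> y \<in> L \<Longrightarrow> x / y \<in> L"
    "x \<in> L \<Longrightarrow> x ^ n \<in> L" "of_nat n \<in> L" "of_int k \<in> L"
    "(\<And>i. i \<in> I \<Longrightarrow> f i \<in> L) \<Longrightarrow> sum f I \<in> L"
proof -
  note D = type_subfieldD[OF L]
  show "x \<in> L \<Longrightarrow> y \<in> L \<Longrightarrow> x - y \<in> L" using D(3)[of x "- y"] D(5)[of y] by simp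
  show "x \<in> L \<Longrightarrow> y \<in> L \<Longrightarrow> x / y \<in> L" using D(4)[of x "inverse y"] D(6)[of y] by (simp add: field_simps)
  show "x \<in> L \<Longrightarrow> x ^ n \<in> L" by (induction n) (auto intro: D)
  show nat: "of_nat n \<in> L" for n by (induction n) (auto intro: D)
  show "of_int k \<in> L" by (cases k rule: int_cases2) (auto intro: D nat)
  show "(\<And>i. i \<in> I \<Longrightarrow> f i \<in> L) \<Longrightarrow> sum f I \<in> L"
    by (induction I rule: infinite_finite_induct) (auto intro: D)
qed

lemma field_automorphism_overD:
  fixes f :: "'k::field \<Rightarrow> 'k"
  assumes "field_automorphism_over E f"
  shows "f (x + y) = f x + f y" "f (x * y) = f x * f y" "f 1 = 1" "f 0 = 0" "f (- x) = - f x"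
    "f (x - y) = f x - f y" "f (inverse x) = inverse (f x)" "f (x ^ n) = f x ^ n" "bij f"
    "f (sum g I) = (\<Sum>i\<in>I. f (g i))"
    "z \<in> E \<Longrightarrow> f z = z"
proof -
  have f: "f \<in> ring_iso ring_of_type_algebra ring_of_type_algebra" and fE: "\<forall>x\<in>E. f x = x"
    using assms by (auto simp: field_automorphism_over_def)
  show add: "f (x + y) = f x + f y" for x y
    using ring_iso_memE(3)[OF f, of x y] by (simp add: ring_of_type_algebra_def)
  show mult: "f (x * y) = f x * f y" for x y
    using ring_iso_memE(2)[OF f, of x y] by (simp add: ring_of_type_algebra_def)
  show one: "f 1 = 1"
    using ring_iso_memE(4)[OF f] by (simp add: ring_of_type_algebra_def)
  show zero: "f 0 = 0" using add[of 0 0] by (metis add_cancel_right_right)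
  show minus: "f (- x) = - f x" for x using add[of x "- x"] zero by (simp add: add_eq_0_iff)
  show "f (x - y) = f x - f y" using add[of x "- y"] minus[of y] by simp
  show "f (inverse x) = inverse (f x)"
  proof (cases "x = 0")
    case False
    then have "f x * f (inverse x) = 1" using mult[of x "inverse x"] one by simp
    then show ?thesis by (metis inverse_unique)
  qed (simp add: zero)
  show "f (x ^ n) = f x ^ n" by (induction n) (auto simp: one mult)
  show "bij f" using ring_iso_memE(5)[OF f] by (simp add: ring_of_type_algebra_def)
  show "f (sum g I) = (\<Sum>i\<in>I. f (g i))"
    by (induction I rule: infinite_finite_induct) (auto simp: add zero)
  show "z \<in> E \<Longrightarrow> f z = z" using fE by simp
qed

lemma padic_abs_nonzero:
  assumes "r \<noteq> 0"
  shows "\<exists>m::int. padic_abs p r = of_nat p powi m"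
  using assms by (auto simp: padic_abs_def split: prod.splits)

lemma padic_abs_of_nat:
  assumes "m > 0"
  shows "padic_abs p (of_nat m) = of_nat p powi (- int (multiplicity p m))"
proof -
  have "quotient_of (of_nat m) = (int m, 1)"
    using quotient_of_int[of "int m"] by (simp add: of_rat_def)
  moreover have "multiplicity (int p) (int m) = multiplicity p m"
    unfolding multiplicity_def by (simp flip: of_nat_power)
  ultimately show ?thesis using assms by (simp add: padic_abs_def)
qed

context unramified_quadratic
begin

lemma nrm_nonneg [simp]: "0 \<le> nrm x"
  and nrm_eq_0_iff [simp]: "nrm x = 0 \<longleftrightarrow> x = 0"
  and nrm_mult: "nrm (x * y) = nrm x * nrm y"
  and nrm_add: "nrm (x + y) \<le> max (nrm x) (nrm y)"
  using nrm by (auto simp: nonarch_abs_def)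

lemma nrm_0 [simp]: "nrm 0 = 0" by simp

lemma nrm_pos: "x \<noteq> 0 \<Longrightarrow> 0 < nrm x"
  using nrm_nonneg[of x] nrm_eq_0_iff[of x] by linarith

lemma nrm_1 [simp]: "nrm 1 = 1"
  using nrm_mult[of 1 1] nrm_eq_0_iff[of 1] by simp

lemma nrm_minus [simp]: "nrm (- x) = nrm x"
proof -
  have "nrm (- 1) * nrm (- 1) = 1" using nrm_mult[of "- 1" "- 1"] by simp
  then have "nrm (- 1) = 1" using nrm_nonneg[of "- 1"] by (simp add: square_eq_1_iff)
  then show ?thesis using nrm_mult[of "- 1" x] by simp
qed

lemma nrm_diff: "nrm (x - y) \<le> max (nrm x) (nrm y)"
  using nrm_add[of x "- y"] by simp

lemma nrm_minus_commute: "nrm (x - y) = nrm (y - x)"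
  using nrm_minus[of "x - y"] by simp

lemma nrm_add_le: "nrm x \<le> c \<Longrightarrow> nrm y \<le> c \<Longrightarrow> nrm (x + y) \<le> c"
  using nrm_add[of x y] by simp

lemma nrm_diff_le: "nrm x \<le> c \<Longrightarrow> nrm y \<le> c \<Longrightarrow> nrm (x - y) \<le> c"
  using nrm_diff[of x y] by simp

lemma nrm_diff_trans: "nrm (x - y) \<le> c \<Longrightarrow> nrm (y - z) \<le> c \<Longrightarrow> nrm (x - z) \<le> c"
  using nrm_add_le[of "x - y" c "y - z"] by simp

lemma nrm_add_eq: "nrm y < nrm x \<Longrightarrow> nrm (x + y) = nrm x"
  using nrm_add[of x y] nrm_diff[of "x + y" y] by (auto simp: max_def split: if_splits)

lemma nrm_sum_le: "0 \<le> c \<Longrightarrow> (\<And>i. i \<in> I \<Longrightarrow> nrm (f i) \<le> c) \<Longrightarrow> nrm (sum f I) \<le> c"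
  by (induction I rule: infinite_finite_induct) (auto intro: nrm_add_le)

lemma nrm_power: "nrm (x ^ n) = nrm x ^ n"
  by (induction n) (auto simp: nrm_mult)

lemma nrm_inverse: "nrm (inverse x) = inverse (nrm x)"
proof (cases "x = 0")
  case False
  then have "nrm x * nrm (inverse x) = 1" using nrm_mult[of x "inverse x"] by simp
  then show ?thesis by (metis inverse_unique)
qed simp

lemma nrm_divide: "nrm (x / y) = nrm x / nrm y"
  by (simp add: divide_inverse nrm_mult nrm_inverse)

lemma nrm_mult_le_one: "nrm x \<le> 1 \<Longrightarrow> nrm y \<le> 1 \<Longrightarrow> nrm (x * y) \<le> 1"
  by (simp add: nrm_mult mult_le_one)

lemma nrm_mult_le: "nrm x \<le> 1 \<Longrightarrow> nrm y \<le> c \<Longrightarrow> nrm (x * y) \<le> c"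
  using mult_mono[of "nrm x" 1 "nrm y" c] by (simp add: nrm_mult)

lemma nrm_mult_le': "nrm x \<le> c \<Longrightarrow> nrm y \<le> 1 \<Longrightarrow> nrm (x * y) \<le> c"
  using nrm_mult_le[of y x c] by (simp add: mult.commute)

lemma nrm_of_nat_le: "nrm (of_nat n) \<le> 1"
  by (induction n) (auto intro: nrm_add_le)

lemma nrm_of_rat: "nrm (of_rat r) = of_rat (padic_abs p r)"
  using Qp by (simp add: padic_numbers_def)

lemma p_gt_2: "p > 2"
  using p_prime p_odd prime_ge_2_nat[of p] by (metis even_numeral le_neq_implies_less)

lemma p_gt_1: "1 < p" and p_pos: "0 < p"
  using p_gt_2 by simp_all

lemma nrm_of_nat: "m > 0 \<Longrightarrow> nrm (of_nat m) = (1 / real p) ^ multiplicity p m"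
  using nrm_of_rat[of "of_nat m"] padic_abs_of_nat[of m p]
  by (simp add: power_int_minus of_rat_inverse of_rat_power power_divide divide_inverse power_inverse)

lemma nrm_p: "nrm (of_nat p) = 1 / real p"
  using nrm_of_nat[of p] p_prime p_gt_1 by simp

lemma nrm_p_lt_1: "nrm (of_nat p) < 1"
  using p_gt_1 by (simp add: nrm_p)

text \<open>Halving preserves integrality because p is odd. This is what permits
  \<open>eps - s / 2\<close> in the reflections and \<open>z 0 / 2\<close> in
  \<open>qpolar_surj\<close>.\<close>

lemma nrm_2: "nrm 2 = 1"
proof -
  have "multiplicity p 2 = 0"
    using p_gt_2 by (intro not_dvd_imp_multiplicity_0) (auto dest: dvd_imp_le)
  then show ?thesis using nrm_of_nat[of 2] by simp
qed

lemma Qp_subfield: "subfield Qp ring_of_type_algebra"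
  and F_subfield: "subfield F ring_of_type_algebra"
  and Qp_subset_F: "Qp \<subseteq> F"
  using Qp F_finite by (auto simp: padic_numbers_def finite_extension_def)

lemma Metric_space_abs: "Metric_space L (abs_dist nrm)"
proof
  show "abs_dist nrm x z \<le> abs_dist nrm x y + abs_dist nrm y z" for x y z
    using nrm_add[of "x - y" "y - z"] nrm_nonneg[of "x - y"] nrm_nonneg[of "y - z"]
    unfolding abs_dist_def diff_add_cancel by (simp add: max_def split: if_splits del: nrm_nonneg)
qed (auto simp: abs_dist_def nrm_minus_commute)

lemma Qp_approx:
  assumes "x \<in> Qp" "e > 0"
  obtains r where "nrm (x - of_rat r) < e"
proof -
  interpret M: Metric_space Qp "abs_dist nrm" by (rule Metric_space_abs)
  have "x \<in> M.mtopology closure_of (range of_rat)"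
    using Qp assms by (simp add: padic_numbers_def abs_topology_def)
  then have "\<exists>y\<in>range of_rat. y \<in> M.mball x e"
    using assms by (simp add: M.metric_closure_of)
  then show ?thesis using that by (auto simp: abs_dist_def)
qed

text \<open>A rational whose distance to x is less than \<open>nrm x\<close> has the same absolute
  value as x, and nonzero rationals have powers of p as values.\<close>

lemma Qp_value: "x \<in> Qp \<Longrightarrow> x \<noteq> 0 \<Longrightarrow> \<exists>m::int. nrm x = real p powi m"
proof -
  assume x: "x \<in> Qp" "x \<noteq> 0"
  obtain r where r: "nrm (x - of_rat r) < nrm x" using Qp_approx[OF x(1) nrm_pos[OF x(2)]] by metis
  then have "nrm (of_rat r - x) < nrm x" by (simp add: nrm_minus_commute)
  from nrm_add_eq[OF this] have eq: "nrm (of_rat r) = nrm x" by simp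
  then have "r \<noteq> 0" using x(2) by auto
  from padic_abs_nonzero[OF this, of p] obtain m where "padic_abs p r = of_nat p powi m" by blast
  moreover have "of_rat (of_nat p powi m :: rat) = real p powi m"
    by (simp add: power_int_def of_rat_power of_rat_inverse)
  ultimately have "nrm x = real p powi m" using eq nrm_of_rat[of r] by simp
  then show ?thesis by blast
qed

text \<open>Neither unramified step adds a new value. Hence p is a uniformizer of all of K, and the
  powers of 1/p are the only thresholds that occur.\<close>

lemma value_group: "x \<noteq> 0 \<Longrightarrow> \<exists>m::int. nrm x = real p powi m"
proof -
  assume "x \<noteq> 0"
  then have "nrm x \<in> nrm ` (UNIV - {0})" by blast
  then have "nrm x \<in> nrm ` (Qp - {0})"
    using F_unramified K_unramified by (simp add: unramified_def)
  then show ?thesis using Qp_value by (metis Diff_iff imageE insertI1)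
qed

lemma nrm_less_power_imp_le:
  assumes "nrm x < (1 / real p) ^ k"
  shows "nrm x \<le> (1 / real p) ^ Suc k"
proof (cases "x = 0")
  case False
  from value_group[OF this] obtain m where m: "nrm x = real p powi m" by blast
  have "real p powi m < real p powi (- int k)"
    using assms m by (simp add: power_int_minus power_divide divide_inverse power_inverse)
  then have "m < - int k"
    using p_gt_1 by (smt (verit, best) of_nat_1 of_nat_less_iff power_int_increasing)
  then have "real p powi m \<le> real p powi (- int (Suc k))"
    using p_gt_1 by (intro power_int_increasing) auto
  also have "\<dots> = (1 / real p) ^ Suc k"
    by (simp only: power_int_minus power_int_of_nat) (simp add: divide_inverse power_inverse)
  finally show ?thesis by (simp add: m)
qed simp

lemma nrm_less_1_imp_le: "nrm x < 1 \<Longrightarrow> nrm x \<le> 1 / real p"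
  using nrm_less_power_imp_le[of x 0] by simp

lemma nrm_lt_1_iff_le: "nrm x < 1 \<longleftrightarrow> nrm x \<le> 1 / real p"
  using nrm_less_1_imp_le[of x] nrm_p_lt_1 nrm_p by auto

text \<open>The scalar is taken in Q_p so that \<tau> fixes it; dividing by it reduces questions
  about \<tau> to elements of absolute value 1.\<close>

lemma unit_scaling:
  assumes "x \<noteq> 0"
  obtains c where "c \<in> Qp" "c \<noteq> 0" "nrm c = nrm x"
proof -
  have "nrm x \<in> nrm ` (UNIV - {0})" using assms by blast
  then have "nrm x \<in> nrm ` (Qp - {0})"
    using F_unramified K_unramified by (simp add: unramified_def)
  then obtain c where "c \<in> Qp - {0}" "nrm x = nrm c" by blast
  then show ?thesis using that[of c] by simp
qed

text \<open>An exchange argument: in a basis v, w of K over F, the element 1 replaces a vector that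
  has a nonzero coefficient in it.\<close>

lemma K_generated:
  obtains x0 where "\<And>x. \<exists>a\<in>F. \<exists>b\<in>F. x = a + b * x0"
proof -
  interpret ring "ring_of_type_algebra :: 'k ring"
    by (rule ring_from_type_algebra)
  note D = type_subfieldD[OF F_subfield]
  have ext: "x \<in> line_extension F v E \<longleftrightarrow> (\<exists>a\<in>F. \<exists>e\<in>E. x = a * v + e)" for x v E
    unfolding line_extension_def set_add_def set_mult_def r_coset_def
    by (auto simp: ring_of_type_algebra_def)
  have "dimension (Suc (Suc 0)) F UNIV" using K_quadratic by (simp add: numeral_2_eq_2)
  then obtain v E where v: "UNIV = line_extension F v E" and E: "dimension (Suc 0) F E"
    by (cases rule: dimension.cases) auto
  from E obtain w E' where w: "E = line_extension F w E'" and E': "dimension 0 F E'"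
    by (cases rule: dimension.cases) auto
  from E' have "E' = {\<zero>\<^bsub>ring_of_type_algebra\<^esub>}" by (cases rule: dimension.cases) auto
  then have "E' = {0}" by (simp add: ring_of_type_algebra_def)
  then have gen: "\<exists>a\<in>F. \<exists>b\<in>F. x = a * v + b * w" for x
    using v w ext by (metis UNIV_I add.right_neutral singletonD)
  obtain a b where ab: "a \<in> F" "b \<in> F" "1 = a * v + b * w" using gen by blast
  show ?thesis
  proof (cases "a = 0")
    case False
    then have veq: "v = inverse a - inverse a * b * w"
      using ab(3) by (simp add: field_simps)
    show ?thesis
    proof (rule that[of w])
      fix x
      obtain c e where ce: "c \<in> F" "e \<in> F" "x = c * v + e * w" using gen by blast
      have "x = c * inverse a + (e - c * (inverse a * b)) * w"
        unfolding ce(3) by (subst veq) (simp add: algebra_simps)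
      moreover have "c * inverse a \<in> F" "e - c * (inverse a * b) \<in> F"
        using ce ab D type_subfield_closed[OF F_subfield] by auto
      ultimately show "\<exists>a\<in>F. \<exists>b\<in>F. x = a + b * w" by blast
    qed
  next
    case True
    then have b: "b \<noteq> 0" "w = inverse b" using ab(3) by (auto simp: inverse_unique)
    show ?thesis
    proof (rule that[of v])
      fix x
      obtain c e where ce: "c \<in> F" "e \<in> F" "x = c * v + e * w" using gen by blast
      have "x = e * inverse b + c * v" using ce b by simp
      moreover have "e * inverse b \<in> F" using ce ab D by auto
      ultimately show "\<exists>a\<in>F. \<exists>b\<in>F. x = a + b * v" using ce by blast
    qed
  qed
qed

subsection \<open>Residues and automorphisms\<close>


lemma integers_UNIV: "x \<in> integers nrm UNIV \<longleftrightarrow> nrm x \<le> 1"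
  by (simp add: integers_def)

lemma nrm_pi: "nrm \<pi> \<le> 1 / real p"
proof -
  have "1 \<in> integers nrm F" using type_subfieldD[OF F_subfield] by (simp add: integers_def)
  then have "\<pi> * 1 \<in> max_ideal nrm F" using F_uniformizer unfolding uniformizer_def by blast
  then show ?thesis by (simp add: max_ideal_def nrm_less_1_imp_le)
qed

lemma F_residues_finite:
  obtains S where "finite S" "S \<subseteq> integers nrm F" "\<And>x. x \<in> F \<Longrightarrow> nrm x \<le> 1 \<Longrightarrow> \<exists>s\<in>S. nrm (x - s) < 1"
proof -
  let ?r = "{(x, y). x \<in> integers nrm F \<and> y \<in> integers nrm F \<and> x - y \<in> max_ideal nrm F}"
  let ?Q = "residue_field nrm F"
  have "q > 0" using q_power p_pos by auto
  \<comment> \<open>\<open>card\<close> of an infinite set is 0, so a positive cardinality q gives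
    finiteness.\<close>
  then have fin: "finite ?Q" using F_residue card_ge_0_finite by blast
  have eq: "equiv (integers nrm F) ?r"
  proof (rule equivI)
    show "refl_on (integers nrm F) ?r"
      using type_subfieldD[OF F_subfield] by (auto simp: refl_on_def max_ideal_def)
    show "sym ?r"
      using type_subfieldD(5)[OF F_subfield]
      by (auto simp: sym_def max_ideal_def nrm_minus_commute) (metis minus_diff_eq)
    show "trans ?r"
    proof (rule transI, clarsimp)
      fix x y z assume *: "x - y \<in> max_ideal nrm F" "y - z \<in> max_ideal nrm F"
      then have "(x - y) + (y - z) \<in> F" "nrm ((x - y) + (y - z)) < 1"
        using type_subfieldD(3)[OF F_subfield, of "x - y" "y - z"] nrm_add[of "x - y" "y - z"]
        by (auto simp: max_ideal_def)
      then show "x - z \<in> max_ideal nrm F" by (simp add: max_ideal_def)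
    qed
  qed auto
  define S where "S = (\<lambda>c. SOME x. x \<in> c) ` ?Q"
  show ?thesis
  proof (rule that[of S])
    show "finite S" using fin by (simp add: S_def)
    have mem: "(SOME x. x \<in> c) \<in> c" if "c \<in> ?Q" for c
      using in_quotient_imp_non_empty[OF eq, of c] that by (simp add: residue_field_def some_in_eq)
    have sub: "c \<subseteq> integers nrm F" if "c \<in> ?Q" for c
      using in_quotient_imp_subset[OF eq, of c] that by (simp add: residue_field_def)
    show "S \<subseteq> integers nrm F" using mem sub by (auto simp: S_def)
    fix x assume "x \<in> F" "nrm x \<le> 1"
    then have x: "x \<in> integers nrm F" by (simp add: integers_def)
    let ?c = "?r `` {x}"
    have c: "?c \<in> ?Q" unfolding residue_field_def using x by (rule quotientI)
    have "(SOME y. y \<in> ?c) \<in> ?c" using mem[OF c] .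
    then have "nrm (x - (SOME y. y \<in> ?c)) < 1" by (auto simp: max_ideal_def)
    moreover have "(SOME y. y \<in> ?c) \<in> S" unfolding S_def using c by (rule imageI)
    ultimately show "\<exists>s\<in>S. nrm (x - s) < 1" by blast
  qed
qed

text \<open>Either every residue of K comes from F, or some integer x1 has a residue outside that of
  F. In the second case 1 and x1 form a basis in which integers have integral coordinates, and each
  coordinate is approximated separately.\<close>

lemma K_residues_finite:
  obtains S where "finite S" "\<And>s. s \<in> S \<Longrightarrow> nrm s \<le> 1"
    "\<And>x. nrm x \<le> 1 \<Longrightarrow> \<exists>s\<in>S. nrm (x - s) < 1"
proof -
  obtain S where S: "finite S" "S \<subseteq> integers nrm F"
    "\<And>x. x \<in> F \<Longrightarrow> nrm x \<le> 1 \<Longrightarrow> \<exists>s\<in>S. nrm (x - s) < 1" using F_residues_finite by metis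
  have S1: "nrm s \<le> 1" if "s \<in> S" for s using S(2) that by (auto simp: integers_def)
  show ?thesis
  proof (cases "\<forall>x. nrm x \<le> 1 \<longrightarrow> (\<exists>a\<in>F. nrm a \<le> 1 \<and> nrm (x - a) < 1)")
    case True
    show ?thesis
    proof (rule that[OF S(1)])
      fix x assume "nrm x \<le> 1"
      then obtain a where a: "a \<in> F" "nrm a \<le> 1" "nrm (x - a) < 1" using True by blast
      then obtain s where s: "s \<in> S" "nrm (a - s) < 1" using S(3) by blast
      then have "nrm ((x - a) + (a - s)) < 1" using nrm_add[of "x - a" "a - s"] a by simp
      then show "\<exists>s\<in>S. nrm (x - s) < 1" using s by auto
    qed (use S1 in auto)
  next
    case False
    then obtain x1 where x1: "nrm x1 \<le> 1" "\<And>a. a \<in> F \<Longrightarrow> nrm a \<le> 1 \<Longrightarrow> \<not> nrm (x1 - a) < 1" by blast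
    note C = type_subfieldD[OF F_subfield] type_subfield_closed[OF F_subfield]
    have "x1 \<notin> F" using x1(2)[of x1] x1(1) by auto
    obtain x0 where x0: "\<And>x. \<exists>a\<in>F. \<exists>b\<in>F. x = a + b * x0" using K_generated by metis
    obtain a1 b1 where ab1: "a1 \<in> F" "b1 \<in> F" "x1 = a1 + b1 * x0" using x0 by blast
    have "b1 \<noteq> 0" using ab1 \<open>x1 \<notin> F\<close> by auto
    then have x0eq: "x0 = x1 / b1 - a1 / b1" using ab1 by (simp add: field_simps)
    have gen: "\<exists>a\<in>F. \<exists>b\<in>F. x = a + b * x1" for x
    proof -
      obtain a b where ab: "a \<in> F" "b \<in> F" "x = a + b * x0" using x0 by blast
      have "x = (a - b * (a1 / b1)) + (b / b1) * x1" unfolding ab(3) x0eq by (simp add: algebra_simps)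
      moreover have "a - b * (a1 / b1) \<in> F" "b / b1 \<in> F" using C ab ab1 by auto
      ultimately show ?thesis by blast
    qed
    \<comment> \<open>If b is large and at least as large as a, division by b shows x1 to be
      congruent to an element of F. If a is strictly larger than b, then a dominates
      \<open>b * x1\<close> and x has the absolute value of a.\<close>
    have bound: "nrm a \<le> 1 \<and> nrm b \<le> 1" if x: "nrm x \<le> 1" "a \<in> F" "b \<in> F" "x = a + b * x1" for x a b
    proof (rule ccontr)
      assume *: "\<not> (nrm a \<le> 1 \<and> nrm b \<le> 1)"
      show False
      proof (cases "nrm a \<le> nrm b")
        case True
        then have b: "nrm b > 1" using * by linarith
        then have "b \<noteq> 0" by auto
        then have "x1 - (- a / b) = x / b" using x by (simp add: field_simps)
        moreover have "nrm (x / b) < 1" using b x by (simp add: nrm_divide field_simps)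
        moreover have "- a / b \<in> F" using C x by auto
        moreover have "nrm (- a / b) \<le> 1" using True b by (simp add: nrm_divide field_simps)
        ultimately show False using x1(2)[of "- a / b"] by simp
      next
        case False
        then have a: "nrm a > 1" using * by linarith
        have "nrm (b * x1) < nrm a" using False nrm_mult_le'[of b "nrm b" x1] x1 by simp
        then have "nrm x = nrm a" using nrm_add_eq[of "b * x1" a] x by simp
        then show False using x a by simp
      qed
    qed
    let ?T = "(\<lambda>(s, t). s + t * x1) ` (S \<times> S)"
    show ?thesis
    proof (rule that[of ?T])
      show "finite ?T" using S by simp
      show "nrm s \<le> 1" if "s \<in> ?T" for s
        using that S1 x1 by (auto intro!: nrm_add_le nrm_mult_le_one)
      fix x assume x: "nrm x \<le> 1"
      obtain a b where ab: "a \<in> F" "b \<in> F" "x = a + b * x1" using gen by blast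
      have le: "nrm a \<le> 1" "nrm b \<le> 1" using bound[OF x ab] by auto
      obtain s where s: "s \<in> S" "nrm (a - s) < 1" using S(3) ab le by blast
      obtain t where t: "t \<in> S" "nrm (b - t) < 1" using S(3) ab le by blast
      have "nrm ((b - t) * x1) < 1" using t nrm_mult_le'[of "b - t" "nrm (b - t)" x1] x1 by simp
      then have "nrm ((a - s) + (b - t) * x1) < 1" using s nrm_add[of "a - s" "(b - t) * x1"] by simp
      then have "nrm (x - (s + t * x1)) < 1" by (simp add: ab(3) algebra_simps)
      then show "\<exists>s\<in>?T. nrm (x - s) < 1" using s t by force
    qed
  qed
qed

text \<open>In a digit expansion, \<open>c k\<close> will say whether the k-th digit is a given
  representative s; the limit then collects all occurrences of s into one coefficient.\<close>

lemma sum_p_powers_limit: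
  fixes c :: "nat \<Rightarrow> bool"
  obtains \<alpha> where "\<alpha> \<in> Qp" "nrm \<alpha> \<le> 1"
    "\<And>N. nrm (\<alpha> - (\<Sum>k<N. of_bool (c k) * of_nat p ^ k)) \<le> (1 / real p) ^ N"
proof -
  interpret M: Metric_space Qp "abs_dist nrm" by (rule Metric_space_abs)
  define s where "s N = (\<Sum>k<N. of_bool (c k) * of_nat p ^ k :: 'k)" for N
  have sQ: "s N \<in> Qp" for N
    unfolding s_def using type_subfieldD[OF Qp_subfield] type_subfield_closed[OF Qp_subfield]
    by (intro type_subfield_closed(6)[OF Qp_subfield]) auto
  have le: "nrm (s N' - s N) \<le> (1 / real p) ^ N" if "N \<le> N'" for N N'
  proof -
    have "s N' - s N = (\<Sum>k\<in>{N..<N'}. of_bool (c k) * of_nat p ^ k)"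
      unfolding s_def using sum_diff_nat_ivl[of 0 N N' "\<lambda>k. of_bool (c k) * of_nat p ^ k :: 'k"] that
      by (simp add: atLeast0LessThan)
    also have "nrm \<dots> \<le> (1 / real p) ^ N"
    proof (rule nrm_sum_le)
      fix k assume "k \<in> {N..<N'}"
      then have "(1 / real p) ^ k \<le> (1 / real p) ^ N" using p_gt_1 by (intro power_decreasing) auto
      then show "nrm (of_bool (c k) * of_nat p ^ k) \<le> (1 / real p) ^ N"
        by (auto simp: nrm_mult nrm_power nrm_p)
    qed simp
    finally show ?thesis .
  qed
  have lim0: "(\<lambda>N. (1 / real p) ^ N) \<longlonglongrightarrow> 0" using p_gt_1 by (intro LIMSEQ_power_zero) auto
  have "M.MCauchy s"
    unfolding M.MCauchy_def
  proof (intro conjI allI impI)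
    show "range s \<subseteq> Qp" using sQ by auto
    fix e :: real assume "e > 0"
    then obtain N where N: "\<And>n. n \<ge> N \<Longrightarrow> (1 / real p) ^ n < e"
      using order_tendstoD(2)[OF lim0] by (auto simp: eventually_sequentially)
    show "\<exists>N. \<forall>n n'. N \<le> n \<longrightarrow> N \<le> n' \<longrightarrow> abs_dist nrm (s n) (s n') < e"
    proof (intro exI allI impI)
      fix n n' assume "N \<le> n" "N \<le> n'"
      then have "nrm (s n - s n') \<le> (1 / real p) ^ N"
        using le[of N n] le[of N n'] nrm_diff_trans[of "s n" "s N" _ "s n'"] by (simp add: nrm_minus_commute)
      then show "abs_dist nrm (s n) (s n') < e" using N[of N] by (simp add: abs_dist_def)
    qed
  qed
  then obtain \<alpha> where \<alpha>: "limitin M.mtopology s \<alpha> sequentially"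
    using Qp by (auto simp: padic_numbers_def M.mcomplete_def)
  then have aQ: "\<alpha> \<in> Qp" and lim: "\<And>e. e > 0 \<Longrightarrow> \<exists>N. \<forall>n\<ge>N. nrm (s n - \<alpha>) < e"
    unfolding M.limit_metric_sequentially abs_dist_def by blast+
  have close: "nrm (\<alpha> - s N) \<le> (1 / real p) ^ N" for N
  proof -
    obtain N' where N': "\<And>n. n \<ge> N' \<Longrightarrow> nrm (s n - \<alpha>) < (1 / real p) ^ N"
      using lim[of "(1 / real p) ^ N"] p_pos by auto
    have "nrm (s (max N N') - \<alpha>) \<le> (1 / real p) ^ N" using N'[of "max N N'"] by simp
    then show ?thesis
      using le[of N "max N N'"] nrm_diff_trans[of \<alpha> "s (max N N')" _ "s N"] by (simp add: nrm_minus_commute)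
  qed
  show ?thesis
  proof (rule that[OF aQ])
    show "nrm \<alpha> \<le> 1" using close[of 0] by (simp add: s_def)
  qed (use close in \<open>simp add: s_def\<close>)
qed

text \<open>Completeness of \<open>Qp\<close> turns the digit expansion of an integer into a combination of
  finitely many fixed digits with coefficients in $\mathbb{Z}_p$.\<close>

lemma integers_finitely_generated:
  "\<exists>S. finite S \<and> (\<forall>x. nrm x \<le> 1 \<longrightarrow>
     (\<exists>\<alpha>. (\<forall>s\<in>S. \<alpha> s \<in> Qp \<and> nrm (\<alpha> s) \<le> 1) \<and> x = (\<Sum>s\<in>S. \<alpha> s * s)))"
proof -
  obtain S where S: "finite S" "\<And>s. s \<in> S \<Longrightarrow> nrm s \<le> 1"
    "\<And>x. nrm x \<le> 1 \<Longrightarrow> \<exists>s\<in>S. nrm (x - s) < 1" using K_residues_finite by metis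
  show ?thesis
  proof (intro exI[of _ S] conjI allI impI)
    show "finite S" by (rule S(1))
    fix x assume x: "nrm x \<le> 1"
    obtain dig where dig: "\<And>x. nrm x \<le> 1 \<Longrightarrow> dig x \<in> S \<and> nrm (x - dig x) < 1"
      using S(3) by metis
    define nxt where "nxt x = (x - dig x) / of_nat p" for x
    define y where "y k = (nxt ^^ k) x" for k
    have p0: "(of_nat p :: 'k) \<noteq> 0" using p_pos by simp
    have y1: "nrm (y k) \<le> 1" for k
    proof (induction k)
      case (Suc k)
      have "nrm (y k - dig (y k)) \<le> 1 / real p" using dig[OF Suc] nrm_less_1_imp_le by blast
      then show ?case using p_pos by (simp add: y_def nxt_def nrm_divide nrm_p field_simps)
    qed (simp add: y_def x)
    have ystep: "y k = dig (y k) + of_nat p * y (Suc k)" for k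
      using p0 by (simp add: y_def nxt_def)
    have expand: "x = (\<Sum>k<N. of_nat p ^ k * dig (y k)) + of_nat p ^ N * y N" for N
    proof (induction N)
      case (Suc N)
      have "of_nat p ^ N * y N = of_nat p ^ N * dig (y N) + of_nat p ^ Suc N * y (Suc N)"
        by (subst ystep) (simp add: algebra_simps)
      then show ?case using Suc by simp
    qed (simp add: y_def)
    have "\<forall>s. \<exists>\<alpha>. \<alpha> \<in> Qp \<and> nrm \<alpha> \<le> 1 \<and>
        (\<forall>N. nrm (\<alpha> - (\<Sum>k<N. of_bool (dig (y k) = s) * of_nat p ^ k)) \<le> (1 / real p) ^ N)"
      using sum_p_powers_limit by metis
    then obtain \<alpha> where \<alpha>: "\<And>s. \<alpha> s \<in> Qp" "\<And>s. nrm (\<alpha> s) \<le> 1"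
      "\<And>s N. nrm (\<alpha> s - (\<Sum>k<N. of_bool (dig (y k) = s) * of_nat p ^ k)) \<le> (1 / real p) ^ N"
      by metis
    have close: "nrm (x - (\<Sum>s\<in>S. \<alpha> s * s)) \<le> (1 / real p) ^ N" for N
    proof -
      have "(\<Sum>s\<in>S. (\<Sum>k<N. of_bool (dig (y k) = s) * of_nat p ^ k) * s) =
          (\<Sum>k<N. \<Sum>s\<in>S. of_bool (dig (y k) = s) * of_nat p ^ k * s)"
        unfolding sum_distrib_right by (rule sum.swap)
      also have "\<dots> = (\<Sum>k<N. of_nat p ^ k * dig (y k))"
      proof (rule sum.cong[OF refl])
        fix k
        have "dig (y k) \<in> S" using dig y1 by blast
        then have "(\<Sum>s\<in>S. of_bool (dig (y k) = s) * of_nat p ^ k * s) =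
            (\<Sum>s\<in>{dig (y k)}. of_bool (dig (y k) = s) * of_nat p ^ k * s)"
          using S(1) by (intro sum.mono_neutral_right) auto
        then show "(\<Sum>s\<in>S. of_bool (dig (y k) = s) * of_nat p ^ k * s) = of_nat p ^ k * dig (y k)"
          by simp
      qed
      finally have "x - (\<Sum>s\<in>S. \<alpha> s * s) = of_nat p ^ N * y N -
          (\<Sum>s\<in>S. (\<alpha> s - (\<Sum>k<N. of_bool (dig (y k) = s) * of_nat p ^ k)) * s)"
        using expand[of N] by (simp add: left_diff_distrib sum_subtractf)
      also have "nrm \<dots> \<le> (1 / real p) ^ N"
      proof (rule nrm_diff_le)
        show "nrm (of_nat p ^ N * y N) \<le> (1 / real p) ^ N"
          using y1 by (intro nrm_mult_le') (auto simp: nrm_power nrm_p)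
        show "nrm (\<Sum>s\<in>S. (\<alpha> s - (\<Sum>k<N. of_bool (dig (y k) = s) * of_nat p ^ k)) * s) \<le> (1 / real p) ^ N"
          using \<alpha>(3) S(2) by (intro nrm_sum_le nrm_mult_le') auto
      qed
      finally show ?thesis .
    qed
    have "(\<lambda>N. (1 / real p) ^ N) \<longlonglongrightarrow> 0" using p_gt_1 by (intro LIMSEQ_power_zero) auto
    then have "nrm (x - (\<Sum>s\<in>S. \<alpha> s * s)) \<le> 0"
      by (rule LIMSEQ_le_const) (use close in auto)
    then have "nrm (x - (\<Sum>s\<in>S. \<alpha> s * s)) = 0"
      using nrm_nonneg[of "x - (\<Sum>s\<in>S. \<alpha> s * s)"] by linarith
    then have "x = (\<Sum>s\<in>S. \<alpha> s * s)" by simp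
    then show "\<exists>\<alpha>. (\<forall>s\<in>S. \<alpha> s \<in> Qp \<and> nrm (\<alpha> s) \<le> 1) \<and> x = (\<Sum>s\<in>S. \<alpha> s * s)"
      using \<alpha>(1,2) by (intro exI[of _ \<alpha>] conjI ballI)
  qed
qed

section \<open>The automorphisms and the absolute value\<close>

lemmas tau_hom = field_automorphism_overD[OF tau(1)]
lemmas sigma_hom = field_automorphism_overD[OF sigma]

text \<open>An integer \<open>x\<close> has \<open>\<tau> (x ^ m)\<close> bounded independently of \<open>m\<close>, so \<open>\<tau> x\<close> is integral.\<close>

lemma tau_integral: "nrm x \<le> 1 \<Longrightarrow> nrm (\<tau> x) \<le> 1"
proof -
  assume x: "nrm x \<le> 1"
  obtain S where S: "finite S"
    and gen: "\<forall>x. nrm x \<le> 1 \<longrightarrow>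
      (\<exists>\<alpha>. (\<forall>s\<in>S. \<alpha> s \<in> Qp \<and> nrm (\<alpha> s) \<le> 1) \<and> x = (\<Sum>s\<in>S. \<alpha> s * s))"
    using integers_finitely_generated by (elim exE conjE)
  define C where "C = Max (insert 0 ((\<lambda>s. nrm (\<tau> s)) ` S))"
  have C: "0 \<le> C" "\<And>s. s \<in> S \<Longrightarrow> nrm (\<tau> s) \<le> C" using S by (auto simp: C_def)
  have bnd: "nrm (\<tau> y) \<le> C" if "nrm y \<le> 1" for y
  proof -
    obtain \<alpha> where \<alpha>: "\<And>s. s \<in> S \<Longrightarrow> \<alpha> s \<in> Qp" "\<And>s. s \<in> S \<Longrightarrow> nrm (\<alpha> s) \<le> 1" "y = (\<Sum>s\<in>S. \<alpha> s * s)"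
      using gen[rule_format, OF \<open>nrm y \<le> 1\<close>] by blast
    have "\<tau> y = (\<Sum>s\<in>S. \<alpha> s * \<tau> s)"
      unfolding \<alpha>(3) tau_hom(10)
      using tau_hom(11)[OF subsetD[OF Qp_subset_F \<alpha>(1)]] by (intro sum.cong refl) (simp add: tau_hom(2))
    moreover have "nrm (\<Sum>s\<in>S. \<alpha> s * \<tau> s) \<le> C"
      using \<alpha>(2) C by (intro nrm_sum_le nrm_mult_le)
    ultimately show ?thesis by simp
  qed
  have "nrm (\<tau> x) ^ m \<le> C" for m
  proof -
    have "nrm (\<tau> (x ^ m)) \<le> C" using bnd x by (simp add: nrm_power power_le_one)
    then show ?thesis by (simp add: tau_hom nrm_power)
  qed
  then show ?thesis by (meson linorder_not_le real_arch_pow)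
qed

lemma tau_of_nat [simp]: "\<tau> (of_nat n) = of_nat n"
  by (induction n) (auto simp: tau_hom)

text \<open>If u has absolute value 1, the images of u and of its inverse are both integral and have
  product 1, so neither can be smaller than 1. The general case follows by scaling with an element
  of Q_p.\<close>

lemma tau_isometry [simp]: "nrm (\<tau> x) = nrm x"
proof -
  have unit: "nrm (\<tau> u) = 1" if "nrm u = 1" for u
  proof -
    have "nrm (\<tau> u) \<le> 1" "nrm (\<tau> (inverse u)) \<le> 1"
      using tau_integral[of u] tau_integral[of "inverse u"] that by (auto simp: nrm_inverse)
    moreover have "nrm (\<tau> u) * nrm (\<tau> (inverse u)) = 1"
    proof -
      have "u \<noteq> 0" using that by auto
      then have "\<tau> u * \<tau> (inverse u) = 1" using tau_hom(2)[of u "inverse u"] by (simp add: tau_hom(3))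
      then show ?thesis by (metis nrm_1 nrm_mult)
    qed
    ultimately show ?thesis
      using mult_left_le[of "nrm (\<tau> (inverse u))" "nrm (\<tau> u)"] by simp
  qed
  show ?thesis
  proof (cases "x = 0")
    case False
    then obtain c where c: "c \<in> Qp" "c \<noteq> 0" "nrm c = nrm x" using unit_scaling by metis
    have "nrm (x / c) = 1" using c False by (simp add: nrm_divide)
    then have "nrm (\<tau> (x / c)) = 1" by (rule unit)
    moreover have "\<tau> (x / c) = \<tau> x / c"
      using c Qp_subset_F by (auto simp: divide_inverse tau_hom)
    ultimately show ?thesis using c False by (simp add: nrm_divide)
  qed (simp add: tau_hom)
qed

text \<open>The generator x0 satisfies a monic quadratic equation over F, and
  \<open>\<tau> x0\<close> is its other root. As the sum e of the two roots lies in F, applying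
  \<tau> again returns x0.\<close>

lemma tau_tau [simp]: "\<tau> (\<tau> x) = x"
proof -
  obtain x0 where x0: "\<And>x. \<exists>a\<in>F. \<exists>b\<in>F. x = a + b * x0" using K_generated by metis
  have lin: "\<tau> (a + b * x0) = a + b * \<tau> x0" if "a \<in> F" "b \<in> F" for a b
    using that by (simp add: tau_hom)
  have ne: "\<tau> x0 \<noteq> x0"
  proof
    assume *: "\<tau> x0 = x0"
    have "\<tau> x = x" for x using x0[of x] lin * by auto
    then show False using tau(2) by auto
  qed
  obtain c e where ce: "c \<in> F" "e \<in> F" "x0 * x0 = c + e * x0" using x0 by metis
  have "\<tau> x0 * \<tau> x0 = c + e * \<tau> x0" using lin[OF ce(1,2)] ce(3) by (metis tau_hom(2))
  then have "(\<tau> x0 - x0) * (\<tau> x0 + x0 - e) = 0" using ce(3) by (simp add: algebra_simps)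
  then have "\<tau> x0 + x0 - e = 0" using ne by simp
  then have tx0: "\<tau> x0 = e - x0" by (simp add: algebra_simps)
  obtain a b where ab: "a \<in> F" "b \<in> F" "x = a + b * x0" using x0 by blast
  then show ?thesis using ce tx0 by (simp add: tau_hom)
qed

text \<open>Any nonzero \<open>x - \<tau> x\<close> changes sign under \<tau>, and scaling by an
  element of Q_p preserves this. The element keeps the denominators of the reflection coefficients
  away from the maximal ideal.\<close>

lemma trace_zero_unit:
  obtains \<epsilon> where "\<tau> \<epsilon> = - \<epsilon>" "nrm \<epsilon> = 1"
proof -
  obtain x where x: "\<tau> x \<noteq> x" using tau(2) by (metis eq_id_iff)
  define z where "z = x - \<tau> x"
  have z: "z \<noteq> 0" "\<tau> z = - z" using x by (auto simp: z_def tau_hom)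
  obtain c where c: "c \<in> Qp" "c \<noteq> 0" "nrm c = nrm z" using unit_scaling[OF z(1)] by metis
  show ?thesis
  proof (rule that[of "z / c"])
    show "\<tau> (z / c) = - (z / c)" using z c Qp_subset_F by (auto simp: divide_inverse tau_hom)
    show "nrm (z / c) = 1" using c z by (simp add: nrm_divide)
  qed
qed

lemma sigma_frob: "nrm x \<le> 1 \<Longrightarrow> nrm (\<sigma> x - x ^ p) \<le> 1 / real p"
proof -
  assume "nrm x \<le> 1"
  then obtain y where "nrm y \<le> 1" "\<sigma> x - x ^ p = \<pi> * y"
    using sigma_frobenius integers_UNIV by metis
  then show ?thesis using nrm_pi nrm_mult_le' by simp
qed

lemma sigma_integral: "nrm x \<le> 1 \<Longrightarrow> nrm (\<sigma> x) \<le> 1"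
proof -
  assume x: "nrm x \<le> 1"
  have "nrm (\<sigma> x - x ^ p) \<le> 1" using sigma_frob[OF x] nrm_p_lt_1 nrm_p by simp
  moreover have "nrm (x ^ p) \<le> 1" using x by (simp add: nrm_power power_le_one)
  ultimately show ?thesis using nrm_add_le[of "\<sigma> x - x ^ p" 1 "x ^ p"] by simp
qed

lemma sigma_of_nat: "\<sigma> (of_nat n) = of_nat n"
  by (induction n) (auto simp: sigma_hom)

lemma sigma_le_power:
  assumes "nrm x \<le> (1 / real p) ^ k"
  shows "nrm (\<sigma> x) \<le> (1 / real p) ^ k"
proof -
  have "nrm (x / of_nat p ^ k) \<le> 1" using assms p_pos by (simp add: nrm_divide nrm_power nrm_p field_simps)
  then have "nrm (\<sigma> (x / of_nat p ^ k)) \<le> 1" by (rule sigma_integral)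
  moreover have "\<sigma> (x / of_nat p ^ k) = \<sigma> x / of_nat p ^ k"
    by (simp add: divide_inverse sigma_hom sigma_of_nat)
  ultimately show ?thesis using p_pos by (simp add: nrm_divide nrm_power nrm_p field_simps)
qed

end

subsection \<open>Traces of powers under rank-one updates\<close>

lemma pow_mat_Suc2:
  fixes A :: "'a::semiring_1 mat"
  assumes "A \<in> carrier_mat n n"
  shows "A ^\<^sub>m Suc k = A * A ^\<^sub>m k"
proof (induction k)
  case (Suc k)
  have "A ^\<^sub>m Suc (Suc k) = (A * A ^\<^sub>m k) * A" using Suc by simp
  also have "\<dots> = A * (A ^\<^sub>m k * A)" using assms by (intro assoc_mult_mat) auto
  finally show ?case by simp
qed (use assms in simp)

definition outer_mat :: "nat \<Rightarrow> 'a::comm_ring_1 vec \<Rightarrow> 'a vec \<Rightarrow> 'a mat" where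
  "outer_mat n x z = mat n n (\<lambda>(i, j). x $ i * z $ j)"

lemma outer_mat_carrier [simp]: "outer_mat n x z \<in> carrier_mat n n"
  by (simp add: outer_mat_def)

lemma outer_mat_dim [simp]: "dim_row (outer_mat n x z) = n" "dim_col (outer_mat n x z) = n"
  by (simp_all add: outer_mat_def)

lemma outer_mat_mult_vec:
  assumes "x \<in> carrier_vec n" "z \<in> carrier_vec n" "y \<in> carrier_vec n"
  shows "outer_mat n x z *\<^sub>v y = (z \<bullet> y) \<cdot>\<^sub>v x"
  using assms by (intro eq_vecI) (auto simp: outer_mat_def scalar_prod_def sum_distrib_right sum_distrib_left mult_ac intro!: sum.cong)

lemma mult_outer_mat:
  assumes "A \<in> carrier_mat n n" "x \<in> carrier_vec n" "z \<in> carrier_vec n"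
  shows "A * outer_mat n x z = outer_mat n (A *\<^sub>v x) z"
  using assms by (intro eq_matI) (auto simp: outer_mat_def scalar_prod_def sum_distrib_right sum_distrib_left mult_ac intro!: sum.cong)

lemma outer_mat_mult:
  assumes "A \<in> carrier_mat n n" "x \<in> carrier_vec n" "z \<in> carrier_vec n"
  shows "outer_mat n x z * A = outer_mat n x (transpose_mat A *\<^sub>v z)"
  using assms by (intro eq_matI) (auto simp: outer_mat_def scalar_prod_def sum_distrib_left mult_ac intro!: sum.cong)

lemma mat_trace_add:
  assumes "A \<in> carrier_mat n n" "B \<in> carrier_mat n n"
  shows "mat_trace (A + B) = mat_trace A + mat_trace B"
  using assms by (auto simp: mat_trace_def sum.distrib)

lemma mat_trace_outer: "mat_trace (outer_mat n x z) = (\<Sum>i<n. x $ i * z $ i)"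
  by (simp add: mat_trace_def outer_mat_def)

lemma mat_trace_outer_mult:
  assumes "A \<in> carrier_mat n n" "x \<in> carrier_vec n" "z \<in> carrier_vec n"
  shows "mat_trace (outer_mat n x z * A) = z \<bullet> (A *\<^sub>v x)"
proof -
  have "mat_trace (outer_mat n x z * A) = (\<Sum>i<n. x $ i * (\<Sum>j<n. A $$ (j, i) * z $ j))"
    unfolding outer_mat_mult[OF assms] mat_trace_outer
    using assms by (intro sum.cong refl) (auto simp: scalar_prod_def lessThan_atLeast0)
  also have "\<dots> = (\<Sum>j<n. z $ j * (\<Sum>i<n. A $$ (j, i) * x $ i))"
    by (simp add: sum_distrib_left mult_ac) (rule sum.swap)
  also have "\<dots> = z \<bullet> (A *\<^sub>v x)"
    using assms by (auto simp: scalar_prod_def lessThan_atLeast0 intro!: sum.cong)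
  finally show ?thesis .
qed

text \<open>Newton's identities: \<open>newton_sum \<phi> i\<close> is the \<open>i\<close>-th power sum of the reciprocal roots of
  $1 - \sum_j \varphi_j X^j$.\<close>

function newton_sum :: "(nat \<Rightarrow> 'a::comm_ring_1) \<Rightarrow> nat \<Rightarrow> 'a" where
  "newton_sum \<phi> i = of_nat i * \<phi> i + (\<Sum>j\<in>{1..<i}. \<phi> j * newton_sum \<phi> (i - j))"
  by auto
termination by (relation "Wellfounded.measure snd") auto

declare newton_sum.simps [simp del]

lemma newton_sum_0 [simp]: "newton_sum \<phi> 0 = 0"
  by (subst newton_sum.simps) simp

lemma newton_sum_unique:
  assumes "t 0 = 0" "\<And>i. i > 0 \<Longrightarrow> t i = of_nat i * \<phi> i + (\<Sum>j\<in>{1..<i}. \<phi> j * t (i - j))"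
  shows "t i = newton_sum \<phi> i"
proof (induction i rule: less_induct)
  case (less i)
  show ?case
  proof (cases "i = 0")
    case False
    then show ?thesis using assms(2)[of i] less by (subst newton_sum.simps) auto
  qed (simp add: assms)
qed

text \<open>The constant term is suppressed because \<open>newton_sum \<phi>\<close> does not depend
  on \<open>\<phi> 0\<close>; later that entry holds a value that has no place in the power
  sums.\<close>

definition newton_fps :: "(nat \<Rightarrow> 'a::comm_ring_1) \<Rightarrow> 'a fps" where
  "newton_fps \<phi> = Abs_fps (\<lambda>i. if i = 0 then 0 else \<phi> i)"

text \<open>With f = \<open>newton_fps \<phi>\<close>, comparing coefficients in T = X f' + f T
  gives Newton's recursion. The series T is the negative of X times the logarithmic derivative of 1
  - f.\<close>

lemma newton_sum_fps:
  assumes "(1 - newton_fps \<phi>) * T = fps_X * fps_deriv (newton_fps \<phi>)"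
  shows "fps_nth T i = newton_sum \<phi> i"
proof (rule newton_sum_unique[where t = "fps_nth T"])
  have eq: "T = fps_X * fps_deriv (newton_fps \<phi>) + newton_fps \<phi> * T"
    using assms by (simp add: algebra_simps)
  have nth: "fps_nth T i = (if i = 0 then 0 else of_nat i * \<phi> i + (\<Sum>j=0..i. fps_nth (newton_fps \<phi>) j * fps_nth T (i - j)))" for i
    by (subst eq) (auto simp: newton_fps_def fps_mult_nth[of "Abs_fps _"])
  show "fps_nth T 0 = 0" using nth[of 0] by simp
  fix i :: nat assume i: "i > 0"
  have "(\<Sum>j=0..i. fps_nth (newton_fps \<phi>) j * fps_nth T (i - j)) = (\<Sum>j\<in>{1..<i}. fps_nth (newton_fps \<phi>) j * fps_nth T (i - j))"
    using \<open>fps_nth T 0 = 0\<close> i by (intro sum.mono_neutral_right) (auto simp: newton_fps_def)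
  also have "\<dots> = (\<Sum>j\<in>{1..<i}. \<phi> j * fps_nth T (i - j))"
    by (intro sum.cong) (auto simp: newton_fps_def)
  finally show "fps_nth T i = of_nat i * \<phi> i + (\<Sum>j\<in>{1..<i}. \<phi> j * fps_nth T (i - j))"
    using nth[of i] i by simp
qed

text \<open>Behind this is the matrix determinant lemma: det(1 - X N) / det(1 - X M) = 1 - X z^T (1
  - X M)^(-1) x, whose coefficients are the given \<phi>. The proof avoids determinants: it replaces
  the factors N of N^i by M one at a time and sums the rank-one errors.\<close>

lemma mat_trace_power_rank_one_update:
  fixes M :: "'a::field mat"
  assumes M: "M \<in> carrier_mat n n" and x: "x \<in> carrier_vec n" and z: "z \<in> carrier_vec n"
  defines "N \<equiv> M + outer_mat n x z"
  shows "mat_trace (N ^\<^sub>m i) - mat_trace (M ^\<^sub>m i) = newton_sum (\<lambda>j. z \<bullet> ((M ^\<^sub>m (j - 1)) *\<^sub>v x)) i"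
proof -
  have N: "N \<in> carrier_mat n n" using M by (simp add: N_def)
  have pM: "M ^\<^sub>m k \<in> carrier_mat n n" and pN: "N ^\<^sub>m k \<in> carrier_mat n n" for k using M N by auto
  define \<phi> where "\<phi> j = z \<bullet> ((M ^\<^sub>m (j - 1)) *\<^sub>v x)" for j
  \<comment> \<open>\<open>g a b\<close> is the trace of the error term M^a x z^T N^b left when one
    factor N between M^a and N^b is replaced by M.\<close>
  define g where "g a b = z \<bullet> ((N ^\<^sub>m b) *\<^sub>v ((M ^\<^sub>m a) *\<^sub>v x))" for a b
  have g0: "g a 0 = \<phi> (Suc a)" for a
    using N pM[of a] x by (simp add: g_def \<phi>_def carrier_matD[OF N])
  \<comment> \<open>Moving one N past M^a x costs a multiple of x itself, since N M^a x = M^(a+1) x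
    + \<phi>(a+1) x.\<close>
  have gS: "g a (Suc b) = g (Suc a) b + g 0 b * \<phi> (Suc a)" for a b
  proof -
    let ?y = "(M ^\<^sub>m a) *\<^sub>v x"
    have y: "?y \<in> carrier_vec n" using pM x by (rule mult_mat_vec_carrier)
    have My: "M *\<^sub>v ?y = (M ^\<^sub>m Suc a) *\<^sub>v x"
      unfolding pow_mat_Suc2[OF M] by (rule assoc_mult_mat_vec[OF M pM x, symmetric])
    have "N *\<^sub>v ?y = M *\<^sub>v ?y + outer_mat n x z *\<^sub>v ?y"
      unfolding N_def by (rule add_mult_distrib_mat_vec[OF M _ y]) simp
    also have "\<dots> = (M ^\<^sub>m Suc a) *\<^sub>v x + \<phi> (Suc a) \<cdot>\<^sub>v x"
      unfolding outer_mat_mult_vec[OF x z y] My by (simp add: \<phi>_def)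
    finally have Ny: "N *\<^sub>v ?y = (M ^\<^sub>m Suc a) *\<^sub>v x + \<phi> (Suc a) \<cdot>\<^sub>v x" .
    have c: "(M ^\<^sub>m Suc a) *\<^sub>v x \<in> carrier_vec n" using pM x by (rule mult_mat_vec_carrier)
    have "(N ^\<^sub>m Suc b) *\<^sub>v ?y = (N ^\<^sub>m b) *\<^sub>v (N *\<^sub>v ?y)"
      using assoc_mult_mat_vec[OF pN[of b] N y] by simp
    also have "\<dots> = (N ^\<^sub>m b) *\<^sub>v ((M ^\<^sub>m Suc a) *\<^sub>v x) + \<phi> (Suc a) \<cdot>\<^sub>v ((N ^\<^sub>m b) *\<^sub>v x)"
      unfolding Ny using mult_add_distrib_mat_vec[OF pN[of b] c, of "\<phi> (Suc a) \<cdot>\<^sub>v x"] mult_mat_vec[OF pN[of b] x] x by simp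
    finally have "g a (Suc b) = z \<bullet> ((N ^\<^sub>m b) *\<^sub>v ((M ^\<^sub>m Suc a) *\<^sub>v x) + \<phi> (Suc a) \<cdot>\<^sub>v ((N ^\<^sub>m b) *\<^sub>v x))"
      by (simp only: g_def)
    also have "\<dots> = g (Suc a) b + \<phi> (Suc a) * (z \<bullet> ((N ^\<^sub>m b) *\<^sub>v x))"
      unfolding g_def using z pN[of b] c x
      by (subst scalar_prod_add_distrib[of _ n]) (auto intro!: mult_mat_vec_carrier)
    also have "z \<bullet> ((N ^\<^sub>m b) *\<^sub>v x) = g 0 b" using x M by (simp add: g_def carrier_matD[OF M])
    finally show ?thesis by (simp add: mult.commute)
  qed
  have step: "mat_trace (M ^\<^sub>m a * N ^\<^sub>m Suc b) = mat_trace (M ^\<^sub>m Suc a * N ^\<^sub>m b) + g a b" for a b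
  proof -
    have "M ^\<^sub>m a * N ^\<^sub>m Suc b = (M ^\<^sub>m a * N) * N ^\<^sub>m b"
      unfolding pow_mat_Suc2[OF N] by (rule assoc_mult_mat[OF pM[of a] N pN[of b], symmetric])
    also have "M ^\<^sub>m a * N = M ^\<^sub>m Suc a + outer_mat n ((M ^\<^sub>m a) *\<^sub>v x) z"
      unfolding N_def using pM[of a] M x z
      by (simp add: mult_add_distrib_mat[of _ n n] mult_outer_mat)
    also have "(M ^\<^sub>m Suc a + outer_mat n ((M ^\<^sub>m a) *\<^sub>v x) z) * N ^\<^sub>m b =
        M ^\<^sub>m Suc a * N ^\<^sub>m b + outer_mat n ((M ^\<^sub>m a) *\<^sub>v x) z * N ^\<^sub>m b"
      using pM[of "Suc a"] pN[of b] by (intro add_mult_distrib_mat) auto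
    finally have "mat_trace (M ^\<^sub>m a * N ^\<^sub>m Suc b) =
        mat_trace (M ^\<^sub>m Suc a * N ^\<^sub>m b) + mat_trace (outer_mat n ((M ^\<^sub>m a) *\<^sub>v x) z * N ^\<^sub>m b)"
      using pM[of "Suc a"] pN[of b] by (simp only: mat_trace_add[of _ n] mult_carrier_mat[of _ n n _ n] outer_mat_carrier)
    then show ?thesis
      unfolding g_def using mat_trace_outer_mult[OF pN[of b] mult_mat_vec_carrier[OF pM[of a] x] z] by simp
  qed
  have tele: "mat_trace (N ^\<^sub>m i) = mat_trace (M ^\<^sub>m a * N ^\<^sub>m (i - a)) + (\<Sum>k<a. g k (i - 1 - k))" if "a \<le> i" for a i
    using that
  proof (induction a)
    case 0
    then show ?case using M left_mult_one_mat[OF pN[of i]] by simp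
  next
    case (Suc a)
    then have "mat_trace (M ^\<^sub>m a * N ^\<^sub>m (i - a)) = mat_trace (M ^\<^sub>m Suc a * N ^\<^sub>m (i - Suc a)) + g a (i - Suc a)"
      using step[of a "i - Suc a"] by (simp add: Suc_diff_Suc)
    then show ?case using Suc by simp
  qed
  have T: "mat_trace (N ^\<^sub>m i) - mat_trace (M ^\<^sub>m i) = (\<Sum>k<i. g k (i - 1 - k))" for i
    using tele[of i i] right_mult_one_mat[OF pM[of i]] N by simp
  have gexp: "g a b = \<phi> (Suc (a + b)) + (\<Sum>k<b. g 0 k * \<phi> (a + b - k))" for a b
  proof (induction b arbitrary: a)
    case (Suc b)
    have "g a (Suc b) = \<phi> (Suc (Suc a + b)) + (\<Sum>k<b. g 0 k * \<phi> (Suc a + b - k)) + g 0 b * \<phi> (Suc a)"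
      unfolding gS Suc by simp
    then show ?case by simp
  qed (simp add: g0)
  define T where "T = Abs_fps (\<lambda>i. mat_trace (N ^\<^sub>m i) - mat_trace (M ^\<^sub>m i))"
  \<comment> \<open>H is the inverse of \<open>1 - newton_fps \<phi>\<close>: the case a = 0 of
    \<open>gexp\<close> is exactly the recursion of that inverse.\<close>
  define H where "H = Abs_fps (\<lambda>i. if i = 0 then 1 else g 0 (i - 1))"
  have "(1 - newton_fps \<phi>) * H = 1"
  proof (rule fps_ext)
    fix i
    show "fps_nth ((1 - newton_fps \<phi>) * H) i = fps_nth 1 i"
    proof (cases i)
      case 0
      then show ?thesis by (simp add: newton_fps_def H_def)
    next
      case (Suc m)
      have "fps_nth (newton_fps \<phi> * H) i = (\<Sum>k=0..Suc m. fps_nth H k * fps_nth (newton_fps \<phi>) (Suc m - k))"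
        by (subst mult.commute) (simp add: fps_mult_nth Suc)
      also have "\<dots> = fps_nth (newton_fps \<phi>) (Suc m) + (\<Sum>k=0..m. fps_nth H (Suc k) * fps_nth (newton_fps \<phi>) (m - k))"
        by (subst sum.atLeast0_atMost_Suc_shift) (simp add: H_def)
      also have "(\<Sum>k=0..m. fps_nth H (Suc k) * fps_nth (newton_fps \<phi>) (m - k)) = (\<Sum>k<m. g 0 k * \<phi> (m - k))"
        by (rule sum.mono_neutral_cong_right) (auto simp: H_def newton_fps_def)
      also have "fps_nth (newton_fps \<phi>) (Suc m) + (\<Sum>k<m. g 0 k * \<phi> (m - k)) = g 0 m"
        using gexp[of 0 m] by (simp add: newton_fps_def)
      finally show ?thesis by (simp add: Suc left_diff_distrib H_def)
    qed
  qed
  moreover have "T = fps_X * fps_deriv (newton_fps \<phi>) * H"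
  proof (rule fps_ext)
    fix i
    show "fps_nth T i = fps_nth (fps_X * fps_deriv (newton_fps \<phi>) * H) i"
    proof (cases i)
      case 0
      then show ?thesis using N M by (simp add: T_def mult.assoc)
    next
      case (Suc m)
      have "fps_nth T i = (\<Sum>l<i. g l (m - l))" by (simp add: T_def T Suc)
      also have "\<dots> = (\<Sum>l<i. \<phi> i + (\<Sum>k<m - l. g 0 k * \<phi> (m - k)))"
        by (rule sum.cong) (auto simp: gexp[of _ "m - _"] Suc)
      also have "\<dots> = of_nat i * \<phi> i + (\<Sum>l<i. \<Sum>k<m - l. g 0 k * \<phi> (m - k))"
        by (simp add: sum.distrib)
      \<comment> \<open>For fixed k the summand does not depend on l, and l takes m - k values;
        these multiplicities are the coefficients of the formal derivative.\<close>
      also have "(\<Sum>l<i. \<Sum>k<m - l. g 0 k * \<phi> (m - k)) = (\<Sum>l<i. \<Sum>k<m. of_bool (k < m - l) * (g 0 k * \<phi> (m - k)))"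
        by (intro sum.cong refl sum.mono_neutral_cong_left) auto
      also have "\<dots> = (\<Sum>k<m. \<Sum>l<i. of_bool (k < m - l) * (g 0 k * \<phi> (m - k)))"
        by (rule sum.swap)
      also have "\<dots> = (\<Sum>k<m. of_nat (m - k) * (g 0 k * \<phi> (m - k)))"
      proof (rule sum.cong[OF refl])
        fix k
        have "(\<Sum>l<i. of_bool (k < m - l) * (g 0 k * \<phi> (m - k))) = (\<Sum>l<m - k. g 0 k * \<phi> (m - k))"
          by (rule sum.mono_neutral_cong_right) (auto simp: Suc)
        then show "(\<Sum>l<i. of_bool (k < m - l) * (g 0 k * \<phi> (m - k))) = of_nat (m - k) * (g 0 k * \<phi> (m - k))"
          by simp
      qed
      also have "\<dots> = (\<Sum>k=0..m. fps_nth H (Suc k) * fps_nth (fps_X * fps_deriv (newton_fps \<phi>)) (m - k))"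
        by (rule sum.mono_neutral_cong_left) (auto simp: H_def newton_fps_def mult_ac Suc_diff_Suc)
      also have "of_nat i * \<phi> i + \<dots> = (\<Sum>k=0..Suc m. fps_nth H k * fps_nth (fps_X * fps_deriv (newton_fps \<phi>)) (Suc m - k))"
        by (simp only: sum.atLeast0_atMost_Suc_shift o_def diff_Suc_Suc) (simp add: H_def newton_fps_def Suc)
      also have "\<dots> = fps_nth (H * (fps_X * fps_deriv (newton_fps \<phi>))) i" by (simp add: fps_mult_nth Suc)
      finally show ?thesis by (simp add: mult.commute)
    qed
  qed
  ultimately have "(1 - newton_fps \<phi>) * T = fps_X * fps_deriv (newton_fps \<phi>)"
    by (metis mult.left_commute mult.right_neutral)
  from newton_sum_fps[OF this, of i] show ?thesis by (simp add: T_def \<phi>_def[abs_def])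
qed

subsection \<open>Dwork's congruence\<close>

definition fps_geometric :: "'a::comm_ring_1 \<Rightarrow> nat \<Rightarrow> 'a fps" where
  "fps_geometric b l = Abs_fps (\<lambda>i. if l dvd i then b ^ (i div l) else 0)"

lemma fps_geometric_inverse:
  assumes "l > 0"
  shows "(1 - fps_const b * fps_X ^ l) * fps_geometric b l = 1"
proof (rule fps_ext)
  fix i
  have "fps_nth (fps_const b * (fps_X ^ l * fps_geometric b l)) i = (if i = 0 then 0 else fps_nth (fps_geometric b l) i)"
  proof (cases "i < l")
    case True
    then show ?thesis using assms by (auto simp: fps_X_power_mult_nth fps_geometric_def dvd_imp_le)
  next
    case False
    then have *: "l dvd i \<longleftrightarrow> l dvd i - l" by (simp add: dvd_minus_self)
    have "l dvd i \<Longrightarrow> i div l = Suc ((i - l) div l)" using False assms by (metis le_div_geq not_less)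
    then show ?thesis using False assms * by (auto simp: fps_X_power_mult_nth fps_geometric_def)
  qed
  then show "fps_nth ((1 - fps_const b * fps_X ^ l) * fps_geometric b l) i = fps_nth 1 i"
    by (simp add: left_diff_distrib mult.assoc) (simp add: fps_geometric_def)
qed

text \<open>For constant term 1 this is the generating series of the power sums of the reciprocal
  roots; it turns products into sums.\<close>

definition neg_log_deriv :: "'a::field fps \<Rightarrow> 'a fps" where
  "neg_log_deriv f = - (fps_X * fps_deriv f * inverse f)"

lemma neg_log_deriv_mult:
  assumes "fps_nth f 0 = 1" "fps_nth g 0 = 1"
  shows "neg_log_deriv (f * g) = neg_log_deriv f + neg_log_deriv g"
proof -
  have i: "inverse f * f = 1" "inverse g * g = 1" using assms by (simp_all add: inverse_mult_eq_1)
  have "inverse (f * g) = inverse f * inverse g" by (rule fps_inverse_mult)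
  moreover have "fps_X * (f * fps_deriv g + fps_deriv f * g) * (inverse f * inverse g) =
      fps_X * fps_deriv g * inverse g * (inverse f * f) + fps_X * fps_deriv f * inverse f * (inverse g * g)"
    by (simp add: algebra_simps)
  ultimately show ?thesis by (simp add: neg_log_deriv_def i)
qed

lemma neg_log_deriv_newton: "fps_nth (neg_log_deriv (1 - newton_fps \<phi>)) i = newton_sum \<phi> i"
proof (rule newton_sum_fps)
  have "fps_nth (1 - newton_fps \<phi>) 0 \<noteq> 0" by (simp add: newton_fps_def)
  then have "inverse (1 - newton_fps \<phi>) * (1 - newton_fps \<phi>) = 1" by (rule inverse_mult_eq_1)
  then show "(1 - newton_fps \<phi>) * neg_log_deriv (1 - newton_fps \<phi>) = fps_X * fps_deriv (newton_fps \<phi>)"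
    by (simp add: neg_log_deriv_def) (metis mult.left_commute mult.right_neutral mult.commute)
qed

lemma neg_log_deriv_factor:
  assumes "l > 0"
  shows "fps_nth (neg_log_deriv (1 - fps_const b * fps_X ^ l)) i =
    (if l dvd i \<and> i > 0 then of_nat l * b ^ (i div l) else 0)"
proof -
  have inv: "inverse (1 - fps_const b * fps_X ^ l) = fps_geometric b l"
  proof -
    have "fps_nth (1 - fps_const b * fps_X ^ l) 0 \<noteq> 0" using assms by simp
    then show ?thesis using fps_geometric_inverse[OF assms, of b]
      by (metis fps_inverse_unique mult.commute)
  qed
  have "fps_X * fps_deriv (1 - fps_const b * fps_X ^ l) = - (fps_const (of_nat l * b) * fps_X ^ l)"
  proof (rule fps_ext)
    fix i
    show "fps_nth (fps_X * fps_deriv (1 - fps_const b * fps_X ^ l)) i =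
        fps_nth (- (fps_const (of_nat l * b) * fps_X ^ l)) i"
      using assms by (cases i) (auto simp: fps_X_power_nth)
  qed
  then have "neg_log_deriv (1 - fps_const b * fps_X ^ l) = fps_const (of_nat l * b) * (fps_X ^ l * fps_geometric b l)"
    by (simp add: neg_log_deriv_def inv mult.assoc)
  then have *: "fps_nth (neg_log_deriv (1 - fps_const b * fps_X ^ l)) i =
      of_nat l * b * (if i < l then 0 else fps_nth (fps_geometric b l) (i - l))"
    by (simp add: fps_X_power_mult_nth)
  show ?thesis
  proof (cases "i < l")
    case True
    then have "\<not> (l dvd i \<and> i > 0)" by (auto dest: dvd_imp_le)
    then show ?thesis using * True by auto
  next
    case False
    then have "l dvd i \<longleftrightarrow> l dvd i - l" by (simp add: dvd_minus_self)
    moreover have "l dvd i \<Longrightarrow> i div l = Suc ((i - l) div l)" using False assms by (metis le_div_geq not_less)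
    ultimately show ?thesis using * False assms by (auto simp: fps_geometric_def)
  qed
qed

section \<open>Integral factorization and congruences between powers\<close>

context unramified_quadratic
begin

definition integral_fps :: "'k fps \<Rightarrow> bool" where
  "integral_fps f \<longleftrightarrow> (\<forall>i. nrm (fps_nth f i) \<le> 1)"

lemma integral_fps_mult: "integral_fps f \<Longrightarrow> integral_fps g \<Longrightarrow> integral_fps (f * g)"
  by (auto simp: integral_fps_def fps_mult_nth intro!: nrm_sum_le nrm_mult_le_one)

text \<open>Factors 1 - b_l X^l are split off greedily, each chosen to kill the lowest remaining
  coefficient. Dividing by such a factor multiplies by an integral geometric series, so integrality
  survives. The b_l are the coordinates of f as a big Witt vector; stopping at m avoids infinite
  products.\<close>

lemma fps_factorization:
  assumes "fps_nth f 0 = 1" "integral_fps f"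
  shows "\<exists>b g. (\<forall>l. nrm (b l) \<le> 1) \<and> fps_nth g 0 = 1 \<and> integral_fps g \<and> (\<forall>j\<in>{1..m}. fps_nth g j = 0) \<and>
    neg_log_deriv f = neg_log_deriv g + (\<Sum>l=1..m. neg_log_deriv (1 - fps_const (b l) * fps_X ^ l))"
proof (induction m)
  case 0
  show ?case using assms by (intro exI[of _ "\<lambda>_. 0"] exI[of _ f]) auto
next
  case (Suc m)
  then obtain b g where b: "\<forall>l. nrm (b l) \<le> 1" and g: "fps_nth g 0 = 1" "integral_fps g" "\<forall>j\<in>{1..m}. fps_nth g j = 0"
    and L: "neg_log_deriv f = neg_log_deriv g + (\<Sum>l=1..m. neg_log_deriv (1 - fps_const (b l) * fps_X ^ l))"
    by blast
  \<comment> \<open>The geometric series contributes c in degree \<open>Suc m\<close>, which cancels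
    the coefficient of g there and leaves the lower ones zero.\<close>
  define c where "c = - fps_nth g (Suc m)"
  have c: "nrm c \<le> 1" using g by (simp add: c_def integral_fps_def)
  define g' where "g' = g * fps_geometric c (Suc m)"
  have geo0: "fps_nth (fps_geometric c (Suc m)) j = (if j = 0 then 1 else if j = Suc m then c else 0)" if "j \<le> Suc m" for j
    using that by (auto simp: fps_geometric_def dest: dvd_imp_le)
  have g'0: "fps_nth g' 0 = 1" using g geo0[of 0] by (simp add: g'_def)
  have int_geo: "integral_fps (fps_geometric c (Suc m))"
    using c by (auto simp: integral_fps_def fps_geometric_def nrm_power power_le_one)
  have g'int: "integral_fps g'" unfolding g'_def using g int_geo by (intro integral_fps_mult)
  have g'z: "fps_nth g' j = 0" if "j \<in> {1..Suc m}" for j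
  proof -
    have "fps_nth g' j = (\<Sum>i=0..j. fps_nth g i * fps_nth (fps_geometric c (Suc m)) (j - i))"
      by (simp add: g'_def fps_mult_nth)
    also have "\<dots> = (\<Sum>i\<in>{0, j}. fps_nth g i * fps_nth (fps_geometric c (Suc m)) (j - i))"
      using that g(3) by (intro sum.mono_neutral_right) (auto simp: geo0)
    also have "\<dots> = fps_nth (fps_geometric c (Suc m)) j + fps_nth g j"
      using that g(1) geo0[of 0] by auto
    also have "\<dots> = 0"
    proof (cases "j = Suc m")
      case True
      then show ?thesis using geo0[of j] by (simp add: c_def)
    next
      case False
      then show ?thesis using geo0[of j] that g(3) by auto
    qed
    finally show ?thesis .
  qed
  have geq: "g = g' * (1 - fps_const c * fps_X ^ Suc m)"
    using fps_geometric_inverse[of "Suc m" c] by (simp add: g'_def mult.assoc mult.commute[of "fps_geometric c (Suc m)"])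
  have Lg: "neg_log_deriv g = neg_log_deriv g' + neg_log_deriv (1 - fps_const c * fps_X ^ Suc m)"
    by (subst geq, rule neg_log_deriv_mult) (simp_all add: g'0)
  show ?case
  proof (intro exI[of _ "b(Suc m := c)"] exI[of _ g'] conjI)
    have "(\<Sum>l=1..m. neg_log_deriv (1 - fps_const ((b(Suc m := c)) l) * fps_X ^ l)) =
        (\<Sum>l=1..m. neg_log_deriv (1 - fps_const (b l) * fps_X ^ l))"
      by (intro sum.cong) auto
    then show "neg_log_deriv f = neg_log_deriv g' +
        (\<Sum>l=1..Suc m. neg_log_deriv (1 - fps_const ((b(Suc m := c)) l) * fps_X ^ l))"
      using L Lg by (simp add: ac_simps)
  qed (use b c g'0 g'int g'z in auto)
qed

text \<open>These are the ghost components of the Witt coordinates: a factor 1 - b X^l contributes l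
  b^(i/l) when l divides i, and the remaining cofactor is 1 modulo X^(m+1).\<close>

lemma newton_sum_divisor_form:
  assumes "\<And>i. nrm (\<phi> i) \<le> 1"
  shows "\<exists>b. (\<forall>l. nrm (b l) \<le> 1) \<and>
    (\<forall>i\<in>{1..m}. newton_sum \<phi> i = (\<Sum>l | l dvd i. of_nat l * b l ^ (i div l)))"
proof -
  let ?f = "1 - newton_fps \<phi>"
  have "fps_nth ?f 0 = 1" by (simp add: newton_fps_def)
  moreover have "integral_fps ?f"
    using assms by (auto simp: integral_fps_def newton_fps_def)
  ultimately obtain b g where b: "\<forall>l. nrm (b l) \<le> 1" and g: "fps_nth g 0 = 1" "\<forall>j\<in>{1..m}. fps_nth g j = 0"
    and L: "neg_log_deriv ?f = neg_log_deriv g + (\<Sum>l=1..m. neg_log_deriv (1 - fps_const (b l) * fps_X ^ l))"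
    using fps_factorization[of ?f m] by blast
  have gz: "fps_nth (neg_log_deriv g) i = 0" if "i \<le> m" for i
  proof -
    have "fps_nth (fps_X * fps_deriv g) j = 0" if "j \<le> m" for j
      using that g(2) by (cases j) auto
    then show ?thesis using that by (auto simp: neg_log_deriv_def fps_mult_nth[of "fps_X * fps_deriv g"] intro!: sum.neutral)
  qed
  show ?thesis
  proof (intro exI[of _ b] conjI b ballI)
    fix i assume i: "i \<in> {1..m}"
    have "newton_sum \<phi> i = (\<Sum>l=1..m. if l dvd i \<and> i > 0 then of_nat l * b l ^ (i div l) else 0)"
      using i gz[of i] L neg_log_deriv_newton[of \<phi> i] by (simp add: fps_sum_nth neg_log_deriv_factor)
    also have "\<dots> = (\<Sum>l | l dvd i. of_nat l * b l ^ (i div l))"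
    proof (rule sum.mono_neutral_cong_right)
      show "{l. l dvd i} \<subseteq> {1..m}"
      proof
        fix l assume "l \<in> {l. l dvd i}"
        then show "l \<in> {1..m}" using i dvd_imp_le[of l i] dvd_pos_nat[of i l] by auto
      qed
    qed (use i in auto)
    finally show "newton_sum \<phi> i = (\<Sum>l | l dvd i. of_nat l * b l ^ (i div l))" .
  qed
qed

lemma nrm_power_le_one: "nrm x \<le> 1 \<Longrightarrow> nrm (x ^ n) \<le> 1"
  by (simp add: nrm_power power_le_one)

lemma nrm_power_diff_le:
  assumes "nrm x \<le> 1" "nrm y \<le> 1"
  shows "nrm (x ^ m - y ^ m) \<le> nrm (x - y)"
  unfolding power_diff_sumr2 using assms
  by (intro nrm_mult_le' nrm_sum_le nrm_mult_le_one nrm_power_le_one) auto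

text \<open>In x^p - y^p = (x - y) S, the cofactor S is congruent modulo p to p y^(p-1), hence
  divisible by p.\<close>

lemma nrm_power_p_diff_le:
  assumes "nrm x \<le> 1" "nrm y \<le> 1" "nrm (x - y) \<le> 1 / real p"
  shows "nrm (x ^ p - y ^ p) \<le> nrm (x - y) * (1 / real p)"
proof -
  have "nrm ((\<Sum>i<p. y ^ (p - Suc i) * x ^ i) - (\<Sum>i<p. y ^ (p - Suc i) * y ^ i)) \<le> 1 / real p"
    unfolding sum_subtractf[symmetric] right_diff_distrib[symmetric]
    using assms nrm_power_diff_le[OF assms(1,2)]
    by (intro nrm_sum_le nrm_mult_le nrm_power_le_one) (auto intro: order_trans)
  moreover have "(\<Sum>i<p. y ^ (p - Suc i) * y ^ i) = of_nat p * y ^ (p - 1)"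
    by (simp flip: power_add)
  moreover have "nrm (of_nat p * y ^ (p - 1)) \<le> 1 / real p"
    using assms by (intro nrm_mult_le' nrm_power_le_one) (auto simp: nrm_p)
  ultimately have "nrm (\<Sum>i<p. y ^ (p - Suc i) * x ^ i) \<le> 1 / real p"
    using nrm_add_le[of "(\<Sum>i<p. y ^ (p - Suc i) * x ^ i) - (\<Sum>i<p. y ^ (p - Suc i) * y ^ i)" _ "\<Sum>i<p. y ^ (p - Suc i) * y ^ i"]
    by simp
  then show ?thesis unfolding power_diff_sumr2[of x p y] nrm_mult by (intro mult_left_mono) auto
qed

text \<open>Every p-th power gains a factor 1/p, and there are as many of them as m has factors p;
  the part of m prime to p preserves the bound.\<close>

lemma nrm_power_diff_le_exponent:
  assumes "nrm x \<le> 1" "nrm y \<le> 1" "nrm (x - y) \<le> 1 / real p" "m > 0"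
  shows "nrm (x ^ m - y ^ m) \<le> (1 / real p) * nrm (of_nat m)"
proof -
  have "\<not> is_unit p" using p_gt_1 by simp
  then obtain m0 where m0: "m = p ^ multiplicity p m * m0" "\<not> p dvd m0"
    using multiplicity_decompose'[of m p] assms(4) by blast
  define v where "v = multiplicity p m"
  have *: "nrm (x ^ (p ^ v) - y ^ (p ^ v)) \<le> (1 / real p) ^ Suc v" for v
  proof (induction v)
    case (Suc v)
    have "(1 / real p) ^ Suc v \<le> (1 / real p) ^ 1" using p_gt_1 by (intro power_decreasing) auto
    then have "nrm ((x ^ (p ^ v)) ^ p - (y ^ (p ^ v)) ^ p) \<le> nrm (x ^ (p ^ v) - y ^ (p ^ v)) * (1 / real p)"
      using Suc assms by (intro nrm_power_p_diff_le nrm_power_le_one) auto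
    also have "\<dots> \<le> (1 / real p) ^ Suc v * (1 / real p)" using Suc by (intro mult_right_mono) auto
    finally show ?case by (simp add: power_mult[symmetric] mult.commute)
  qed (use assms in simp)
  have "x ^ m = (x ^ p ^ v) ^ m0" "y ^ m = (y ^ p ^ v) ^ m0"
    using m0(1) v_def by (metis power_mult)+
  then have "nrm (x ^ m - y ^ m) \<le> (1 / real p) ^ Suc v"
    using *[of v] nrm_power_diff_le[of "x ^ p ^ v" "y ^ p ^ v" m0]
      nrm_power_le_one[OF assms(1)] nrm_power_le_one[OF assms(2)]
    by simp
  then show ?thesis using nrm_of_nat[OF assms(4)] by (simp add: v_def)
qed

text \<open>Writing \<open>1 - newton_fps \<phi>\<close> as a product of factors $1 - b_l X^l$ turns its power sums into
  $\sum_{l \mid i} l b_l^{i/l}$, where each summand is congruent to its Frobenius image.\<close>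

lemma newton_sum_congruence:
  assumes "\<And>i. nrm (\<phi> i) \<le> 1" "i > 0"
  shows "nrm (newton_sum \<phi> i - of_bool (p dvd i) * \<sigma> (newton_sum \<phi> (i div p))) \<le> nrm (of_nat i)"
proof -
  obtain b where "(\<forall>l. nrm (b l) \<le> 1) \<and>
      (\<forall>j\<in>{1..i}. newton_sum \<phi> j = (\<Sum>l | l dvd j. of_nat l * b l ^ (j div l)))"
    using newton_sum_divisor_form[of \<phi> i, OF assms(1)] by (elim exE)
  then have b: "\<And>l. nrm (b l) \<le> 1"
    and div: "\<And>j. j \<in> {1..i} \<Longrightarrow> newton_sum \<phi> j = (\<Sum>l | l dvd j. of_nat l * b l ^ (j div l))"
    by simp_all
  \<comment> \<open>The divisors of i/p are the divisors l of i with p dividing i/l. This lets the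
    Frobenius term be subtracted summand by summand.\<close>
  have "of_bool (p dvd i) * \<sigma> (newton_sum \<phi> (i div p)) =
      (\<Sum>l | l dvd i. of_bool (p dvd i div l) * (of_nat l * \<sigma> (b l) ^ (i div l div p)))"
  proof (cases "p dvd i")
    case True
    then obtain j where j: "i = p * j" by auto
    then have jpos: "j > 0" "i div p = j" using assms(2) p_pos by auto
    have "j \<in> {1..i}" using jpos j p_pos by auto
    then have "\<sigma> (newton_sum \<phi> j) = (\<Sum>l | l dvd j. of_nat l * \<sigma> (b l) ^ (j div l))"
      by (simp add: div sigma_hom sigma_of_nat)
    also have "\<dots> = (\<Sum>l | l dvd i. of_bool (p dvd i div l) * (of_nat l * \<sigma> (b l) ^ (i div l div p)))"
    proof (rule sum.mono_neutral_cong_left)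
      show "\<forall>l\<in>{l. l dvd i} - {l. l dvd j}. of_bool (p dvd i div l) * (of_nat l * \<sigma> (b l) ^ (i div l div p)) = 0"
      proof
        fix l assume l: "l \<in> {l. l dvd i} - {l. l dvd j}"
        have "\<not> p dvd i div l"
        proof
          assume "p dvd i div l"
          then have "l * p dvd i" using l by (auto simp: dvd_def mult.assoc)
          then have "l dvd j" using j p_pos by (simp add: mult.commute)
          then show False using l by simp
        qed
        then show "of_bool (p dvd i div l) * (of_nat l * \<sigma> (b l) ^ (i div l div p)) = 0" by simp
      qed
      fix l assume "l \<in> {l. l dvd j}"
      then obtain c where c: "j = l * c" by auto
      then have "l > 0" using jpos by auto
      then have "i div l = p * c" "j div l = c" using c j by (auto simp: mult.left_commute)
      then show "of_nat l * \<sigma> (b l) ^ (j div l) =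
          of_bool (p dvd i div l) * (of_nat l * \<sigma> (b l) ^ (i div l div p))" using p_pos by simp
    qed (use j assms(2) in auto)
    finally show ?thesis using True jpos by simp
  next
    case False
    then have "\<not> p dvd i div l" if "l dvd i" for l
      using that by (metis dvd_div_mult_self dvd_mult2)
    then show ?thesis using False by (auto intro!: sum.neutral[symmetric])
  qed
  then have "newton_sum \<phi> i - of_bool (p dvd i) * \<sigma> (newton_sum \<phi> (i div p)) =
      (\<Sum>l | l dvd i. of_nat l * b l ^ (i div l) - of_bool (p dvd i div l) * (of_nat l * \<sigma> (b l) ^ (i div l div p)))"
    using div[of i] assms(2) by (simp add: sum_subtractf)
  also have "nrm \<dots> \<le> nrm (of_nat i)"
  proof (rule nrm_sum_le)
    fix l assume "l \<in> {l. l dvd i}"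
    then obtain m where m: "i = l * m" by auto
    then have pos: "l > 0" "m > 0" using assms(2) by auto
    have im: "i div l = m" using m pos by simp
    \<comment> \<open>For m = i/l divisible by p, the congruence of \<open>b l ^ p\<close> and
      \<open>\<sigma> (b l)\<close> modulo p is raised to the power m/p; the gains from l, p and m/p
      multiply to that of i. Otherwise l and i have the same absolute value already.\<close>
    show "nrm (of_nat l * b l ^ (i div l) - of_bool (p dvd i div l) * (of_nat l * \<sigma> (b l) ^ (i div l div p))) \<le> nrm (of_nat i)"
    proof (cases "p dvd m")
      case True
      then obtain m' where m': "m = p * m'" by auto
      then have "m' > 0" using pos by auto
      have "nrm (b l ^ p - \<sigma> (b l)) \<le> 1 / real p" using sigma_frob[OF b] by (simp add: nrm_minus_commute)
      then have "nrm ((b l ^ p) ^ m' - \<sigma> (b l) ^ m') \<le> (1 / real p) * nrm (of_nat m')"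
        using b \<open>m' > 0\<close> by (intro nrm_power_diff_le_exponent nrm_power_le_one sigma_integral) auto
      then have "nrm (of_nat l) * nrm ((b l ^ p) ^ m' - \<sigma> (b l) ^ m') \<le> nrm (of_nat l) * ((1 / real p) * nrm (of_nat m'))"
        by (intro mult_left_mono) auto
      then have "nrm (of_nat l * ((b l ^ p) ^ m' - \<sigma> (b l) ^ m')) \<le> nrm (of_nat i)"
        by (simp add: nrm_mult m m' nrm_p)
      then show ?thesis using p_pos by (simp add: im m' right_diff_distrib power_mult)
    next
      case False
      then have "multiplicity p m = 0" by (rule not_dvd_imp_multiplicity_0)
      then have "nrm (of_nat i) = nrm (of_nat l)" using nrm_of_nat[OF pos(2)] by (simp add: m nrm_mult)
      then show ?thesis using False b by (simp add: im nrm_mult_le' nrm_power_le_one)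
    qed
  qed simp
  finally show ?thesis .
qed

end

subsection \<open>Transversals and averages\<close>

text \<open>The representatives are kept inside A, so functions and events need not be transported
  to a quotient; averaging over T is averaging over the quotient.\<close>

definition transversal :: "'a set \<Rightarrow> ('a \<Rightarrow> 'a \<Rightarrow> bool) \<Rightarrow> 'a set \<Rightarrow> bool" where
  "transversal A E T \<longleftrightarrow> finite T \<and> T \<subseteq> A \<and> (\<forall>x\<in>A. \<exists>t\<in>T. E x t) \<and> (\<forall>t\<in>T. \<forall>t'\<in>T. E t t' \<longrightarrow> t = t')"

lemma transversal_exists:
  assumes "finite (\<kappa> ` A)" "\<And>x y. x \<in> A \<Longrightarrow> y \<in> A \<Longrightarrow> \<kappa> x = \<kappa> y \<longleftrightarrow> E x y"
  shows "\<exists>T. transversal A E T"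
proof (intro exI)
  let ?T = "inv_into A \<kappa> ` \<kappa> ` A"
  show "transversal A E ?T"
    unfolding transversal_def
  proof (intro conjI ballI impI)
    show "finite ?T" using assms(1) by simp
    show "?T \<subseteq> A" by (auto intro: inv_into_into)
    fix x assume x: "x \<in> A"
    have "\<kappa> (inv_into A \<kappa> (\<kappa> x)) = \<kappa> x" "inv_into A \<kappa> (\<kappa> x) \<in> A"
      using x by (auto intro: f_inv_into_f inv_into_into)
    then show "\<exists>t\<in>?T. E x t" using x assms(2)[of x "inv_into A \<kappa> (\<kappa> x)"] by auto
  next
    fix t t' assume t: "t \<in> ?T" "t' \<in> ?T" "E t t'"
    then have "t \<in> A" "t' \<in> A" by (auto intro: inv_into_into)
    then have "\<kappa> t = \<kappa> t'" using assms(2) t by blast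
    then show "t = t'" using t by (auto simp: f_inv_into_f)
  qed
qed

text \<open>Applying \<phi> and then passing to the representative is an injective self-map of the
  finite set T, hence a permutation of it.\<close>

lemma transversal_sum_reindex:
  fixes g :: "'a \<Rightarrow> real"
  assumes E: "equivp E" and T: "transversal A E T"
    and \<phi>: "\<And>x. x \<in> A \<Longrightarrow> \<phi> x \<in> A" "\<And>x y. x \<in> A \<Longrightarrow> y \<in> A \<Longrightarrow> E (\<phi> x) (\<phi> y) \<Longrightarrow> E x y"
    and g: "\<And>x y. x \<in> A \<Longrightarrow> y \<in> A \<Longrightarrow> E x y \<Longrightarrow> g x = g y"
  shows "(\<Sum>t\<in>T. g (\<phi> t)) = (\<Sum>t\<in>T. g t)"
proof -
  have TX: "T \<subseteq> A" and fin: "finite T" and uniq: "\<And>t t'. t \<in> T \<Longrightarrow> t' \<in> T \<Longrightarrow> E t t' \<Longrightarrow> t = t'"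
    using T by (auto simp: transversal_def)
  obtain \<rho> where \<rho>: "\<And>x. x \<in> A \<Longrightarrow> \<rho> x \<in> T \<and> E x (\<rho> x)"
    using T unfolding transversal_def by metis
  let ?m = "\<lambda>t. \<rho> (\<phi> t)"
  have inj: "inj_on ?m T"
  proof (rule inj_onI)
    fix t t' assume t: "t \<in> T" "t' \<in> T" "?m t = ?m t'"
    have "E (\<phi> t) (?m t)" "E (\<phi> t') (?m t)" using \<rho> \<phi>(1) TX t by (metis subsetD)+
    then have "E (\<phi> t) (\<phi> t')" using E by (meson equivp_symp equivp_transp)
    then show "t = t'" using \<phi>(2) uniq t TX by blast
  qed
  have sub: "?m ` T \<subseteq> T" using \<rho> \<phi>(1) TX by blast
  have im: "?m ` T = T" by (rule endo_inj_surj[OF fin sub inj])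
  have "(\<Sum>t\<in>T. g (\<phi> t)) = (\<Sum>t\<in>T. g (?m t))"
    using \<rho> \<phi>(1) TX by (intro sum.cong refl g) blast+
  also have "\<dots> = (\<Sum>t\<in>?m ` T. g t)" using inj by (simp add: sum.reindex)
  finally show ?thesis by (simp only: im)
qed

lemma transversal_partition_sum:
  fixes g :: "'a \<Rightarrow> real"
  assumes E: "equivp E" and S: "transversal Y E S" and fin: "finite T"
    and \<psi>: "\<And>t. t \<in> T \<Longrightarrow> \<psi> t \<in> Y"
  shows "(\<Sum>s\<in>S. \<Sum>t | t \<in> T \<and> E (\<psi> t) s. g t) = (\<Sum>t\<in>T. g t)"
proof -
  have finS: "finite S" and uniq: "\<And>t t'. t \<in> S \<Longrightarrow> t' \<in> S \<Longrightarrow> E t t' \<Longrightarrow> t = t'"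
    using S by (auto simp: transversal_def)
  have "(\<Sum>s\<in>S. \<Sum>t | t \<in> T \<and> E (\<psi> t) s. g t) = sum g (\<Union>s\<in>S. {t. t \<in> T \<and> E (\<psi> t) s})"
  proof (rule sum.UNION_disjoint[symmetric])
    show "\<forall>s\<in>S. \<forall>s'\<in>S. s \<noteq> s' \<longrightarrow> {t. t \<in> T \<and> E (\<psi> t) s} \<inter> {t. t \<in> T \<and> E (\<psi> t) s'} = {}"
      using uniq E by (auto) (meson equivp_symp equivp_transp)
  qed (use finS fin in auto)
  also have "(\<Union>s\<in>S. {t. t \<in> T \<and> E (\<psi> t) s}) = T"
    using S \<psi> by (auto simp: transversal_def)
  finally show ?thesis .
qed

text \<open>All fibres of the map induced by \<psi> on classes have the same size, because
  \<open>hom\<close> carries any fibre into any other. In the applications \<psi> is additive and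
  \<phi> is translation by a preimage of y' - y.\<close>

lemma transversal_fibres:
  assumes E: "equivp E" and T: "transversal A E T" and E': "equivp E'" and S: "transversal Y E' S"
    and \<psi>: "\<And>x. x \<in> A \<Longrightarrow> \<psi> x \<in> Y" "\<And>x y. x \<in> A \<Longrightarrow> y \<in> A \<Longrightarrow> E x y \<Longrightarrow> E' (\<psi> x) (\<psi> y)"
    and hom: "\<And>y y'. y \<in> Y \<Longrightarrow> y' \<in> Y \<Longrightarrow> \<exists>\<phi>. (\<forall>x\<in>A. \<phi> x \<in> A \<and> (E' (\<psi> (\<phi> x)) y' \<longleftrightarrow> E' (\<psi> x) y)) \<and>
        (\<forall>x\<in>A. \<forall>x'\<in>A. E (\<phi> x) (\<phi> x') \<longrightarrow> E x x')"
    and y: "y \<in> Y"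
  shows "card {t \<in> T. E' (\<psi> t) y} * card S = card T"
proof -
  have fin: "finite T" "finite S" and TX: "T \<subseteq> A" "S \<subseteq> Y" using T S by (auto simp: transversal_def)
  have eq: "card {t \<in> T. E' (\<psi> t) y} = card {t \<in> T. E' (\<psi> t) y'}" if y': "y' \<in> Y" for y'
  proof -
    obtain \<phi> where \<phi>: "\<And>x. x \<in> A \<Longrightarrow> \<phi> x \<in> A" "\<And>x. x \<in> A \<Longrightarrow> E' (\<psi> (\<phi> x)) y' \<longleftrightarrow> E' (\<psi> x) y"
      "\<And>x x'. x \<in> A \<Longrightarrow> x' \<in> A \<Longrightarrow> E (\<phi> x) (\<phi> x') \<Longrightarrow> E x x'"
      using hom[OF y y'] by blast
    have "(\<Sum>t\<in>T. of_bool (E' (\<psi> (\<phi> t)) y') :: real) = (\<Sum>t\<in>T. of_bool (E' (\<psi> t) y'))"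
    proof (rule transversal_sum_reindex[OF E T \<phi>(1,3), where g = "\<lambda>x. of_bool (E' (\<psi> x) y')"])
      fix x x' assume "x \<in> A" "x' \<in> A" "E x x'"
      then have "E' (\<psi> x) (\<psi> x')" by (rule \<psi>(2))
      then show "of_bool (E' (\<psi> x) y') = (of_bool (E' (\<psi> x') y') :: real)"
        using equivp_symp[OF E'] equivp_transp[OF E'] by (smt (verit, best))
    qed
    moreover have "(\<Sum>t\<in>T. of_bool (E' (\<psi> (\<phi> t)) y') :: real) = (\<Sum>t\<in>T. of_bool (E' (\<psi> t) y))"
      using \<phi>(2) TX by (intro sum.cong) auto
    ultimately have "real (card (T \<inter> {t. E' (\<psi> t) y})) = real (card (T \<inter> {t. E' (\<psi> t) y'}))"
      using fin by simp
    then show ?thesis by (simp add: Int_def)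
  qed
  have "real (card T) = (\<Sum>s\<in>S. \<Sum>t | t \<in> T \<and> E' (\<psi> t) s. 1)"
    using transversal_partition_sum[OF E' S fin(1), where \<psi> = \<psi> and g = "\<lambda>_. 1"] \<psi>(1) TX by (simp add: subsetD)
  also have "\<dots> = (\<Sum>s\<in>S. real (card {t \<in> T. E' (\<psi> t) y}))"
    using eq TX by (intro sum.cong) auto
  finally have "real (card T) = real (card {t \<in> T. E' (\<psi> t) y} * card S)" by (simp add: mult.commute)
  then show ?thesis by linarith
qed

text \<open>Let N and m be the sizes of T and S and c(s) the number of t with value in the class s.
  The number of colliding pairs is the sum of c(s)^2, so the squared deviations of c(s)/N from 1/m
  add up to (collisions)/N^2 - 1/m, at most b/N. Cauchy-Schwarz against \<Phi>, whose squares sum to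
  at most m, gives the bound.\<close>

lemma collision_equidistribution:
  fixes \<Phi> :: "'b \<Rightarrow> real" and b :: real
  assumes E: "equivp E" and S: "transversal Y E S" and T: "finite T" "T \<noteq> {}"
    and f: "\<And>t. t \<in> T \<Longrightarrow> f t \<in> Y"
    and \<Phi>: "\<And>x y. x \<in> Y \<Longrightarrow> y \<in> Y \<Longrightarrow> E x y \<Longrightarrow> \<Phi> x = \<Phi> y" "\<And>x. x \<in> Y \<Longrightarrow> 0 \<le> \<Phi> x \<and> \<Phi> x \<le> 1"
    and coll: "(\<Sum>t\<in>T. real (card {t' \<in> T. E (f t') (f t)})) \<le> (real (card T))\<^sup>2 / real (card S) + real (card T) * b"
  shows "((\<Sum>t\<in>T. \<Phi> (f t)) / card T - (\<Sum>s\<in>S. \<Phi> s) / card S)\<^sup>2 \<le> card S * b / card T"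
proof -
  have finS: "finite S" and SY: "S \<subseteq> Y" using S by (auto simp: transversal_def)
  define N where "N = real (card T)"
  define m where "m = real (card S)"
  have N0: "N > 0" using T by (simp add: N_def card_gt_0_iff)
  obtain t0 where "t0 \<in> T" using T by blast
  then have "\<exists>s\<in>S. E (f t0) s" using S f by (auto simp: transversal_def)
  then have m0: "m > 0" using finS by (auto simp: m_def card_gt_0_iff)
  define c where "c s = real (card {t \<in> T. E (f t) s})" for s
  have sumc: "(\<Sum>s\<in>S. c s) = N"
    using transversal_partition_sum[OF E S T(1), where \<psi> = f and g = "\<lambda>_. 1"] f by (simp add: c_def N_def)
  have sumc2: "(\<Sum>s\<in>S. c s * c s) = (\<Sum>t\<in>T. real (card {t' \<in> T. E (f t') (f t)}))"
  proof -
    have "(\<Sum>s\<in>S. c s * c s) = (\<Sum>s\<in>S. \<Sum>t | t \<in> T \<and> E (f t) s. c s)"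
      by (simp add: c_def)
    also have "\<dots> = (\<Sum>s\<in>S. \<Sum>t | t \<in> T \<and> E (f t) s. real (card {t' \<in> T. E (f t') (f t)}))"
    proof (intro sum.cong refl)
      fix s t assume "t \<in> {t. t \<in> T \<and> E (f t) s}"
      then have "{t' \<in> T. E (f t') s} = {t' \<in> T. E (f t') (f t)}"
        using E by (auto) (meson equivp_symp equivp_transp)+
      then show "c s = real (card {t' \<in> T. E (f t') (f t)})" by (simp add: c_def)
    qed
    also have "\<dots> = (\<Sum>t\<in>T. real (card {t' \<in> T. E (f t') (f t)}))"
      by (rule transversal_partition_sum[OF E S T(1) f])
    finally show ?thesis .
  qed
  have sum\<Phi>: "(\<Sum>t\<in>T. \<Phi> (f t)) = (\<Sum>s\<in>S. c s * \<Phi> s)"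
  proof -
    have "(\<Sum>t\<in>T. \<Phi> (f t)) = (\<Sum>s\<in>S. \<Sum>t | t \<in> T \<and> E (f t) s. \<Phi> (f t))"
      using transversal_partition_sum[OF E S T(1), where \<psi> = f and g = "\<lambda>t. \<Phi> (f t)"] f by simp
    also have "\<dots> = (\<Sum>s\<in>S. \<Sum>t | t \<in> T \<and> E (f t) s. \<Phi> s)"
      using \<Phi>(1) f SY by (intro sum.cong refl) auto
    finally show ?thesis by (simp add: c_def)
  qed
  have "(\<Sum>t\<in>T. \<Phi> (f t)) / N - (\<Sum>s\<in>S. \<Phi> s) / m = (\<Sum>s\<in>S. (c s / N - 1 / m) * \<Phi> s)"
    by (simp add: sum\<Phi> sum_divide_distrib left_diff_distrib sum_subtractf)
  then have "((\<Sum>t\<in>T. \<Phi> (f t)) / N - (\<Sum>s\<in>S. \<Phi> s) / m)\<^sup>2 \<le> (\<Sum>s\<in>S. (c s / N - 1 / m)\<^sup>2) * (\<Sum>s\<in>S. (\<Phi> s)\<^sup>2)"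
    using Cauchy_Schwarz_ineq_sum[of "\<lambda>s. c s / N - 1 / m" \<Phi> S] by simp
  also have "\<dots> \<le> (\<Sum>s\<in>S. (c s / N - 1 / m)\<^sup>2) * m"
  proof (rule mult_left_mono)
    have "(\<Sum>s\<in>S. (\<Phi> s)\<^sup>2) \<le> (\<Sum>s\<in>S. 1)"
      using \<Phi>(2) SY by (intro sum_mono) (auto simp: power_le_one_iff subset_iff abs_square_le_1)
    then show "(\<Sum>s\<in>S. (\<Phi> s)\<^sup>2) \<le> m" by (simp add: m_def)
  qed (auto intro: sum_nonneg)
  also have "(\<Sum>s\<in>S. (c s / N - 1 / m)\<^sup>2) = (\<Sum>s\<in>S. c s * c s) / N\<^sup>2 - 1 / m"
  proof -
    have "(\<Sum>s\<in>S. (c s / N - 1 / m)\<^sup>2) = (\<Sum>s\<in>S. c s * c s / N\<^sup>2 - c s * (2 / (N * m)) + 1 / m\<^sup>2)"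
      by (intro sum.cong refl) (simp add: power2_diff power_divide, simp add: power2_eq_square)
    also have "\<dots> = (\<Sum>s\<in>S. c s * c s) / N\<^sup>2 - N * (2 / (N * m)) + m * (1 / m\<^sup>2)"
      by (simp add: sum.distrib sum_subtractf sum_divide_distrib[symmetric] sumc m_def flip: sum_distrib_right)
    also have "\<dots> = (\<Sum>s\<in>S. c s * c s) / N\<^sup>2 - 1 / m" using N0 m0 by (simp add: power2_eq_square)
    finally show ?thesis .
  qed
  also have "\<dots> * m \<le> m * b / N"
  proof -
    have "(\<Sum>s\<in>S. c s * c s) / N\<^sup>2 \<le> (N\<^sup>2 / m + N * b) / N\<^sup>2"
      using coll unfolding sumc2 N_def m_def by (intro divide_right_mono) auto
    also have "\<dots> = 1 / m + b / N" using N0 m0 by (simp add: add_divide_distrib power2_eq_square)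
    finally have "((\<Sum>s\<in>S. c s * c s) / N\<^sup>2 - 1 / m) * m \<le> b / N * m"
      using m0 by (intro mult_right_mono) auto
    then show ?thesis by (simp add: mult.commute)
  qed
  finally show ?thesis by (simp add: N_def m_def)
qed

text \<open>The classes split the space into \<open>card T\<close> events of equal probability. This
  is the passage from Haar measure to counting.\<close>

lemma (in prob_space) transversal_prob:
  assumes E: "equivp E" and T: "transversal (space M) E T"
    and meas: "\<And>x. x \<in> space M \<Longrightarrow> {y \<in> space M. E x y} \<in> events"
    and eq: "\<And>x x'. x \<in> space M \<Longrightarrow> x' \<in> space M \<Longrightarrow> prob {y \<in> space M. E x y} = prob {y \<in> space M. E x' y}"
    and Q: "\<And>x y. x \<in> space M \<Longrightarrow> y \<in> space M \<Longrightarrow> E x y \<Longrightarrow> Q x \<longleftrightarrow> Q y"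
  shows "prob {x \<in> space M. Q x} = (\<Sum>t\<in>T. of_bool (Q t)) / card T"
proof -
  have fin: "finite T" and TX: "T \<subseteq> space M" and ex: "\<And>x. x \<in> space M \<Longrightarrow> \<exists>t\<in>T. E x t"
    and uniq: "\<And>t t'. t \<in> T \<Longrightarrow> t' \<in> T \<Longrightarrow> E t t' \<Longrightarrow> t = t'"
    using T by (auto simp: transversal_def)
  define C where "C x = {y \<in> space M. E x y}" for x
  have disj: "disjoint_family_on C T"
    unfolding disjoint_family_on_def C_def using uniq E by auto (meson equivp_symp equivp_transp)
  have probU: "prob (\<Union>t\<in>T'. C t) = (\<Sum>t\<in>T'. prob (C t))" if "T' \<subseteq> T" for T'
  proof (rule finite_measure_finite_Union)
    show "finite T'" using that fin finite_subset by blast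
    show "C ` T' \<subseteq> events" using that TX meas by (auto simp: C_def)
    show "disjoint_family_on C T'" using disj that by (meson disjoint_family_on_mono)
  qed
  obtain x0 where x0: "x0 \<in> space M" using not_empty by blast
  define \<mu> where "\<mu> = prob (C x0)"
  have \<mu>: "prob (C t) = \<mu>" if "t \<in> T" for t
    using eq[of t x0] that TX x0 by (auto simp: \<mu>_def C_def)
  have "(\<Union>t\<in>T. C t) = space M"
    using ex TX E by (auto simp: C_def) (meson equivp_symp)
  then have "1 = real (card T) * \<mu>" using probU[of T] prob_space \<mu> by simp
  moreover from this have "card T \<noteq> 0" by (intro notI) simp
  ultimately have card: "\<mu> = 1 / card T" by (simp add: field_simps)
  have "{x \<in> space M. Q x} = (\<Union>t\<in>T \<inter> {t. Q t}. C t)"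
  proof (intro equalityI subsetI)
    fix x assume x: "x \<in> {x \<in> space M. Q x}"
    then obtain t where "t \<in> T" "E x t" using ex by blast
    moreover have "Q t" using x Q[of x t] \<open>t \<in> T\<close> \<open>E x t\<close> TX by auto
    ultimately show "x \<in> (\<Union>t\<in>T \<inter> {t. Q t}. C t)" using x equivp_symp[OF E] by (auto simp: C_def)
  next
    fix x assume "x \<in> (\<Union>t\<in>T \<inter> {t. Q t}. C t)"
    then show "x \<in> {x \<in> space M. Q x}" using Q TX by (auto simp: C_def)
  qed
  then have "prob {x \<in> space M. Q x} = real (card (T \<inter> {t. Q t})) * \<mu>"
    using probU[of "T \<inter> {t. Q t}"] \<mu> by simp
  then show ?thesis using fin by (simp add: card)
qed

subsection \<open>Integral matrices\<close>

context unramified_quadratic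
begin

abbreviation RR :: "'k set" where "RR \<equiv> integers nrm UNIV"

definition ivec :: "nat \<Rightarrow> 'k vec set" where
  "ivec n = {v \<in> carrier_vec n. \<forall>i<n. nrm (v $ i) \<le> 1}"

definition close_vec :: "nat \<Rightarrow> real \<Rightarrow> 'k vec \<Rightarrow> 'k vec \<Rightarrow> bool" where
  "close_vec n c u v \<longleftrightarrow> (\<forall>i<n. nrm (u $ i - v $ i) \<le> c)"

definition close_mat :: "nat \<Rightarrow> real \<Rightarrow> 'k mat \<Rightarrow> 'k mat \<Rightarrow> bool" where
  "close_mat n c A B \<longleftrightarrow> (\<forall>i<n. \<forall>j<n. nrm (A $$ (i, j) - B $$ (i, j)) \<le> c)"

lemma mat_over_RR: "M \<in> mat_over n RR \<longleftrightarrow> M \<in> carrier_mat n n \<and> (\<forall>i<n. \<forall>j<n. nrm (M $$ (i, j)) \<le> 1)"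
  by (auto simp: mat_over_def integers_def)

lemma ivec_carrier: "v \<in> ivec n \<Longrightarrow> v \<in> carrier_vec n"
  by (simp add: ivec_def)

lemma mat_over_carrier: "M \<in> mat_over n RR \<Longrightarrow> M \<in> carrier_mat n n"
  by (simp add: mat_over_RR)

lemma nrm_mult_diff_le:
  assumes "nrm a \<le> 1" "nrm b' \<le> 1" "nrm (a - a') \<le> c" "nrm (b - b') \<le> c"
  shows "nrm (a * b - a' * b') \<le> c"
proof -
  have "a * b - a' * b' = a * (b - b') + (a - a') * b'" by (simp add: algebra_simps)
  moreover have "nrm (a * (b - b')) \<le> c" using assms by (intro nrm_mult_le)
  moreover have "nrm ((a - a') * b') \<le> c" using assms by (intro nrm_mult_le')
  ultimately show ?thesis using nrm_add_le by metis
qed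

lemma scalar_prod_integral: "u \<in> ivec n \<Longrightarrow> v \<in> ivec n \<Longrightarrow> nrm (u \<bullet> v) \<le> 1"
  by (auto simp: ivec_def scalar_prod_def intro!: nrm_sum_le nrm_mult_le_one)

lemma scalar_prod_close:
  assumes "u \<in> ivec n" "v \<in> ivec n" "u' \<in> ivec n" "v' \<in> ivec n" "close_vec n c u u'" "close_vec n c v v'" "0 \<le> c"
  shows "nrm (u \<bullet> v - u' \<bullet> v') \<le> c"
proof -
  have "u \<bullet> v - u' \<bullet> v' = (\<Sum>i\<in>{0..<n}. u $ i * v $ i - u' $ i * v' $ i)"
    using assms by (auto simp: ivec_def scalar_prod_def sum_subtractf)
  then show ?thesis
    using assms by (auto simp: ivec_def close_vec_def intro!: nrm_sum_le nrm_mult_diff_le)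
qed

lemma row_ivec: "M \<in> mat_over n RR \<Longrightarrow> i < n \<Longrightarrow> row M i \<in> ivec n"
  by (auto simp: mat_over_RR ivec_def)

lemma col_ivec: "M \<in> mat_over n RR \<Longrightarrow> i < n \<Longrightarrow> col M i \<in> ivec n"
  by (auto simp: mat_over_RR ivec_def)

lemma mat_over_mult: "A \<in> mat_over n RR \<Longrightarrow> B \<in> mat_over n RR \<Longrightarrow> A * B \<in> mat_over n RR"
  using scalar_prod_integral[OF row_ivec col_ivec, of A n _ B] by (auto simp: mat_over_RR)

lemma mat_over_one: "1\<^sub>m n \<in> mat_over n RR"
  by (auto simp: mat_over_RR)

lemma mat_over_pow: "A \<in> mat_over n RR \<Longrightarrow> A ^\<^sub>m k \<in> mat_over n RR"
  by (induction k) (auto intro: mat_over_mult mat_over_one simp: mat_over_carrier carrier_matD[OF mat_over_carrier])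

lemma mult_mat_ivec: "A \<in> mat_over n RR \<Longrightarrow> v \<in> ivec n \<Longrightarrow> A *\<^sub>v v \<in> ivec n"
  using scalar_prod_integral[OF row_ivec, of A n _ v] by (auto simp: mat_over_RR ivec_def)

lemma close_mat_refl: "0 \<le> c \<Longrightarrow> close_mat n c A A"
  by (simp add: close_mat_def)

lemma close_vec_refl: "0 \<le> c \<Longrightarrow> close_vec n c v v"
  by (simp add: close_vec_def)

lemma close_row:
  "close_mat n c A A' \<Longrightarrow> A \<in> mat_over n RR \<Longrightarrow> A' \<in> mat_over n RR \<Longrightarrow> i < n \<Longrightarrow> close_vec n c (row A i) (row A' i)"
  by (simp add: close_mat_def close_vec_def carrier_matD[OF mat_over_carrier])

lemma close_col:
  "close_mat n c A A' \<Longrightarrow> A \<in> mat_over n RR \<Longrightarrow> A' \<in> mat_over n RR \<Longrightarrow> i < n \<Longrightarrow> close_vec n c (col A i) (col A' i)"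
  by (simp add: close_mat_def close_vec_def carrier_matD[OF mat_over_carrier])

lemma close_mat_mult:
  assumes "A \<in> mat_over n RR" "B \<in> mat_over n RR" "A' \<in> mat_over n RR" "B' \<in> mat_over n RR"
    "close_mat n c A A'" "close_mat n c B B'" "0 \<le> c"
  shows "close_mat n c (A * B) (A' * B')"
  unfolding close_mat_def
proof (intro allI impI)
  fix i j assume ij: "i < n" "j < n"
  have "nrm (row A i \<bullet> col B j - row A' i \<bullet> col B' j) \<le> c"
    using assms ij by (intro scalar_prod_close[where n = n] row_ivec col_ivec close_row close_col)
  then show "nrm ((A * B) $$ (i, j) - (A' * B') $$ (i, j)) \<le> c"
    using assms ij by (simp add: carrier_matD[OF mat_over_carrier])
qed

lemma close_mat_pow:
  assumes "A \<in> mat_over n RR" "A' \<in> mat_over n RR" "close_mat n c A A'" "0 \<le> c"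
  shows "close_mat n c (A ^\<^sub>m k) (A' ^\<^sub>m k)"
proof (induction k)
  case 0
  then show ?case using assms by (simp add: carrier_matD[OF mat_over_carrier] close_mat_refl)
next
  case (Suc k)
  then show ?case using assms by (auto intro!: close_mat_mult mat_over_pow)
qed

lemma close_mult_mat_vec:
  assumes "A \<in> mat_over n RR" "v \<in> ivec n" "A' \<in> mat_over n RR" "v' \<in> ivec n"
    "close_mat n c A A'" "close_vec n c v v'" "0 \<le> c"
  shows "close_vec n c (A *\<^sub>v v) (A' *\<^sub>v v')"
  unfolding close_vec_def
proof (intro allI impI)
  fix i assume i: "i < n"
  have "nrm (row A i \<bullet> v - row A' i \<bullet> v') \<le> c"
    using assms i by (intro scalar_prod_close[where n = n] row_ivec close_row)
  then show "nrm ((A *\<^sub>v v) $ i - (A' *\<^sub>v v') $ i) \<le> c"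
    using assms i by (simp add: carrier_matD[OF mat_over_carrier])
qed

lemma mat_trace_close:
  assumes "A \<in> carrier_mat n n" "A' \<in> carrier_mat n n" "close_mat n c A A'" "0 \<le> c"
  shows "nrm (mat_trace A - mat_trace A') \<le> c"
  using assms by (auto simp: mat_trace_def close_mat_def sum_subtractf[symmetric] intro!: nrm_sum_le)

section \<open>Traces and power sums with the Frobenius correction\<close>

definition frob_trace :: "nat \<Rightarrow> 'k mat \<Rightarrow> 'k" where
  "frob_trace i M = mat_trace (M ^\<^sub>m i) - of_bool (p dvd i) * \<sigma> (mat_trace (M ^\<^sub>m (i div p)))"

definition frob_newton :: "(nat \<Rightarrow> 'k) \<Rightarrow> nat \<Rightarrow> 'k" where
  "frob_newton \<phi> i = newton_sum \<phi> i - of_bool (p dvd i) * \<sigma> (newton_sum \<phi> (i div p))"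

lemma frob_diff_close:
  assumes "nrm (a - a') \<le> (1 / real p) ^ k" "nrm (b - b') \<le> (1 / real p) ^ k"
  shows "nrm ((a - of_bool Q * \<sigma> b) - (a' - of_bool Q * \<sigma> b')) \<le> (1 / real p) ^ k"
proof -
  have "(a - of_bool Q * \<sigma> b) - (a' - of_bool Q * \<sigma> b') = (a - a') - of_bool Q * \<sigma> (b - b')"
    by (simp add: sigma_hom algebra_simps)
  moreover have "nrm (of_bool Q * \<sigma> (b - b')) \<le> (1 / real p) ^ k"
    using sigma_le_power[OF assms(2)] by (intro nrm_mult_le) auto
  then have "nrm ((a - a') - of_bool Q * \<sigma> (b - b')) \<le> (1 / real p) ^ k"
    by (rule nrm_diff_le[OF assms(1)])
  ultimately show ?thesis by (simp only:)
qed

lemma frob_trace_close: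
  assumes "A \<in> mat_over n RR" "B \<in> mat_over n RR" "close_mat n ((1 / real p) ^ k) A B"
  shows "nrm (frob_trace i A - frob_trace i B) \<le> (1 / real p) ^ k"
proof -
  have "nrm (mat_trace (A ^\<^sub>m j) - mat_trace (B ^\<^sub>m j)) \<le> (1 / real p) ^ k" for j
    using assms by (intro mat_trace_close[where n = n] close_mat_pow mat_over_carrier mat_over_pow) auto
  then show ?thesis unfolding frob_trace_def by (intro frob_diff_close)
qed

lemma newton_sum_integral:
  assumes "\<And>j. nrm (\<phi> j) \<le> 1"
  shows "nrm (newton_sum \<phi> i) \<le> 1"
proof (induction i rule: less_induct)
  case (less i)
  show ?case
    using less assms nrm_of_nat_le
    by (subst newton_sum.simps) (auto intro!: nrm_add_le nrm_sum_le nrm_mult_le_one)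
qed

lemma newton_sum_close:
  assumes "\<And>j. nrm (\<phi> j) \<le> 1" "\<And>j. nrm (\<phi>' j) \<le> 1" "\<And>j. j \<in> {1..i} \<Longrightarrow> nrm (\<phi> j - \<phi>' j) \<le> c" "0 \<le> c"
  shows "nrm (newton_sum \<phi> i - newton_sum \<phi>' i) \<le> c"
  using assms(3)
proof (induction i rule: less_induct)
  case (less i)
  show ?case
  proof (cases "i = 0")
    case False
    have "newton_sum \<phi> i - newton_sum \<phi>' i = of_nat i * (\<phi> i - \<phi>' i) +
        (\<Sum>j\<in>{1..<i}. \<phi> j * newton_sum \<phi> (i - j) - \<phi>' j * newton_sum \<phi>' (i - j))"
      by (subst newton_sum.simps, subst (2) newton_sum.simps) (simp add: algebra_simps sum_subtractf)
    also have "nrm \<dots> \<le> c"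
    proof (rule nrm_add_le)
      show "nrm (of_nat i * (\<phi> i - \<phi>' i)) \<le> c"
        using less(2)[of i] False nrm_of_nat_le by (intro nrm_mult_le) auto
      show "nrm (\<Sum>j\<in>{1..<i}. \<phi> j * newton_sum \<phi> (i - j) - \<phi>' j * newton_sum \<phi>' (i - j)) \<le> c"
      proof (rule nrm_sum_le)
        fix j assume j: "j \<in> {1..<i}"
        have "nrm (newton_sum \<phi> (i - j) - newton_sum \<phi>' (i - j)) \<le> c"
          using j less(2) by (intro less(1)) auto
        then show "nrm (\<phi> j * newton_sum \<phi> (i - j) - \<phi>' j * newton_sum \<phi>' (i - j)) \<le> c"
          using j less(2)[of j] assms(1,2) by (intro nrm_mult_diff_le newton_sum_integral) auto
      qed fact
    qed
    finally show ?thesis .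
  qed (simp add: assms)
qed

lemma frob_newton_close:
  assumes "\<And>j. nrm (\<phi> j) \<le> 1" "\<And>j. nrm (\<phi>' j) \<le> 1" "\<And>j. j \<in> {1..i} \<Longrightarrow> nrm (\<phi> j - \<phi>' j) \<le> (1 / real p) ^ k"
  shows "nrm (frob_newton \<phi> i - frob_newton \<phi>' i) \<le> (1 / real p) ^ k"
proof -
  have "nrm (newton_sum \<phi> m - newton_sum \<phi>' m) \<le> (1 / real p) ^ k" if "m \<le> i" for m
    using assms that by (intro newton_sum_close) auto
  then show ?thesis unfolding frob_newton_def by (intro frob_diff_close) auto
qed

lemma frob_newton_congruence:
  "(\<And>j. nrm (\<phi> j) \<le> 1) \<Longrightarrow> i > 0 \<Longrightarrow> nrm (frob_newton \<phi> i) \<le> nrm (of_nat i)"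
  unfolding frob_newton_def by (rule newton_sum_congruence)

lemma newton_sum_cong: "(\<And>j. j \<in> {1..i} \<Longrightarrow> \<phi> j = \<phi>' j) \<Longrightarrow> newton_sum \<phi> i = newton_sum \<phi>' i"
proof (induction i rule: less_induct)
  case (less i)
  show ?case
  proof (cases "i = 0")
    case False
    then show ?thesis using less
      by (subst newton_sum.simps, subst (2) newton_sum.simps) (auto intro!: arg_cong2[where f = "(+)"] sum.cong arg_cong2[where f = "(*)"])
  qed simp
qed

lemma frob_newton_cong: "(\<And>j. j \<in> {1..i} \<Longrightarrow> \<phi> j = \<phi>' j) \<Longrightarrow> frob_newton \<phi> i = frob_newton \<phi>' i"
proof -
  assume a: "\<And>j. j \<in> {1..i} \<Longrightarrow> \<phi> j = \<phi>' j"
  have "newton_sum \<phi> m = newton_sum \<phi>' m" if "m \<le> i" for m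
    using a that by (intro newton_sum_cong) auto
  then show ?thesis by (simp add: frob_newton_def)
qed

text \<open>Apart from the leading term, only power sums of smaller index occur, and
  \<open>i div p\<close> is smaller than i as well. So \<open>\<phi> i\<close> enters linearly with
  coefficient i, which makes the system of d conditions triangular.\<close>

lemma frob_newton_top:
  assumes "i > 0"
  shows "frob_newton \<phi> i = of_nat i * \<phi> i + frob_newton (\<phi>(i := 0)) i"
proof -
  have "i div p < i" using assms p_gt_1 by simp
  then have "newton_sum \<phi> (i div p) = newton_sum (\<phi>(i := 0)) (i div p)" by (intro newton_sum_cong) auto
  moreover have "newton_sum \<phi> i = of_nat i * \<phi> i + newton_sum (\<phi>(i := 0)) i"
  proof -
    have "(\<Sum>j\<in>{1..<i}. \<phi> j * newton_sum \<phi> (i - j)) =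
        (\<Sum>j\<in>{1..<i}. (\<phi>(i := 0)) j * newton_sum (\<phi>(i := 0)) (i - j))"
    proof (rule sum.cong[OF refl])
      fix j assume j: "j \<in> {1..<i}"
      then have "newton_sum \<phi> (i - j) = newton_sum (\<phi>(i := 0)) (i - j)"
        by (intro newton_sum_cong) auto
      then show "\<phi> j * newton_sum \<phi> (i - j) = (\<phi>(i := 0)) j * newton_sum (\<phi>(i := 0)) (i - j)"
        using j by simp
    qed
    then show ?thesis by (subst newton_sum.simps, subst (2) newton_sum.simps) simp
  qed
  ultimately show ?thesis by (simp add: frob_newton_def)
qed

lemma frob_trace_update:
  assumes M: "M \<in> carrier_mat n n" and x: "x \<in> carrier_vec n" and z: "z \<in> carrier_vec n"
  shows "frob_trace i (M + outer_mat n x z) = frob_trace i M + frob_newton (\<lambda>j. z \<bullet> ((M ^\<^sub>m (j - 1)) *\<^sub>v x)) i"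
proof -
  have "mat_trace ((M + outer_mat n x z) ^\<^sub>m j) = mat_trace (M ^\<^sub>m j) + newton_sum (\<lambda>j. z \<bullet> ((M ^\<^sub>m (j - 1)) *\<^sub>v x)) j" for j
    using mat_trace_power_rank_one_update[OF M x z, of j] by (simp add: algebra_simps)
  then show ?thesis by (simp only: frob_trace_def frob_newton_def) (simp add: sigma_hom algebra_simps)
qed

text \<open>Starting from the zero matrix, M is built column by column. Adding a column is a
  rank-one update with a unit vector, and the change is controlled by the congruence for Newton
  sums.\<close>

lemma frob_trace_congruence:
  assumes M: "M \<in> mat_over n RR" and i: "i > 0"
  shows "nrm (frob_trace i M) \<le> nrm (of_nat i)"
proof -
  define A where "A k = mat n n (\<lambda>(a, b). if b < k then M $$ (a, b) else 0)" for k
  have A: "A k \<in> mat_over n RR" for k using M by (auto simp: A_def mat_over_RR)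
  have "nrm (frob_trace i (A k)) \<le> nrm (of_nat i)" if "k \<le> n" for k
    using that
  proof (induction k)
    case 0
    have A0: "A 0 = 0\<^sub>m n n" by (intro eq_matI) (auto simp: A_def)
    have "mat_trace ((0\<^sub>m n n :: 'k mat) ^\<^sub>m j) = 0" if "j > 0" for j
      using that by (cases j) (auto simp: mat_trace_def intro!: sum.neutral)
    \<comment> \<open>This excludes the zeroth power, which is the identity and has trace n instead
      of 0.\<close>
    moreover have "p dvd i \<Longrightarrow> i div p > 0" using i p_pos by (auto simp: dvd_def)
    ultimately have "frob_trace i (A 0) = 0" using i by (auto simp: frob_trace_def A0 sigma_hom)
    then show ?case by simp
  next
    case (Suc k)
    have c: "col M k \<in> ivec n" using M Suc by (intro col_ivec) auto
    have e: "unit_vec n k \<in> ivec n" using Suc by (auto simp: ivec_def)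
    have AS: "A (Suc k) = A k + outer_mat n (col M k) (unit_vec n k)"
      using M Suc by (intro eq_matI) (auto simp: A_def outer_mat_def mat_over_RR less_Suc_eq)
    have "frob_trace i (A (Suc k)) = frob_trace i (A k) + frob_newton (\<lambda>j. unit_vec n k \<bullet> ((A k ^\<^sub>m (j - 1)) *\<^sub>v col M k)) i"
      unfolding AS using A c e by (intro frob_trace_update) (auto simp: mat_over_carrier ivec_carrier)
    also have "nrm \<dots> \<le> nrm (of_nat i)"
      using Suc i A c e
      by (intro nrm_add_le frob_newton_congruence scalar_prod_integral[of _ n] mult_mat_ivec mat_over_pow) auto
    finally show ?case .
  qed
  then have "nrm (frob_trace i (A n)) \<le> nrm (of_nat i)" by simp
  moreover have "A n = M" using M by (intro eq_matI) (auto simp: A_def mat_over_RR)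
  ultimately show ?thesis by simp
qed

subsection \<open>Unitary reflections\<close>


abbreviation conj_vec :: "'k vec \<Rightarrow> 'k vec" where "conj_vec u \<equiv> map_vec \<tau> u"

definition herm :: "'k vec \<Rightarrow> 'k vec \<Rightarrow> 'k" where
  "herm u v = conj_vec u \<bullet> v"

definition adj :: "'k mat \<Rightarrow> 'k mat" where
  "adj M = map_mat \<tau> (transpose_mat M)"

abbreviation UU :: "nat \<Rightarrow> 'k mat set" where "UU n \<equiv> unitary_group n RR \<tau>"

lemma conj_vec_carrier: "u \<in> carrier_vec n \<Longrightarrow> conj_vec u \<in> carrier_vec n"
  by simp

lemma conj_vec_ivec: "u \<in> ivec n \<Longrightarrow> conj_vec u \<in> ivec n"
  by (auto simp: ivec_def)

lemma adj_carrier: "M \<in> carrier_mat n n \<Longrightarrow> adj M \<in> carrier_mat n n"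
  by (simp add: adj_def)

lemma adj_index: "M \<in> carrier_mat n n \<Longrightarrow> i < n \<Longrightarrow> j < n \<Longrightarrow> adj M $$ (i, j) = \<tau> (M $$ (j, i))"
  by (simp add: adj_def)

lemma adj_mat_over: "M \<in> mat_over n RR \<Longrightarrow> adj M \<in> mat_over n RR"
  by (auto simp: mat_over_RR adj_carrier adj_index)

lemma adj_adj: "M \<in> carrier_mat n n \<Longrightarrow> adj (adj M) = M"
  by (intro eq_matI) (simp_all add: adj_def)

lemma adj_mult:
  assumes "A \<in> carrier_mat n n" "B \<in> carrier_mat n n"
  shows "adj (A * B) = adj B * adj A"
  using assms by (intro eq_matI) (simp_all add: adj_def scalar_prod_def tau_hom mult.commute)

lemma unitary_groupD:
  assumes "M \<in> UU n"
  shows "M \<in> mat_over n RR" "M \<in> carrier_mat n n" "M * adj M = 1\<^sub>m n" "adj M * M = 1\<^sub>m n"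
proof -
  from assms have M: "M \<in> mat_over n RR" and u: "M * adj M = 1\<^sub>m n"
    by (auto simp: unitary_group_def GL_over_def adj_def)
  from assms obtain N where N: "N \<in> mat_over n RR" "M * N = 1\<^sub>m n" "N * M = 1\<^sub>m n"
    by (auto simp: unitary_group_def GL_over_def inverts_mat_def mat_over_def)
  note c = mat_over_carrier[OF M] mat_over_carrier[OF N(1)]
  show "M \<in> mat_over n RR" "M \<in> carrier_mat n n" "M * adj M = 1\<^sub>m n" using M c u by auto
  have "N = N * (M * adj M)" using c u by simp
  also have "\<dots> = (N * M) * adj M" using assoc_mult_mat[OF c(2) c(1) adj_carrier[OF c(1)]] by simp
  also have "\<dots> = adj M" using left_mult_one_mat[OF adj_carrier[OF c(1)]] by (simp add: N)
  finally show "adj M * M = 1\<^sub>m n" using N by simp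
qed

lemma unitary_groupI:
  assumes "M \<in> mat_over n RR" "M * adj M = 1\<^sub>m n" "adj M * M = 1\<^sub>m n"
  shows "M \<in> UU n"
proof -
  have "inverts_mat M (adj M)" "inverts_mat (adj M) M"
    using assms adj_mat_over[OF assms(1)] by (simp_all add: inverts_mat_def carrier_matD[OF mat_over_carrier])
  then show ?thesis
    using assms adj_mat_over[OF assms(1)] by (auto simp: unitary_group_def GL_over_def adj_def)
qed

lemma unitary_group_adj: "M \<in> UU n \<Longrightarrow> adj M \<in> UU n"
  using unitary_groupD[of M n] by (intro unitary_groupI) (auto simp: adj_mat_over adj_adj)

lemma unitary_group_mult:
  assumes "A \<in> UU n" "B \<in> UU n"
  shows "A * B \<in> UU n"
proof (rule unitary_groupI)
  note A = unitary_groupD[OF assms(1)] and B = unitary_groupD[OF assms(2)]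
  note aA = adj_carrier[OF A(2)] and aB = adj_carrier[OF B(2)]
  show "A * B \<in> mat_over n RR" using A B by (intro mat_over_mult)
  have "(A * B) * (adj B * adj A) = A * (B * (adj B * adj A))"
    using A(2) B(2) aA aB by (intro assoc_mult_mat) auto
  also have "B * (adj B * adj A) = (B * adj B) * adj A"
    using assoc_mult_mat[OF B(2) aB aA] by simp
  finally show "A * B * adj (A * B) = 1\<^sub>m n"
    using A B aA by (simp add: adj_mult[OF A(2) B(2)])
  have "(adj B * adj A) * (A * B) = adj B * (adj A * (A * B))"
    using A(2) B(2) aA aB by (intro assoc_mult_mat) auto
  also have "adj A * (A * B) = (adj A * A) * B"
    using assoc_mult_mat[OF aA A(2) B(2)] by simp
  finally show "adj (A * B) * (A * B) = 1\<^sub>m n"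
    using A B by (simp add: adj_mult[OF A(2) B(2)])
qed

lemma unitary_group_one: "1\<^sub>m n \<in> UU n"
proof -
  have "adj (1\<^sub>m n) = 1\<^sub>m n" by (intro eq_matI) (auto simp: adj_def tau_hom)
  then show ?thesis by (intro unitary_groupI) (auto simp: mat_over_one)
qed

lemma herm_add_left: "u \<in> carrier_vec n \<Longrightarrow> w \<in> carrier_vec n \<Longrightarrow> v \<in> carrier_vec n \<Longrightarrow> herm (u + w) v = herm u v + herm w v"
  by (simp add: herm_def scalar_prod_def tau_hom algebra_simps sum.distrib)

lemma herm_add_right: "u \<in> carrier_vec n \<Longrightarrow> w \<in> carrier_vec n \<Longrightarrow> v \<in> carrier_vec n \<Longrightarrow> herm u (v + w) = herm u v + herm u w"
  by (simp add: herm_def scalar_prod_def algebra_simps sum.distrib)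

lemma tau_herm: "u \<in> carrier_vec n \<Longrightarrow> v \<in> carrier_vec n \<Longrightarrow> \<tau> (herm u v) = herm v u"
  by (simp add: herm_def scalar_prod_def tau_hom mult.commute)

lemma herm_adj:
  assumes "M \<in> carrier_mat n n" "u \<in> carrier_vec n" "v \<in> carrier_vec n"
  shows "herm u (M *\<^sub>v v) = herm (adj M *\<^sub>v u) v"
proof -
  have "conj_vec (adj M *\<^sub>v u) = transpose_mat M *\<^sub>v conj_vec u"
    using assms by (intro eq_vecI) (simp_all add: adj_def scalar_prod_def tau_hom)
  then show ?thesis
    using transpose_vec_mult_scalar[OF assms(1,3) conj_vec_carrier[OF assms(2)]] by (simp add: herm_def)
qed

lemma herm_integral: "u \<in> ivec n \<Longrightarrow> v \<in> ivec n \<Longrightarrow> nrm (herm u v) \<le> 1"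
  unfolding herm_def by (intro scalar_prod_integral[where n = n] conj_vec_ivec)

lemma close_conj_vec: "u \<in> carrier_vec n \<Longrightarrow> v \<in> carrier_vec n \<Longrightarrow> close_vec n c u v \<Longrightarrow> close_vec n c (conj_vec u) (conj_vec v)"
  by (simp add: close_vec_def flip: tau_hom(6))

lemma herm_close:
  assumes "u \<in> ivec n" "v \<in> ivec n" "u' \<in> ivec n" "v' \<in> ivec n" "close_vec n c u u'" "close_vec n c v v'" "0 \<le> c"
  shows "nrm (herm u v - herm u' v') \<le> c"
  unfolding herm_def using assms
  by (intro scalar_prod_close[where n = n] conj_vec_ivec close_conj_vec ivec_carrier)

definition eps :: 'k where
  "eps = (SOME \<epsilon>. \<tau> \<epsilon> = - \<epsilon> \<and> nrm \<epsilon> = 1)"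

lemma eps: "\<tau> eps = - eps" "nrm eps = 1"
proof -
  have "\<exists>\<epsilon>. \<tau> \<epsilon> = - \<epsilon> \<and> nrm \<epsilon> = 1" using trace_zero_unit by metis
  from someI_ex[OF this] show "\<tau> eps = - eps" "nrm eps = 1" by (simp_all add: eps_def)
qed

text \<open>The scalars \<open>a\<close> with \<open>a + \<tau> a + a * \<tau> a * s = 0\<close> are, for \<open>\<tau> s = s\<close>, the inverses of
  \<open>e - s / 2\<close> with \<open>\<tau> e = - e\<close>.\<close>

definition refl_coeff :: "'k \<Rightarrow> 'k" where
  "refl_coeff s = inverse (eps - s / 2)"

lemma tau_2: "\<tau> 2 = 2"
  using tau_of_nat[of 2] by simp

text \<open>Were \<open>eps - s / 2\<close> in the maximal ideal, its conjugate
  \<open>- eps - s / 2\<close> would be there too, and so would their difference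
  \<open>2 * eps\<close>, which is a unit.\<close>

lemma refl_denominator_unit:
  assumes "\<tau> s = s" "nrm s \<le> 1"
  shows "nrm (eps - s / 2) = 1"
proof (rule ccontr)
  assume n: "nrm (eps - s / 2) \<noteq> 1"
  have "nrm (s / 2) \<le> 1" using assms by (simp add: nrm_divide nrm_2)
  then have "nrm (eps - s / 2) \<le> 1" using eps by (intro nrm_diff_le) auto
  then have lt: "nrm (eps - s / 2) < 1" using n by simp
  have "\<tau> (eps - s / 2) = - eps - s / 2"
    using assms(1) eps(1) by (simp only: tau_hom(2,6,7) divide_inverse tau_2)
  then have "nrm (- eps - s / 2) < 1" using lt tau_isometry by metis
  then have "nrm ((eps - s / 2) - (- eps - s / 2)) < 1"
    using lt nrm_diff[of "eps - s / 2" "- eps - s / 2"] by simp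
  moreover have "(eps - s / 2) - (- eps - s / 2) = 2 * eps" by simp
  ultimately show False using eps by (simp add: nrm_mult nrm_2)
qed

lemma refl_coeff_unit: "\<tau> s = s \<Longrightarrow> nrm s \<le> 1 \<Longrightarrow> nrm (refl_coeff s) = 1"
  using refl_denominator_unit by (simp add: refl_coeff_def nrm_inverse)

text \<open>For e = \<open>eps - s / 2\<close> with conjugate e', one has 1/e + 1/e' = (e + e')/(e
  e') and e + e' = -s.\<close>

lemma refl_coeff_eq:
  assumes "\<tau> s = s" "nrm s \<le> 1"
  shows "refl_coeff s + \<tau> (refl_coeff s) + refl_coeff s * \<tau> (refl_coeff s) * s = 0"
proof -
  have t: "\<tau> (eps - s / 2) = - eps - s / 2"
    using assms(1) eps(1) by (simp only: tau_hom(2,6,7) divide_inverse tau_2)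
  have nz: "eps - s / 2 \<noteq> 0" "- eps - s / 2 \<noteq> 0"
    using refl_denominator_unit[OF assms] t tau_isometry[of "eps - s / 2"] by auto
  have "inverse (eps - s / 2) + inverse (- eps - s / 2) =
      inverse (eps - s / 2) * inverse (- eps - s / 2) * ((eps - s / 2) + (- eps - s / 2))"
    unfolding division_ring_inverse_add[OF nz] by (simp only: mult_ac)
  also have "(eps - s / 2) + (- eps - s / 2) = - s" by simp
  finally show ?thesis unfolding refl_coeff_def tau_hom(7) t by simp
qed

text \<open>The scalar of the reflection varies with u; this keeps the events dependent on the
  values u^* M^j u only modulo p^k.\<close>

lemma refl_coeff_close:
  assumes "\<tau> s = s" "nrm s \<le> 1" "\<tau> s' = s'" "nrm s' \<le> 1" "nrm (s - s') \<le> c"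
  shows "nrm (refl_coeff s - refl_coeff s') \<le> c"
proof -
  have u: "nrm (eps - s / 2) = 1" "nrm (eps - s' / 2) = 1" using refl_denominator_unit assms by auto
  then have nz: "eps - s / 2 \<noteq> 0" "eps - s' / 2 \<noteq> 0" by auto
  have "refl_coeff s - refl_coeff s' = ((eps - s' / 2) - (eps - s / 2)) * refl_coeff s * refl_coeff s'"
    unfolding refl_coeff_def division_ring_inverse_diff[OF nz] by (simp only: mult_ac)
  also have "(eps - s' / 2) - (eps - s / 2) = (s - s') / 2" by (simp add: diff_divide_distrib)
  finally have e: "refl_coeff s - refl_coeff s' = (s - s') / 2 * refl_coeff s * refl_coeff s'" .
  have "nrm (refl_coeff s - refl_coeff s') = nrm (s - s')"
    unfolding e by (simp add: nrm_mult nrm_divide nrm_2 refl_coeff_unit assms)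
  then show ?thesis using assms by simp
qed

definition refl_mat :: "nat \<Rightarrow> 'k vec \<Rightarrow> 'k mat" where
  "refl_mat n u = 1\<^sub>m n + outer_mat n (refl_coeff (herm u u) \<cdot>\<^sub>v u) (conj_vec u)"

text \<open>The product of the two updates has rank-one part with coefficient a + b + a b u^* u.
  Taking b to be the conjugate of a, and then the reverse, gives both one-sided inverses.\<close>

lemma rank_one_unitary_mult:
  assumes u: "u \<in> carrier_vec n" and ab: "a + b + a * b * herm u u = 0"
  shows "(1\<^sub>m n + outer_mat n (a \<cdot>\<^sub>v u) (conj_vec u)) * (1\<^sub>m n + outer_mat n (b \<cdot>\<^sub>v u) (conj_vec u)) = 1\<^sub>m n"
proof -
  let ?o = "\<lambda>a. outer_mat n (a \<cdot>\<^sub>v u) (conj_vec u)"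
  have cu: "conj_vec u \<in> carrier_vec n" using u by simp
  have "?o a * ?o b = outer_mat n (?o a *\<^sub>v (b \<cdot>\<^sub>v u)) (conj_vec u)"
    using u cu by (intro mult_outer_mat) auto
  also have "?o a *\<^sub>v (b \<cdot>\<^sub>v u) = (conj_vec u \<bullet> (b \<cdot>\<^sub>v u)) \<cdot>\<^sub>v (a \<cdot>\<^sub>v u)"
    using u cu by (intro outer_mat_mult_vec) auto
  also have "\<dots> = (a * b * herm u u) \<cdot>\<^sub>v u"
    using u cu by (intro eq_vecI) (simp_all add: herm_def)
  finally have oo: "?o a * ?o b = ?o (a * b * herm u u)" .
  have "(1\<^sub>m n + ?o a) * (1\<^sub>m n + ?o b) = 1\<^sub>m n * (1\<^sub>m n + ?o b) + ?o a * (1\<^sub>m n + ?o b)"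
    by (rule add_mult_distrib_mat[of _ n n]) auto
  also have "?o a * (1\<^sub>m n + ?o b) = ?o a * 1\<^sub>m n + ?o a * ?o b"
    by (rule mult_add_distrib_mat[of _ n n]) auto
  also have "1\<^sub>m n * (1\<^sub>m n + ?o b) = 1\<^sub>m n + ?o b" by (rule left_mult_one_mat) auto
  also have "?o a * 1\<^sub>m n = ?o a" by (rule right_mult_one_mat) auto
  also have "1\<^sub>m n + ?o b + (?o a + ?o a * ?o b) = 1\<^sub>m n"
  proof (rule eq_matI)
    fix i j assume ij: "i < dim_row (1\<^sub>m n :: 'k mat)" "j < dim_col (1\<^sub>m n :: 'k mat)"
    have "b * u $ i * \<tau> (u $ j) + (a * u $ i * \<tau> (u $ j) + a * b * herm u u * u $ i * \<tau> (u $ j)) =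
        (a + b + a * b * herm u u) * (u $ i * \<tau> (u $ j))" by (simp add: algebra_simps)
    then show "(1\<^sub>m n + ?o b + (?o a + ?o a * ?o b)) $$ (i, j) = 1\<^sub>m n $$ (i, j)"
      unfolding oo using ij u by (simp add: outer_mat_def ab)
  qed auto
  finally show ?thesis .
qed

lemma herm_self: "u \<in> ivec n \<Longrightarrow> \<tau> (herm u u) = herm u u" "u \<in> ivec n \<Longrightarrow> nrm (herm u u) \<le> 1"
  by (simp_all add: tau_herm[OF ivec_carrier ivec_carrier] herm_integral)

lemma refl_mat_unitary:
  assumes u: "u \<in> ivec n"
  shows "refl_mat n u \<in> UU n"
proof (rule unitary_groupI)
  let ?a = "refl_coeff (herm u u)"
  have uc: "u \<in> carrier_vec n" using u by (rule ivec_carrier)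
  have a: "nrm ?a = 1" using herm_self[OF u] by (rule refl_coeff_unit)
  have eq: "?a + \<tau> ?a + ?a * \<tau> ?a * herm u u = 0" using herm_self[OF u] by (rule refl_coeff_eq)
  have adj: "adj (refl_mat n u) = 1\<^sub>m n + outer_mat n (\<tau> ?a \<cdot>\<^sub>v u) (conj_vec u)"
    using uc by (intro eq_matI) (auto simp: adj_def refl_mat_def outer_mat_def tau_hom)
  show "refl_mat n u * adj (refl_mat n u) = 1\<^sub>m n"
    unfolding adj unfolding refl_mat_def using uc eq by (rule rank_one_unitary_mult)
  have "\<tau> ?a + ?a + \<tau> ?a * ?a * herm u u = 0" using eq by (simp add: algebra_simps)
  then show "adj (refl_mat n u) * refl_mat n u = 1\<^sub>m n"
    unfolding adj unfolding refl_mat_def using uc by (intro rank_one_unitary_mult)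
  show "refl_mat n u \<in> mat_over n RR"
  proof -
    have "nrm (?a * u $ i * \<tau> (u $ j)) \<le> 1" if "i < n" "j < n" for i j
      using that u a by (intro nrm_mult_le_one) (auto simp: ivec_def)
    then show ?thesis using uc by (auto simp: mat_over_RR refl_mat_def outer_mat_def intro!: nrm_add_le)
  qed
qed

lemma refl_mat_mult_vec:
  assumes "u \<in> carrier_vec n" "y \<in> carrier_vec n"
  shows "refl_mat n u *\<^sub>v y = y + (refl_coeff (herm u u) * herm u y) \<cdot>\<^sub>v u"
proof -
  let ?a = "refl_coeff (herm u u)"
  have "refl_mat n u *\<^sub>v y = 1\<^sub>m n *\<^sub>v y + outer_mat n (?a \<cdot>\<^sub>v u) (conj_vec u) *\<^sub>v y"
    unfolding refl_mat_def using assms by (intro add_mult_distrib_mat_vec) auto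
  also have "outer_mat n (?a \<cdot>\<^sub>v u) (conj_vec u) *\<^sub>v y = herm u y \<cdot>\<^sub>v (?a \<cdot>\<^sub>v u)"
    unfolding herm_def using assms by (intro outer_mat_mult_vec) auto
  finally show ?thesis using assms by (simp add: smult_smult_assoc mult.commute)
qed

text \<open>The matrix h_u M is M plus the outer product of a u with the row vector u^* M. That row
  absorbs one factor M, which turns the exponents j - 1 of the update formula into j.\<close>

lemma frob_trace_refl_mult:
  assumes u: "u \<in> ivec n" and M: "M \<in> carrier_mat n n"
  shows "frob_trace i (refl_mat n u * M) =
    frob_trace i M + frob_newton (\<lambda>j. refl_coeff (herm u u) * herm u ((M ^\<^sub>m j) *\<^sub>v u)) i"
proof -
  let ?a = "refl_coeff (herm u u)" and ?z = "transpose_mat M *\<^sub>v conj_vec u"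
  have uc: "u \<in> carrier_vec n" and cu: "conj_vec u \<in> carrier_vec n" using ivec_carrier[OF u] by auto
  have z: "?z \<in> carrier_vec n" using M cu by (intro mult_mat_vec_carrier) auto
  have pM: "M ^\<^sub>m k \<in> carrier_mat n n" for k using M by simp
  have "refl_mat n u * M = 1\<^sub>m n * M + outer_mat n (?a \<cdot>\<^sub>v u) (conj_vec u) * M"
    unfolding refl_mat_def using M by (intro add_mult_distrib_mat) auto
  also have "\<dots> = M + outer_mat n (?a \<cdot>\<^sub>v u) ?z"
    using M uc cu by (simp add: outer_mat_mult)
  finally have "frob_trace i (refl_mat n u * M) =
      frob_trace i M + frob_newton (\<lambda>j. ?z \<bullet> ((M ^\<^sub>m (j - 1)) *\<^sub>v (?a \<cdot>\<^sub>v u))) i"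
    using M uc z by (simp add: frob_trace_update)
  moreover have "frob_newton (\<lambda>j. ?z \<bullet> ((M ^\<^sub>m (j - 1)) *\<^sub>v (?a \<cdot>\<^sub>v u))) i =
      frob_newton (\<lambda>j. ?a * herm u ((M ^\<^sub>m j) *\<^sub>v u)) i"
  proof (rule frob_newton_cong)
    fix j assume "j \<in> {1..i}"
    then obtain l where j: "j = Suc l" by (cases j) auto
    have w: "(M ^\<^sub>m l) *\<^sub>v u \<in> carrier_vec n" using pM uc by (rule mult_mat_vec_carrier)
    have "(M ^\<^sub>m l) *\<^sub>v (?a \<cdot>\<^sub>v u) = ?a \<cdot>\<^sub>v ((M ^\<^sub>m l) *\<^sub>v u)" using pM uc by (rule mult_mat_vec)
    then have "?z \<bullet> ((M ^\<^sub>m (j - 1)) *\<^sub>v (?a \<cdot>\<^sub>v u)) = ?a * (?z \<bullet> ((M ^\<^sub>m l) *\<^sub>v u))"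
      using z w by (simp add: j)
    also have "?z \<bullet> ((M ^\<^sub>m l) *\<^sub>v u) = conj_vec u \<bullet> (M *\<^sub>v ((M ^\<^sub>m l) *\<^sub>v u))"
      by (rule transpose_vec_mult_scalar[OF M w cu])
    also have "M *\<^sub>v ((M ^\<^sub>m l) *\<^sub>v u) = (M ^\<^sub>m j) *\<^sub>v u"
      unfolding j pow_mat_Suc2[OF M] using assoc_mult_mat_vec[OF M pM uc] by simp
    finally show "?z \<bullet> ((M ^\<^sub>m (j - 1)) *\<^sub>v (?a \<cdot>\<^sub>v u)) = ?a * herm u ((M ^\<^sub>m j) *\<^sub>v u)"
      by (simp add: herm_def)
  qed
  ultimately show ?thesis by simp
qed

end

subsection \<open>Finite levels\<close>

lemma transversal_PiE:
  assumes "finite I" and T: "\<And>i. i \<in> I \<Longrightarrow> transversal (S i) E (T i)"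
  shows "transversal {a. \<forall>i\<in>I. a i \<in> S i} (\<lambda>a b. \<forall>i\<in>I. E (a i) (b i)) (Pi\<^sub>E I T)"
  unfolding transversal_def
proof (intro conjI ballI impI)
  note T' = T[unfolded transversal_def]
  show "finite (Pi\<^sub>E I T)" using assms(1) T' by (intro finite_PiE) auto
  show "Pi\<^sub>E I T \<subseteq> {a. \<forall>i\<in>I. a i \<in> S i}" using T' by (auto dest!: PiE_mem) blast
  fix a assume "a \<in> {a. \<forall>i\<in>I. a i \<in> S i}"
  then have "\<forall>i\<in>I. \<exists>t\<in>T i. E (a i) t" using T' by blast
  then obtain t where "\<forall>i\<in>I. t i \<in> T i \<and> E (a i) (t i)" by metis
  then show "\<exists>t\<in>Pi\<^sub>E I T. \<forall>i\<in>I. E (a i) (t i)"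
    by (intro bexI[of _ "restrict t I"]) auto
next
  fix a b assume ab: "a \<in> Pi\<^sub>E I T" "b \<in> Pi\<^sub>E I T" "\<forall>i\<in>I. E (a i) (b i)"
  show "a = b"
  proof (rule PiE_ext[OF ab(1,2)])
    fix i assume "i \<in> I"
    then show "a i = b i" using T[of i] ab PiE_mem[OF ab(1), of i] PiE_mem[OF ab(2), of i]
      by (simp add: transversal_def)
  qed
qed

lemma equivp_fun: "equivp E \<Longrightarrow> equivp (\<lambda>a b. \<forall>i\<in>I. E (a i) (b i))"
  by (intro equivpI reflpI sympI transpI) (auto intro: equivp_reflp equivp_symp equivp_transp)

context unramified_quadratic
begin

abbreviation lv :: "nat \<Rightarrow> real" where "lv k \<equiv> (1 / real p) ^ k"

abbreviation cong_lv :: "nat \<Rightarrow> 'k \<Rightarrow> 'k \<Rightarrow> bool" where "cong_lv k x y \<equiv> nrm (x - y) \<le> lv k"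

abbreviation "close_fun I k \<equiv> (\<lambda>a b. \<forall>i\<in>I. cong_lv k (a i) (b i))"

lemma lv_nonneg: "0 \<le> lv k" by simp

lemma lv_1: "nrm x \<le> lv 1 \<longleftrightarrow> nrm x < 1"
  by (simp add: nrm_lt_1_iff_le)

lemma lv_le_lv1: "k \<ge> 1 \<Longrightarrow> lv k \<le> lv 1"
  using p_gt_1 by (intro power_decreasing) auto

lemma equivp_cong_lv: "equivp (cong_lv k)"
  by (intro equivpI reflpI sympI transpI) (auto simp: nrm_minus_commute intro: nrm_diff_trans)

lemma equivp_close_vec: "equivp (close_vec n (lv k))"
  unfolding close_vec_def
  by (intro equivpI reflpI sympI transpI) (auto simp: nrm_minus_commute intro: nrm_diff_trans)

lemma equivp_close_mat: "equivp (close_mat n (lv k))"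
  unfolding close_mat_def
proof (intro equivpI reflpI sympI transpI allI impI)
  fix A B C :: "'k mat" and i j
  assume "\<forall>i<n. \<forall>j<n. cong_lv k (A $$ (i, j)) (B $$ (i, j))"
    "\<forall>i<n. \<forall>j<n. cong_lv k (B $$ (i, j)) (C $$ (i, j))" "i < n" "j < n"
  then show "cong_lv k (A $$ (i, j)) (C $$ (i, j))"
    using nrm_diff_trans[of "A $$ (i, j)" "B $$ (i, j)" "lv k" "C $$ (i, j)"] by blast
qed (auto simp: nrm_minus_commute)

lemma residues_finite: "\<exists>S. finite S \<and> (\<forall>x. nrm x \<le> 1 \<longrightarrow> (\<exists>s\<in>S. cong_lv k x s))"
proof (induction k)
  case 0
  show ?case by (intro exI[of _ "{0}"]) auto
next
  case (Suc k)
  then obtain S where S: "finite S" "\<forall>x. nrm x \<le> 1 \<longrightarrow> (\<exists>s\<in>S. cong_lv k x s)" by blast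
  obtain S1 where S1: "finite S1" "\<And>x. nrm x \<le> 1 \<Longrightarrow> \<exists>s\<in>S1. nrm (x - s) < 1"
    using K_residues_finite by metis
  let ?T = "(\<lambda>(s, t). s + of_nat p ^ k * t) ` (S \<times> S1)"
  show ?case
  proof (intro exI[of _ ?T] conjI allI impI)
    show "finite ?T" using S S1 by simp
    fix x assume "nrm x \<le> 1"
    then obtain s where s: "s \<in> S" "cong_lv k x s" using S by blast
    define y where "y = (x - s) / of_nat p ^ k"
    have pk: "nrm (of_nat p ^ k) = lv k" "lv k > 0" using p_pos by (auto simp: nrm_power nrm_p)
    have "nrm y \<le> 1" unfolding y_def nrm_divide pk(1) using s pk by simp
    then obtain t where t: "t \<in> S1" "nrm (y - t) < 1" using S1 by blast
    have "of_nat p ^ k * y = x - s" using p_pos by (simp add: y_def)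
    then have "x - (s + of_nat p ^ k * t) = of_nat p ^ k * (y - t)"
      by (simp add: right_diff_distrib)
    also have "nrm \<dots> \<le> lv k * (1 / real p)"
      unfolding nrm_mult pk(1) using t nrm_less_1_imp_le[of "y - t"] by (intro mult_left_mono) auto
    finally show "\<exists>s\<in>?T. cong_lv (Suc k) x s" using s t by (auto simp: mult.commute)
  qed
qed

lemma transversal_integers_subset:
  assumes "A \<subseteq> {x. nrm x \<le> 1}"
  shows "\<exists>T. transversal A (cong_lv k) T"
proof (rule transversal_exists)
  let ?\<kappa> = "\<lambda>x. {y. cong_lv k x y}"
  show eq: "?\<kappa> x = ?\<kappa> y \<longleftrightarrow> cong_lv k x y" for x y
  proof
    assume "?\<kappa> x = ?\<kappa> y"
    moreover have "y \<in> ?\<kappa> y" by simp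
    ultimately show "cong_lv k x y" by blast
  next
    assume xy: "cong_lv k x y"
    then have yx: "cong_lv k y x" by (simp add: nrm_minus_commute)
    show "?\<kappa> x = ?\<kappa> y"
      using nrm_diff_trans[OF xy] nrm_diff_trans[OF yx] by blast
  qed
  obtain S where S: "finite S" "\<forall>x. nrm x \<le> 1 \<longrightarrow> (\<exists>s\<in>S. cong_lv k x s)" using residues_finite by blast
  have "?\<kappa> ` A \<subseteq> ?\<kappa> ` S"
  proof
    fix c assume "c \<in> ?\<kappa> ` A"
    then obtain x where x: "x \<in> A" "c = ?\<kappa> x" by blast
    then obtain s where "s \<in> S" "cong_lv k x s" using S(2) assms by blast
    then show "c \<in> ?\<kappa> ` S" using x eq[of x s] by blast
  qed
  then show "finite (?\<kappa> ` A)" using S(1) finite_surj by blast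
qed

section \<open>Representatives modulo p^k\<close>

definition residue_reps :: "nat \<Rightarrow> 'k set" where
  "residue_reps k = (SOME T. transversal {x. nrm x \<le> 1} (cong_lv k) T)"

definition fixed_reps :: "nat \<Rightarrow> 'k set" where
  "fixed_reps k = (SOME T. transversal {x. nrm x \<le> 1 \<and> \<tau> x = x} (cong_lv k) T)"

definition vec_reps :: "nat \<Rightarrow> nat \<Rightarrow> 'k vec set" where
  "vec_reps n k = (\<lambda>f. vec n f) ` (Pi\<^sub>E {..<n} (\<lambda>_. residue_reps k))"

definition unitary_reps :: "nat \<Rightarrow> nat \<Rightarrow> 'k mat set" where
  "unitary_reps n k = (SOME T. transversal (UU n) (close_mat n (lv k)) T)"

text \<open>This is the range for the values u^* M^j u, j from 0 to d: at j = 0 the value is fixed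
  by \<tau>, elsewhere it is an arbitrary integer. Entries beyond d are left free, and the
  membership form matches \<open>transversal_PiE\<close>.\<close>

definition form_space :: "nat \<Rightarrow> (nat \<Rightarrow> 'k) set" where
  "form_space d = {a. \<forall>j\<in>{0..d}. a j \<in> (if j = 0 then {x. nrm x \<le> 1 \<and> \<tau> x = x} else {x. nrm x \<le> 1})}"

definition form_reps :: "nat \<Rightarrow> nat \<Rightarrow> (nat \<Rightarrow> 'k) set" where
  "form_reps d k = Pi\<^sub>E {0..d} (\<lambda>j. if j = 0 then fixed_reps k else residue_reps k)"

lemma transversal_residue_reps: "transversal {x. nrm x \<le> 1} (cong_lv k) (residue_reps k)"
  unfolding residue_reps_def by (rule someI_ex, rule transversal_integers_subset) auto

lemma transversal_fixed_reps: "transversal {x. nrm x \<le> 1 \<and> \<tau> x = x} (cong_lv k) (fixed_reps k)"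
  unfolding fixed_reps_def by (rule someI_ex, rule transversal_integers_subset) auto

lemma transversal_form_reps: "transversal (form_space d) (close_fun {0..d} k) (form_reps d k)"
  unfolding form_space_def form_reps_def by (rule transversal_PiE) (use transversal_residue_reps transversal_fixed_reps in auto)

lemma finite_residue_reps: "finite (residue_reps k)" and residue_reps_integral: "t \<in> residue_reps k \<Longrightarrow> nrm t \<le> 1"
  and residue_reps_ex: "nrm x \<le> 1 \<Longrightarrow> \<exists>t\<in>residue_reps k. cong_lv k x t"
  and residue_reps_unique: "t \<in> residue_reps k \<Longrightarrow> t' \<in> residue_reps k \<Longrightarrow> cong_lv k t t' \<Longrightarrow> t = t'"
  using transversal_residue_reps[of k] by (auto simp: transversal_def)

lemma card_residue_reps_ge: "k \<ge> 1 \<Longrightarrow> card (residue_reps k) \<ge> 2"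
proof -
  assume k: "k \<ge> 1"
  obtain t0 t1 where t: "t0 \<in> residue_reps k" "cong_lv k 0 t0" "t1 \<in> residue_reps k" "cong_lv k 1 t1"
    using residue_reps_ex[of 0 k] residue_reps_ex[of 1 k] by auto
  have "t0 \<noteq> t1"
  proof
    assume "t0 = t1"
    then have "cong_lv k 0 1" using t nrm_diff_trans[of 0 t0 "lv k" 1] by (simp add: nrm_minus_commute)
    then have "(1::real) \<le> lv 1" using lv_le_lv1[OF k] by simp
    then show False using p_gt_1 by simp
  qed
  then have "card {t0, t1} = 2" by simp
  moreover have "{t0, t1} \<subseteq> residue_reps k" using t by auto
  ultimately show ?thesis using card_mono[OF finite_residue_reps] by metis
qed

lemma vec_reps_mem:
  assumes "v \<in> vec_reps n k"
  shows "v \<in> carrier_vec n" "i < n \<Longrightarrow> v $ i \<in> residue_reps k"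
proof -
  obtain f where f: "f \<in> Pi\<^sub>E {..<n} (\<lambda>_. residue_reps k)" "v = vec n f"
    using assms unfolding vec_reps_def by blast
  show "v \<in> carrier_vec n" by (simp add: f(2))
  show "i < n \<Longrightarrow> v $ i \<in> residue_reps k" using PiE_mem[OF f(1), of i] by (simp add: f(2))
qed

lemma transversal_vec_reps: "transversal (ivec n) (close_vec n (lv k)) (vec_reps n k)"
  unfolding transversal_def
proof (intro conjI ballI impI)
  show "finite (vec_reps n k)" unfolding vec_reps_def by (intro finite_imageI finite_PiE) (auto simp: finite_residue_reps)
  show "vec_reps n k \<subseteq> ivec n"
  proof
    fix v assume v: "v \<in> vec_reps n k"
    have "nrm (v $ i) \<le> 1" if "i < n" for i using vec_reps_mem(2)[OF v that] by (rule residue_reps_integral)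
    then show "v \<in> ivec n" using vec_reps_mem(1)[OF v] by (simp add: ivec_def)
  qed
  fix v assume v: "v \<in> ivec n"
  then have "\<forall>i<n. \<exists>t\<in>residue_reps k. cong_lv k (v $ i) t" using residue_reps_ex by (simp add: ivec_def)
  then obtain t where t: "\<forall>i<n. t i \<in> residue_reps k \<and> cong_lv k (v $ i) (t i)" by metis
  have "vec n (restrict t {..<n}) \<in> vec_reps n k" unfolding vec_reps_def using t by (intro imageI restrict_PiE_iff[THEN iffD2]) simp
  moreover have "close_vec n (lv k) v (vec n (restrict t {..<n}))" using t by (simp add: close_vec_def)
  ultimately show "\<exists>t\<in>vec_reps n k. close_vec n (lv k) v t" by blast
next
  fix v v' assume vv: "v \<in> vec_reps n k" "v' \<in> vec_reps n k" "close_vec n (lv k) v v'"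
  have "v $ i = v' $ i" if "i < n" for i
    using vv that by (intro residue_reps_unique[of _ k] vec_reps_mem(2)) (simp_all add: close_vec_def)
  then show "v = v'" using vec_reps_mem(1)[OF vv(1)] vec_reps_mem(1)[OF vv(2)] by (intro eq_vecI) simp_all
qed

lemma card_vec_reps: "card (vec_reps n k) = card (residue_reps k) ^ n"
proof -
  have "inj_on (\<lambda>f. vec n f) (Pi\<^sub>E {..<n} (\<lambda>_. residue_reps k))"
  proof (rule inj_onI)
    fix f g assume fg: "f \<in> Pi\<^sub>E {..<n} (\<lambda>_. residue_reps k)" "g \<in> Pi\<^sub>E {..<n} (\<lambda>_. residue_reps k)" "vec n f = vec n g"
    show "f = g"
    proof (rule PiE_ext[OF fg(1,2)])
      fix i assume "i \<in> {..<n}"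
      then show "f i = g i" using arg_cong[OF fg(3), of "\<lambda>v. v $ i"] by simp
    qed
  qed
  then show ?thesis by (simp add: vec_reps_def card_image card_PiE)
qed

lemma finite_vec_reps: "finite (vec_reps n k)" and vec_reps_ivec: "v \<in> vec_reps n k \<Longrightarrow> v \<in> ivec n"
  and vec_reps_unique: "v \<in> vec_reps n k \<Longrightarrow> v' \<in> vec_reps n k \<Longrightarrow> close_vec n (lv k) v v' \<Longrightarrow> v = v'"
  using transversal_vec_reps[of n k] by (auto simp: transversal_def)

text \<open>Rounding all entries to residue representatives is a class invariant with finitely many
  values. The rounded matrix need not be unitary, so representatives are chosen in the classes
  instead of being listed as for vectors.\<close>

lemma transversal_unitary_reps: "transversal (UU n) (close_mat n (lv k)) (unitary_reps n k)"
  unfolding unitary_reps_def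
proof (rule someI_ex)
  define \<rho> where "\<rho> x = (SOME t. t \<in> residue_reps k \<and> cong_lv k x t)" for x
  have \<rho>: "\<rho> x \<in> residue_reps k \<and> cong_lv k x (\<rho> x)" if "nrm x \<le> 1" for x
  proof -
    have "\<exists>t. t \<in> residue_reps k \<and> cong_lv k x t" using residue_reps_ex[OF that, of k] by blast
    from someI_ex[OF this] show ?thesis by (simp only: \<rho>_def)
  qed
  have \<rho>eq: "\<rho> x = \<rho> y \<longleftrightarrow> cong_lv k x y" if "nrm x \<le> 1" "nrm y \<le> 1" for x y
  proof -
    have x: "\<rho> x \<in> residue_reps k" "cong_lv k x (\<rho> x)" "cong_lv k (\<rho> x) x"
      using \<rho>[OF that(1)] nrm_minus_commute[of x "\<rho> x"] by simp_all
    have y: "\<rho> y \<in> residue_reps k" "cong_lv k y (\<rho> y)" "cong_lv k (\<rho> y) y"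
      using \<rho>[OF that(2)] nrm_minus_commute[of y "\<rho> y"] by simp_all
    show ?thesis
    proof
      assume "\<rho> x = \<rho> y"
      then have "cong_lv k (\<rho> x) y" using y(3) by simp
      then show "cong_lv k x y" by (rule nrm_diff_trans[OF x(2)])
    next
      assume "cong_lv k x y"
      from nrm_diff_trans[OF nrm_diff_trans[OF x(3) this] y(2)] show "\<rho> x = \<rho> y"
        by (rule residue_reps_unique[OF x(1) y(1)])
    qed
  qed
  let ?\<kappa> = "\<lambda>M. mat n n (\<lambda>ij. \<rho> (M $$ ij))"
  show "\<exists>T. transversal (UU n) (close_mat n (lv k)) T"
  proof (rule transversal_exists[where \<kappa> = ?\<kappa>])
    have "?\<kappa> ` UU n \<subseteq> (\<lambda>f. mat n n f) ` (Pi\<^sub>E ({..<n} \<times> {..<n}) (\<lambda>_. residue_reps k))"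
    proof
      fix C assume "C \<in> ?\<kappa> ` UU n"
      then obtain M where M: "M \<in> UU n" "C = ?\<kappa> M" by blast
      let ?f = "restrict (\<lambda>ij. \<rho> (M $$ ij)) ({..<n} \<times> {..<n})"
      have "C = mat n n ?f" unfolding M(2) by (intro eq_matI) auto
      moreover have "?f \<in> Pi\<^sub>E ({..<n} \<times> {..<n}) (\<lambda>_. residue_reps k)"
        using unitary_groupD(1)[OF M(1)] \<rho> by (intro restrict_PiE_iff[THEN iffD2] ballI) (auto simp: mat_over_RR)
      ultimately show "C \<in> (\<lambda>f. mat n n f) ` (Pi\<^sub>E ({..<n} \<times> {..<n}) (\<lambda>_. residue_reps k))" by (intro image_eqI)
    qed
    then show "finite (?\<kappa> ` UU n)"
      by (rule finite_subset) (intro finite_imageI finite_PiE, auto simp: finite_residue_reps)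
    fix M N assume MN: "M \<in> UU n" "N \<in> UU n"
    note D = unitary_groupD(1)[OF MN(1)] unitary_groupD(1)[OF MN(2)]
    have "?\<kappa> M = ?\<kappa> N \<longleftrightarrow> (\<forall>i<n. \<forall>j<n. \<rho> (M $$ (i, j)) = \<rho> (N $$ (i, j)))"
    proof
      assume eq: "?\<kappa> M = ?\<kappa> N"
      show "\<forall>i<n. \<forall>j<n. \<rho> (M $$ (i, j)) = \<rho> (N $$ (i, j))"
      proof (intro allI impI)
        fix i j assume "i < n" "j < n"
        moreover have "?\<kappa> M $$ (i, j) = ?\<kappa> N $$ (i, j)" by (simp only: eq)
        ultimately show "\<rho> (M $$ (i, j)) = \<rho> (N $$ (i, j))" by simp
      qed
    qed (auto intro!: eq_matI)
    also have "\<dots> \<longleftrightarrow> close_mat n (lv k) M N"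
      using \<rho>eq D by (simp add: close_mat_def mat_over_RR)
    finally show "?\<kappa> M = ?\<kappa> N \<longleftrightarrow> close_mat n (lv k) M N" .
  qed
qed

lemma finite_unitary_reps: "finite (unitary_reps n k)" and unitary_reps_UU: "M \<in> unitary_reps n k \<Longrightarrow> M \<in> UU n"
  using transversal_unitary_reps[of n k] by (auto simp: transversal_def)

lemma unitary_reps_nonempty: "unitary_reps n k \<noteq> {}"
  using transversal_unitary_reps[of n k] unitary_group_one[of n] by (auto simp: transversal_def)

text \<open>The finite-level form of left invariance of Haar measure; the inverse of h shows that
  translation does not merge classes.\<close>

lemma sum_unitary_reps_translate:
  fixes g :: "'k mat \<Rightarrow> real"
  assumes h: "h \<in> UU n" and g: "\<And>M N. M \<in> UU n \<Longrightarrow> N \<in> UU n \<Longrightarrow> close_mat n (lv k) M N \<Longrightarrow> g M = g N"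
  shows "(\<Sum>M\<in>unitary_reps n k. g (h * M)) = (\<Sum>M\<in>unitary_reps n k. g M)"
proof (rule transversal_sum_reindex[OF equivp_close_mat transversal_unitary_reps])
  fix M N assume MN: "M \<in> UU n" "N \<in> UU n" "close_mat n (lv k) (h * M) (h * N)"
  note H = unitary_groupD[OF h] and DM = unitary_groupD[OF MN(1)] and DN = unitary_groupD[OF MN(2)]
  have canc: "adj h * (h * A) = A" if "A \<in> carrier_mat n n" for A
    using assoc_mult_mat[OF adj_carrier[OF H(2)] H(2) that] left_mult_one_mat[OF that] by (simp add: H(4))
  have "close_mat n (lv k) (adj h * (h * M)) (adj h * (h * N))"
    by (rule close_mat_mult[OF adj_mat_over[OF H(1)] mat_over_mult[OF H(1) DM(1)] adj_mat_over[OF H(1)]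
          mat_over_mult[OF H(1) DN(1)] close_mat_refl[OF lv_nonneg] MN(3) lv_nonneg])
  then show "close_mat n (lv k) M N" by (simp add: canc DM(2) DN(2))
next
  show "h * M \<in> UU n" if "M \<in> UU n" for M using h that by (rule unitary_group_mult)
qed (rule g)

subsection \<open>Independence modulo \<open>p\<close>\<close>


definition dot :: "nat \<Rightarrow> (nat \<Rightarrow> 'k) \<Rightarrow> (nat \<Rightarrow> 'k) \<Rightarrow> 'k" where
  "dot n f g = (\<Sum>l<n. f l * g l)"

text \<open>Linear independence of the reductions over the residue field.\<close>

definition indep :: "nat \<Rightarrow> nat \<Rightarrow> (nat \<Rightarrow> 'k vec) \<Rightarrow> bool" where
  "indep n m v \<longleftrightarrow> (\<forall>\<alpha>. (\<forall>i<m. nrm (\<alpha> i) \<le> 1) \<longrightarrow> (\<forall>l<n. nrm (\<Sum>i<m. \<alpha> i * v i $ l) < 1) \<longrightarrow>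
     (\<forall>i<m. nrm (\<alpha> i) < 1))"

lemma nrm_diff_lt: "nrm x < 1 \<Longrightarrow> nrm y < 1 \<Longrightarrow> nrm (x - y) < 1"
  using nrm_diff[of x y] by simp

lemma nrm_add_lt: "nrm x < 1 \<Longrightarrow> nrm y < 1 \<Longrightarrow> nrm (x + y) < 1"
  using nrm_add[of x y] by simp

lemma nrm_sum_lt: "(\<And>i. i \<in> I \<Longrightarrow> nrm (f i) < 1) \<Longrightarrow> nrm (sum f I) < 1"
  by (induction I rule: infinite_finite_induct) (auto intro: nrm_add_lt)

lemma nrm_mult_lt: "nrm x \<le> 1 \<Longrightarrow> nrm y < 1 \<Longrightarrow> nrm (x * y) < 1"
  using nrm_mult_le[of x y "nrm y"] by simp

lemma dot_integral: "(\<And>l. l < n \<Longrightarrow> nrm (f l) \<le> 1) \<Longrightarrow> (\<And>l. l < n \<Longrightarrow> nrm (g l) \<le> 1) \<Longrightarrow> nrm (dot n f g) \<le> 1"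
  unfolding dot_def by (intro nrm_sum_le nrm_mult_le_one) auto

lemma dot_lin_right:
  "dot n f (\<lambda>l. g l - (\<Sum>j<m. c j * u j l)) = dot n f g - (\<Sum>j<m. c j * dot n f (u j))"
proof -
  have "(\<Sum>l<n. f l * (\<Sum>j<m. c j * u j l)) = (\<Sum>j<m. \<Sum>l<n. c j * (f l * u j l))"
    unfolding sum_distrib_left by (subst sum.swap) (simp add: mult.left_commute)
  then show ?thesis by (simp add: dot_def right_diff_distrib sum_subtractf sum_distrib_left)
qed

text \<open>A Gram-Schmidt induction. Independence modulo p provides a unit coordinate after the
  earlier components are removed, and dividing by it makes the dual system exact over the integers,
  not merely modulo p.\<close>

lemma indep_dual:
  assumes "indep n m v" "\<And>i. i < m \<Longrightarrow> v i \<in> ivec n"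
  shows "\<exists>u. (\<forall>j<m. \<forall>l<n. nrm (u j l) \<le> 1) \<and> (\<forall>i<m. \<forall>j<m. dot n (\<lambda>l. v i $ l) (u j) = of_bool (i = j))"
  using assms
proof (induction m)
  case (Suc m)
  have vi: "nrm (v i $ l) \<le> 1" if "i < Suc m" "l < n" for i l
    using Suc.prems(2)[OF that(1)] that(2) by (simp add: ivec_def)
  have "indep n m v"
    unfolding indep_def
  proof (intro allI impI)
    fix \<alpha> i assume a: "\<forall>i<m. nrm (\<alpha> i) \<le> 1" "\<forall>l<n. nrm (\<Sum>i<m. \<alpha> i * v i $ l) < 1" "i < m"
    let ?\<alpha> = "\<alpha>(m := 0)"
    have "(\<Sum>i<Suc m. ?\<alpha> i * v i $ l) = (\<Sum>i<m. \<alpha> i * v i $ l)" for l by simp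
    moreover have "\<forall>i<Suc m. nrm (?\<alpha> i) \<le> 1" using a by (simp add: less_Suc_eq)
    ultimately have "\<forall>i<Suc m. nrm (?\<alpha> i) < 1"
      using Suc.prems(1)[unfolded indep_def, rule_format, of ?\<alpha>] a by (simp only:) blast
    then have "nrm (?\<alpha> i) < 1" using a(3) less_Suc_eq by blast
    then show "nrm (\<alpha> i) < 1" using a(3) by simp
  qed
  from Suc.IH[OF this] Suc.prems(2) obtain u where u: "\<And>j l. j < m \<Longrightarrow> l < n \<Longrightarrow> nrm (u j l) \<le> 1"
    and du: "\<And>i j. i < m \<Longrightarrow> j < m \<Longrightarrow> dot n (\<lambda>l. v i $ l) (u j) = of_bool (i = j)"
    by (metis less_SucI)
  define V where "V i l = v i $ l" for i l
  have Vint: "nrm (V i l) \<le> 1" if "i \<le> m" "l < n" for i l using vi[of i l] that by (simp add: V_def)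
  have du': "dot n (V i) (u j) = of_bool (i = j)" if "i < m" "j < m" for i j
    using du[OF that] by (simp add: V_def[abs_def])
  define c where "c j = dot n (V m) (u j)" for j
  have c1: "nrm (c j) \<le> 1" if "j < m" for j unfolding c_def using that u Vint by (intro dot_integral) auto
  define v' where "v' l = V m l - (\<Sum>j<m. c j * V j l)" for l
  \<comment> \<open>Otherwise the combination \<open>v'\<close>, in which the last vector has
    coefficient 1, would be a dependence modulo p.\<close>
  have "\<exists>l<n. nrm (v' l) = 1"
  proof (rule ccontr)
    assume *: "\<not> (\<exists>l<n. nrm (v' l) = 1)"
    have lt: "nrm (v' l) < 1" if "l < n" for l
    proof -
      have "nrm (v' l) \<le> 1" unfolding v'_def using that c1 Vint by (intro nrm_diff_le nrm_sum_le nrm_mult_le_one) auto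
      then show ?thesis using * that by force
    qed
    let ?\<alpha> = "\<lambda>i. if i = m then 1 else - c i"
    have "(\<Sum>i<Suc m. ?\<alpha> i * v i $ l) = v' l" for l
      by (simp add: v'_def V_def sum_negf)
    moreover have "\<forall>i<Suc m. nrm (?\<alpha> i) \<le> 1" using c1 by (simp add: less_Suc_eq)
    ultimately have "\<forall>i<Suc m. nrm (?\<alpha> i) < 1"
      using Suc.prems(1)[unfolded indep_def, rule_format, of ?\<alpha>] lt by (simp only:) blast
    then show False by (auto dest: spec[of _ m])
  qed
  then obtain l0 where l0: "l0 < n" "nrm (v' l0) = 1" by blast
  then have nz: "v' l0 \<noteq> 0" by auto
  define w0 where "w0 l = (if l = l0 then inverse (v' l0) else 0)" for l
  have dw0: "dot n f w0 = f l0 * inverse (v' l0)" for f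
  proof -
    have "dot n f w0 = (\<Sum>l\<in>{l0}. f l * w0 l)"
      unfolding dot_def using l0 by (intro sum.mono_neutral_right) (auto simp: w0_def)
    then show ?thesis by (simp add: w0_def)
  qed
  have w0int: "nrm (w0 l) \<le> 1" for l using l0 by (simp add: w0_def nrm_inverse)
  \<comment> \<open>The scaled coordinate functional \<open>w0\<close> is corrected by the earlier
    dual vectors so that it vanishes on the earlier vectors; on the last one it then takes the value
    1.\<close>
  define w where "w l = w0 l - (\<Sum>j<m. dot n (V j) w0 * u j l)" for l
  have wint: "nrm (w l) \<le> 1" if "l < n" for l
    unfolding w_def using that u w0int Vint by (intro nrm_diff_le nrm_sum_le nrm_mult_le_one dot_integral) auto
  have dw: "dot n f w = dot n f w0 - (\<Sum>j<m. dot n (V j) w0 * dot n f (u j))" for f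
    unfolding w_def[abs_def] by (rule dot_lin_right)
  have dw1: "dot n (V i) w = 0" if "i < m" for i
  proof -
    have "(\<Sum>j<m. dot n (V j) w0 * dot n (V i) (u j)) = (\<Sum>j\<in>{i}. dot n (V j) w0 * dot n (V i) (u j))"
      using that du' by (intro sum.mono_neutral_right) auto
    then show ?thesis using dw[of "V i"] du'[OF that that] by simp
  qed
  have dw2: "dot n (V m) w = 1"
  proof -
    have "(\<Sum>j<m. dot n (V j) w0 * dot n (V m) (u j)) = (\<Sum>j<m. c j * V j l0) * inverse (v' l0)"
      by (simp add: dw0 c_def sum_distrib_right sum_distrib_left mult_ac)
    then have "dot n (V m) w = v' l0 * inverse (v' l0)"
      unfolding dw by (simp only: dw0 v'_def left_diff_distrib)
    then show ?thesis using nz by simp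
  qed
  \<comment> \<open>The earlier dual vectors must be made to vanish on the new vector. The
    correction is written as a one-term sum to match \<open>dot_lin_right\<close>.\<close>
  define u' where "u' j = (if j = m then w else (\<lambda>l. u j l - (\<Sum>i<Suc 0. c j * w l)))" for j
  have du'': "dot n f (\<lambda>l. u j l - (\<Sum>i<Suc 0. c j * w l)) = dot n f (u j) - c j * dot n f w" for f j
    using dot_lin_right[of n f "u j" "\<lambda>_. c j" "\<lambda>_. w" "Suc 0"] by simp
  show ?case
  proof (intro exI[of _ u'] conjI allI impI)
    fix j l assume "j < Suc m" "l < n"
    then show "nrm (u' j l) \<le> 1"
      using wint[of l] u[of j l] c1[of j] by (auto simp: u'_def less_Suc_eq intro!: nrm_diff_le nrm_mult_le_one)
  next
    fix i j assume ij: "i < Suc m" "j < Suc m"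
    have "dot n (V i) (u' j) = of_bool (i = j)"
    proof (cases "j = m")
      case True
      then show ?thesis using ij dw1[of i] dw2 by (auto simp: u'_def less_Suc_eq)
    next
      case False
      then have "dot n (V i) (u' j) = dot n (V i) (u j) - c j * dot n (V i) w"
        unfolding u'_def using du'' by simp
      then show ?thesis using ij False dw1[of i] dw2 du'[of i j] by (auto simp: less_Suc_eq c_def)
    qed
    then show "dot n (\<lambda>l. v i $ l) (u' j) = of_bool (i = j)" by (simp add: V_def[abs_def])
  qed
qed auto

lemma indep_surj:
  assumes "indep n m v" "\<And>i. i < m \<Longrightarrow> v i \<in> ivec n" "\<And>i. i < m \<Longrightarrow> nrm (t i) \<le> 1"
  shows "\<exists>u\<in>ivec n. \<forall>i<m. herm u (v i) = t i"
proof -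
  obtain U where U: "\<And>j l. j < m \<Longrightarrow> l < n \<Longrightarrow> nrm (U j l) \<le> 1"
    and dU: "\<And>i j. i < m \<Longrightarrow> j < m \<Longrightarrow> dot n (\<lambda>l. v i $ l) (U j) = of_bool (i = j)"
    using indep_dual[OF assms(1,2)] by blast
  \<comment> \<open>Conjugating here cancels the conjugation in the first argument of
    \<open>herm\<close>.\<close>
  define u where "u = vec n (\<lambda>l. \<tau> (\<Sum>j<m. t j * U j l))"
  show ?thesis
  proof (intro bexI[of _ u] allI impI)
    show "u \<in> ivec n"
      using U assms(3) by (auto simp: u_def ivec_def intro!: nrm_sum_le nrm_mult_le_one)
    fix i assume i: "i < m"
    have "herm u (v i) = (\<Sum>l<n. (\<Sum>j<m. t j * U j l) * v i $ l)"
      using ivec_carrier[OF assms(2)[OF i]] by (simp add: herm_def scalar_prod_def u_def lessThan_atLeast0)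
    also have "\<dots> = (\<Sum>j<m. \<Sum>l<n. t j * U j l * v i $ l)"
      unfolding sum_distrib_right by (rule sum.swap)
    also have "\<dots> = (\<Sum>j<m. t j * dot n (\<lambda>l. v i $ l) (U j))"
      by (simp add: dot_def sum_distrib_left mult_ac)
    also have "\<dots> = (\<Sum>j\<in>{i}. t j * dot n (\<lambda>l. v i $ l) (U j))"
      using i dU by (intro sum.mono_neutral_right) auto
    finally show "herm u (v i) = t i" using dU[OF i i] by simp
  qed
qed

lemma ivec_add: "u \<in> ivec n \<Longrightarrow> w \<in> ivec n \<Longrightarrow> u + w \<in> ivec n"
  by (auto simp: ivec_def intro!: nrm_add_le)

lemma close_vec_add_cancel:
  assumes "u \<in> ivec n" "u' \<in> ivec n" "w \<in> ivec n"
  shows "close_vec n c (u + w) (u' + w) \<longleftrightarrow> close_vec n c u u'"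
    "close_vec n c (w + u) (w + u') \<longleftrightarrow> close_vec n c u u'"
  using assms by (auto simp: close_vec_def ivec_def)

lemma equivp_close_fun: "equivp (close_fun I k)"
  using equivp_fun[OF equivp_cong_lv] .

text \<open>The products with an independent family can be prescribed arbitrarily, so translations
  permute the fibres and each system of values modulo p^k is taken equally often.\<close>

lemma indep_fibre_card:
  assumes v: "indep n m v" "\<And>i. i < m \<Longrightarrow> v i \<in> ivec n" and y: "\<And>i. i < m \<Longrightarrow> nrm (y i) \<le> 1"
  shows "card {u \<in> vec_reps n k. \<forall>i<m. cong_lv k (herm u (v i)) (y i)} * card (residue_reps k) ^ m = card (vec_reps n k)"
proof -
  let ?Y = "{a. \<forall>i\<in>{..<m}. a i \<in> {x. nrm x \<le> 1}}"
  let ?S = "Pi\<^sub>E {..<m} (\<lambda>_. residue_reps k)"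
  have S: "transversal ?Y (close_fun {..<m} k) ?S"
    by (rule transversal_PiE) (auto intro: transversal_residue_reps)
  have "card {t \<in> vec_reps n k. close_fun {..<m} k (\<lambda>i. herm t (v i)) y} * card ?S = card (vec_reps n k)"
  proof (rule transversal_fibres[OF equivp_close_vec transversal_vec_reps equivp_close_fun S])
    show "(\<lambda>i. herm x (v i)) \<in> ?Y" if "x \<in> ivec n" for x
      using that v(2) herm_integral by auto
    show "close_fun {..<m} k (\<lambda>i. herm x (v i)) (\<lambda>i. herm x' (v i))"
      if "x \<in> ivec n" "x' \<in> ivec n" "close_vec n (lv k) x x'" for x x'
      using that v(2) by (auto intro!: herm_close[where n = n] close_vec_refl)
    show "y \<in> ?Y" using y by auto
    fix y y' assume yy: "y \<in> ?Y" "y' \<in> ?Y"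
    have "\<exists>u\<in>ivec n. \<forall>i<m. herm u (v i) = y' i - y i"
      using v yy by (intro indep_surj nrm_diff_le) auto
    then obtain w where w: "w \<in> ivec n" "\<And>i. i < m \<Longrightarrow> herm w (v i) = y' i - y i" by blast
    show "\<exists>\<phi>. (\<forall>x\<in>ivec n. \<phi> x \<in> ivec n \<and>
          (close_fun {..<m} k (\<lambda>i. herm (\<phi> x) (v i)) y' \<longleftrightarrow> close_fun {..<m} k (\<lambda>i. herm x (v i)) y)) \<and>
        (\<forall>x\<in>ivec n. \<forall>x'\<in>ivec n. close_vec n (lv k) (\<phi> x) (\<phi> x') \<longrightarrow> close_vec n (lv k) x x')"
    proof (intro exI[of _ "\<lambda>x. x + w"] conjI ballI impI)
      fix x assume x: "x \<in> ivec n"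
      show "x + w \<in> ivec n" using x w by (intro ivec_add)
      have "herm (x + w) (v i) - y' i = herm x (v i) - y i" if "i < m" for i
        using herm_add_left[OF ivec_carrier[OF x] ivec_carrier[OF w(1)] ivec_carrier[OF v(2)[OF that]]] w(2)[OF that]
        by simp
      then show "close_fun {..<m} k (\<lambda>i. herm (x + w) (v i)) y' \<longleftrightarrow> close_fun {..<m} k (\<lambda>i. herm x (v i)) y"
        by simp
    qed (use w close_vec_add_cancel in blast)
  qed
  then show ?thesis by (simp add: card_PiE Ball_def)
qed

subsection \<open>Genericity of Krylov vectors\<close>


lemma pow_ivec: "M \<in> UU n \<Longrightarrow> v \<in> ivec n \<Longrightarrow> (M ^\<^sub>m i) *\<^sub>v v \<in> ivec n"
  by (intro mult_mat_ivec mat_over_pow unitary_groupD(1))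

lemma pow_Suc_mult_vec:
  assumes "M \<in> carrier_mat n n" "v \<in> carrier_vec n"
  shows "(M ^\<^sub>m Suc i) *\<^sub>v v = M *\<^sub>v ((M ^\<^sub>m i) *\<^sub>v v)" "(M ^\<^sub>m Suc i) *\<^sub>v v = (M ^\<^sub>m i) *\<^sub>v (M *\<^sub>v v)"
proof -
  have p: "M ^\<^sub>m i \<in> carrier_mat n n" using assms(1) by simp
  show "(M ^\<^sub>m Suc i) *\<^sub>v v = M *\<^sub>v ((M ^\<^sub>m i) *\<^sub>v v)"
    unfolding pow_mat_Suc2[OF assms(1)] by (rule assoc_mult_mat_vec[OF assms(1) p assms(2)])
  show "(M ^\<^sub>m Suc i) *\<^sub>v v = (M ^\<^sub>m i) *\<^sub>v (M *\<^sub>v v)"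
    using assoc_mult_mat_vec[OF p assms] by simp
qed

lemma unitary_cancel_vec:
  assumes "M \<in> UU n" "v \<in> carrier_vec n"
  shows "adj M *\<^sub>v (M *\<^sub>v v) = v" "M *\<^sub>v (adj M *\<^sub>v v) = v"
  using unitary_groupD[OF assms(1)] assoc_mult_mat_vec[OF adj_carrier[OF unitary_groupD(2)[OF assms(1)]] unitary_groupD(2)[OF assms(1)] assms(2)]
    assoc_mult_mat_vec[OF unitary_groupD(2)[OF assms(1)] adj_carrier[OF unitary_groupD(2)[OF assms(1)]] assms(2)]
    one_mult_mat_vec[OF assms(2)] by simp_all

lemma combination_mult_mat:
  assumes "A \<in> mat_over n RR" "\<And>i. i < m \<Longrightarrow> v i \<in> carrier_vec n" "\<forall>l<n. nrm (\<Sum>i<m. \<alpha> i * v i $ l) < 1" "r < n"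
  shows "nrm (\<Sum>i<m. \<alpha> i * (A *\<^sub>v v i) $ r) < 1"
proof -
  have "(\<Sum>i<m. \<alpha> i * (A *\<^sub>v v i) $ r) = (\<Sum>i<m. \<Sum>l<n. A $$ (r, l) * (\<alpha> i * v i $ l))"
  proof (rule sum.cong[OF refl])
    fix i assume "i \<in> {..<m}"
    then have "dim_vec (v i) = n" using assms(2) by auto
    then have "(A *\<^sub>v v i) $ r = (\<Sum>l<n. A $$ (r, l) * v i $ l)"
      using assms(4) carrier_matD[OF mat_over_carrier[OF assms(1)]] by (simp add: scalar_prod_def lessThan_atLeast0)
    then show "\<alpha> i * (A *\<^sub>v v i) $ r = (\<Sum>l<n. A $$ (r, l) * (\<alpha> i * v i $ l))"
      by (simp add: sum_distrib_left mult_ac)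
  qed
  also have "\<dots> = (\<Sum>l<n. A $$ (r, l) * (\<Sum>i<m. \<alpha> i * v i $ l))"
    unfolding sum_distrib_left by (rule sum.swap)
  also have "nrm \<dots> < 1"
  proof (rule nrm_sum_lt, rule nrm_mult_lt)
    fix l assume "l \<in> {..<n}"
    then show "nrm (A $$ (r, l)) \<le> 1" "nrm (\<Sum>i<m. \<alpha> i * v i $ l) < 1"
      using assms by (simp_all add: mat_over_RR)
  qed
  finally show ?thesis .
qed

lemma indep_mult_mat:
  assumes "A \<in> mat_over n RR" "\<And>i. i < m \<Longrightarrow> v i \<in> carrier_vec n" "indep n m (\<lambda>i. A *\<^sub>v v i)"
  shows "indep n m v"
  unfolding indep_def
proof (intro allI impI)
  fix \<alpha> i assume a: "\<forall>i<m. nrm (\<alpha> i) \<le> 1" "\<forall>l<n. nrm (\<Sum>i<m. \<alpha> i * v i $ l) < 1" "i < m"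
  have "\<forall>l<n. nrm (\<Sum>i<m. \<alpha> i * (A *\<^sub>v v i) $ l) < 1"
    using combination_mult_mat[OF assms(1,2) a(2)] by blast
  then show "nrm (\<alpha> i) < 1" using assms(3) a(1,3) unfolding indep_def by blast
qed

lemma indep_close:
  assumes c: "\<And>i. i < m \<Longrightarrow> close_vec n (lv 1) (v i) (v' i)" and i: "indep n m v"
  shows "indep n m v'"
  unfolding indep_def
proof (intro allI impI)
  fix \<alpha> i assume a: "\<forall>i<m. nrm (\<alpha> i) \<le> 1" "\<forall>l<n. nrm (\<Sum>i<m. \<alpha> i * v' i $ l) < 1" "i < m"
  have "nrm (\<Sum>i<m. \<alpha> i * v i $ l) < 1" if l: "l < n" for l
  proof -
    have "(\<Sum>i<m. \<alpha> i * v i $ l) = (\<Sum>i<m. \<alpha> i * v' i $ l) + (\<Sum>i<m. \<alpha> i * (v i $ l - v' i $ l))"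
      by (simp add: right_diff_distrib sum_subtractf)
    moreover have "nrm (\<Sum>i<m. \<alpha> i * (v i $ l - v' i $ l)) < 1"
    proof (rule nrm_sum_lt)
      fix i assume "i \<in> {..<m}"
      then have "nrm (v i $ l - v' i $ l) \<le> lv 1" "nrm (\<alpha> i) \<le> 1" using c[of i] l a(1) by (auto simp: close_vec_def)
      then show "nrm (\<alpha> i * (v i $ l - v' i $ l)) < 1" using lv_1 nrm_mult_lt by blast
    qed
    ultimately show ?thesis using a(2) l nrm_add_lt by simp
  qed
  then show "nrm (\<alpha> i) < 1" using i a(1,3) unfolding indep_def by blast
qed

lemma close_vec_sym: "close_vec n c u v \<Longrightarrow> close_vec n c v u"
  by (simp add: close_vec_def nrm_minus_commute)

lemma pow_close:
  assumes "M \<in> UU n" "N \<in> UU n" "v \<in> ivec n" "close_mat n c M N" "0 \<le> c"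
  shows "close_vec n c ((M ^\<^sub>m i) *\<^sub>v v) ((N ^\<^sub>m i) *\<^sub>v v)"
  using assms by (intro close_mult_mat_vec close_mat_pow mat_over_pow close_vec_refl unitary_groupD(1))

abbreviation krylov :: "nat \<Rightarrow> 'k vec \<Rightarrow> 'k mat \<Rightarrow> nat \<Rightarrow> bool" where
  "krylov n v M j \<equiv> indep n j (\<lambda>i. (M ^\<^sub>m i) *\<^sub>v v)"

lemma krylov_close:
  assumes "M \<in> UU n" "N \<in> UU n" "v \<in> ivec n" "close_mat n (lv 1) M N"
  shows "krylov n v M j \<longleftrightarrow> krylov n v N j"
  using indep_close[of j n "\<lambda>i. (M ^\<^sub>m i) *\<^sub>v v" "\<lambda>i. (N ^\<^sub>m i) *\<^sub>v v"]
    indep_close[of j n "\<lambda>i. (N ^\<^sub>m i) *\<^sub>v v" "\<lambda>i. (M ^\<^sub>m i) *\<^sub>v v"]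
    pow_close[OF assms lv_nonneg] close_vec_sym by blast

text \<open>Applying the inverse of M returns the unshifted family. The shifted vectors are the ones
  on which the reflection in h_u M acts.\<close>

lemma krylov_shift:
  assumes "M \<in> UU n" "v \<in> ivec n" "krylov n v M j"
  shows "indep n j (\<lambda>i. (M ^\<^sub>m Suc i) *\<^sub>v v)"
proof (rule indep_mult_mat[OF adj_mat_over[OF unitary_groupD(1)[OF assms(1)]]])
  show "(M ^\<^sub>m Suc i) *\<^sub>v v \<in> carrier_vec n" for i using pow_ivec[OF assms(1,2)] by (rule ivec_carrier)
  have "adj M *\<^sub>v ((M ^\<^sub>m Suc i) *\<^sub>v v) = (M ^\<^sub>m i) *\<^sub>v v" for i
    unfolding pow_Suc_mult_vec(1)[OF unitary_groupD(2)[OF assms(1)] ivec_carrier[OF assms(2)]]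
    by (rule unitary_cancel_vec[OF assms(1) ivec_carrier[OF pow_ivec[OF assms(1,2)]]])
  then show "indep n j (\<lambda>i. adj M *\<^sub>v ((M ^\<^sub>m Suc i) *\<^sub>v v))" using assms(3) by simp
qed

text \<open>In a dependence the last coefficient is a unit, since otherwise dropping it leaves a
  dependence of the independent part. After dividing by it, the coefficients are rounded to
  representatives, so that only finitely many choices remain to be counted.\<close>

lemma first_dependence:
  assumes v: "\<And>i. i \<le> j \<Longrightarrow> v i \<in> ivec n" and ind: "indep n j v" and dep: "\<not> indep n (Suc j) v"
  shows "\<exists>\<beta>\<in>Pi\<^sub>E {..<j} (\<lambda>_. residue_reps 1). \<forall>l<n. nrm (v j $ l - (\<Sum>i<j. \<beta> i * v i $ l)) < 1"
proof -
  obtain \<alpha> i0 where a: "\<forall>i<Suc j. nrm (\<alpha> i) \<le> 1" "\<forall>l<n. nrm (\<Sum>i<Suc j. \<alpha> i * v i $ l) < 1"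
    and i0: "i0 < Suc j" "\<not> nrm (\<alpha> i0) < 1"
    using dep unfolding indep_def by blast
  have vi: "nrm (v i $ l) \<le> 1" if "i \<le> j" "l < n" for i l using v[OF that(1)] that(2) by (simp add: ivec_def)
  have aj: "nrm (\<alpha> j) = 1"
  proof (rule ccontr)
    assume "nrm (\<alpha> j) \<noteq> 1"
    then have lt: "nrm (\<alpha> j) < 1" using a(1) by (simp add: order_less_le)
    have "nrm (\<Sum>i<j. \<alpha> i * v i $ l) < 1" if "l < n" for l
    proof -
      have e: "(\<Sum>i<j. \<alpha> i * v i $ l) = (\<Sum>i<Suc j. \<alpha> i * v i $ l) - v j $ l * \<alpha> j" by simp
      show ?thesis
        unfolding e by (rule nrm_diff_lt[OF a(2)[rule_format, OF that] nrm_mult_lt[OF vi[OF order_refl that] lt]])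
    qed
    then have "\<forall>i<j. nrm (\<alpha> i) < 1" using ind a(1) unfolding indep_def by (meson less_SucI)
    then show False using i0 lt by (auto simp: less_Suc_eq)
  qed
  then have nz: "\<alpha> j \<noteq> 0" by auto
  define \<gamma> where "\<gamma> i = - \<alpha> i / \<alpha> j" for i
  have g1: "nrm (\<gamma> i) \<le> 1" if "i < j" for i using a(1) that aj by (simp add: \<gamma>_def nrm_divide)
  have g2: "nrm (v j $ l - (\<Sum>i<j. \<gamma> i * v i $ l)) < 1" if "l < n" for l
  proof -
    have "v j $ l - (\<Sum>i<j. \<gamma> i * v i $ l) = inverse (\<alpha> j) * (\<Sum>i<Suc j. \<alpha> i * v i $ l)"
      using nz by (simp add: \<gamma>_def distrib_left sum_distrib_left sum_negf divide_inverse mult_ac)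
    then show ?thesis using a(2) that aj by (simp add: nrm_mult nrm_inverse)
  qed
  define \<rho> where "\<rho> x = (SOME t. t \<in> residue_reps 1 \<and> cong_lv 1 x t)" for x
  have \<rho>: "\<rho> x \<in> residue_reps 1 \<and> nrm (x - \<rho> x) < 1" if "nrm x \<le> 1" for x
  proof -
    have "\<exists>t. t \<in> residue_reps 1 \<and> cong_lv 1 x t" using residue_reps_ex[OF that, of 1] by blast
    from someI_ex[OF this] show ?thesis using lv_1[of "x - \<rho> x"] by (simp only: \<rho>_def)
  qed
  show ?thesis
  proof (intro bexI[of _ "restrict (\<lambda>i. \<rho> (\<gamma> i)) {..<j}"] allI impI)
    show "restrict (\<lambda>i. \<rho> (\<gamma> i)) {..<j} \<in> Pi\<^sub>E {..<j} (\<lambda>_. residue_reps 1)"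
      using \<rho> g1 by (intro restrict_PiE_iff[THEN iffD2]) simp
    fix l assume l: "l < n"
    have e: "v j $ l - (\<Sum>i<j. restrict (\<lambda>i. \<rho> (\<gamma> i)) {..<j} i * v i $ l) =
        (v j $ l - (\<Sum>i<j. \<gamma> i * v i $ l)) + (\<Sum>i<j. v i $ l * (\<gamma> i - \<rho> (\<gamma> i)))"
      by (simp add: right_diff_distrib sum_subtractf mult.commute)
    have "nrm (\<Sum>i<j. v i $ l * (\<gamma> i - \<rho> (\<gamma> i))) < 1"
      using \<rho> g1 vi l by (intro nrm_sum_lt nrm_mult_lt) auto
    then show "nrm (v j $ l - (\<Sum>i<j. restrict (\<lambda>i. \<rho> (\<gamma> i)) {..<j} i * v i $ l)) < 1"
      unfolding e by (rule nrm_add_lt[OF g2[OF l]])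
  qed
qed

text \<open>M has its first dependence at index j, and u satisfies j conditions modulo p: h_u fixes
  M v, ..., M^(j-1) v and moves M^j v by a u. The conditions can be prescribed because the shifted
  Krylov vectors are independent.\<close>

definition escape :: "nat \<Rightarrow> 'k vec \<Rightarrow> nat \<Rightarrow> 'k mat \<Rightarrow> 'k vec \<Rightarrow> bool" where
  "escape n v j M u \<longleftrightarrow> krylov n v M j \<and> \<not> krylov n v M (Suc j) \<and>
     (\<forall>i<j. cong_lv 1 (herm u ((M ^\<^sub>m Suc i) *\<^sub>v v)) (of_bool (Suc i = j)))"

text \<open>A reflection \<open>u\<close> fixing the first Krylov vectors and moving the \<open>j\<close>-th one out of their span
  is, up to the scalar, the difference of the new \<open>j\<close>-th vector and an element of that span.\<close>

lemma escape_determines: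
  assumes u: "u \<in> ivec n" and M: "M \<in> UU n" and v: "v \<in> ivec n" and j: "j > 0"
    and esc: "escape n v j M u"
  defines "N \<equiv> refl_mat n u * M"
  shows "\<exists>b\<in>residue_reps 1. \<exists>\<beta>\<in>Pi\<^sub>E {..<j} (\<lambda>_. residue_reps 1). \<forall>l<n.
    nrm (u $ l - b * (((N ^\<^sub>m j) *\<^sub>v v) $ l - (\<Sum>i<j. \<beta> i * ((N ^\<^sub>m i) *\<^sub>v v) $ l))) < 1"
proof -
  define a where "a = refl_coeff (herm u u)"
  have a1: "nrm a = 1" unfolding a_def using herm_self[OF u] by (rule refl_coeff_unit)
  then have anz: "a \<noteq> 0" by auto
  have N: "N \<in> UU n" unfolding N_def using refl_mat_unitary[OF u] M by (rule unitary_group_mult)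
  note Mc = unitary_groupD(2)[OF M] and Nc = unitary_groupD(2)[OF N] and vc = ivec_carrier[OF v]
  have uc: "u \<in> carrier_vec n" using u by (rule ivec_carrier)
  have ul: "nrm (u $ l) \<le> 1" if "l < n" for l using u that by (simp add: ivec_def)
  have step: "(N *\<^sub>v ((M ^\<^sub>m i) *\<^sub>v v)) $ l = ((M ^\<^sub>m Suc i) *\<^sub>v v) $ l + a * herm u ((M ^\<^sub>m Suc i) *\<^sub>v v) * u $ l"
    if "l < n" for i l
  proof -
    have c: "(M ^\<^sub>m i) *\<^sub>v v \<in> carrier_vec n" "(M ^\<^sub>m Suc i) *\<^sub>v v \<in> carrier_vec n"
      using ivec_carrier[OF pow_ivec[OF M v]] by blast+
    have "N *\<^sub>v ((M ^\<^sub>m i) *\<^sub>v v) = refl_mat n u *\<^sub>v (M *\<^sub>v ((M ^\<^sub>m i) *\<^sub>v v))"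
      unfolding N_def by (rule assoc_mult_mat_vec[OF unitary_groupD(2)[OF refl_mat_unitary[OF u]] Mc c(1)])
    also have "M *\<^sub>v ((M ^\<^sub>m i) *\<^sub>v v) = (M ^\<^sub>m Suc i) *\<^sub>v v" by (rule pow_Suc_mult_vec(1)[OF Mc vc, symmetric])
    also have "refl_mat n u *\<^sub>v ((M ^\<^sub>m Suc i) *\<^sub>v v) =
        (M ^\<^sub>m Suc i) *\<^sub>v v + (a * herm u ((M ^\<^sub>m Suc i) *\<^sub>v v)) \<cdot>\<^sub>v u"
      unfolding a_def by (rule refl_mat_mult_vec[OF uc c(2)])
    finally show ?thesis using that uc by simp
  qed
  have hm: "nrm (herm u ((M ^\<^sub>m Suc i) *\<^sub>v v) - of_bool (Suc i = j)) < 1" if "i < j" for i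
    using esc that lv_1 unfolding escape_def by blast
  have push: "nrm (((N ^\<^sub>m Suc i) *\<^sub>v v) $ l - (((M ^\<^sub>m Suc i) *\<^sub>v v) $ l + of_bool (Suc i = j) * a * u $ l)) < 1"
    if "close_vec n (lv 1) ((N ^\<^sub>m i) *\<^sub>v v) ((M ^\<^sub>m i) *\<^sub>v v)" "i < j" "l < n" for i l
  proof -
    have "close_vec n (lv 1) (N *\<^sub>v ((N ^\<^sub>m i) *\<^sub>v v)) (N *\<^sub>v ((M ^\<^sub>m i) *\<^sub>v v))"
      by (rule close_mult_mat_vec[OF unitary_groupD(1)[OF N] pow_ivec[OF N v] unitary_groupD(1)[OF N] pow_ivec[OF M v]
            close_mat_refl[OF lv_nonneg] that(1) lv_nonneg])
    then have "nrm ((N *\<^sub>v ((N ^\<^sub>m i) *\<^sub>v v)) $ l - (N *\<^sub>v ((M ^\<^sub>m i) *\<^sub>v v)) $ l) < 1"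
      using that(3) lv_1 unfolding close_vec_def by blast
    then have 1: "nrm (((N ^\<^sub>m Suc i) *\<^sub>v v) $ l - (((M ^\<^sub>m Suc i) *\<^sub>v v) $ l + a * herm u ((M ^\<^sub>m Suc i) *\<^sub>v v) * u $ l)) < 1"
      unfolding step[OF that(3)] pow_Suc_mult_vec(1)[OF Nc vc] .
    have 2: "nrm ((a * u $ l) * (herm u ((M ^\<^sub>m Suc i) *\<^sub>v v) - of_bool (Suc i = j))) < 1"
      using hm[OF that(2)] a1 ul[OF that(3)] by (intro nrm_mult_lt nrm_mult_le_one) auto
    have "((N ^\<^sub>m Suc i) *\<^sub>v v) $ l - (((M ^\<^sub>m Suc i) *\<^sub>v v) $ l + of_bool (Suc i = j) * a * u $ l) =
      (((N ^\<^sub>m Suc i) *\<^sub>v v) $ l - (((M ^\<^sub>m Suc i) *\<^sub>v v) $ l + a * herm u ((M ^\<^sub>m Suc i) *\<^sub>v v) * u $ l)) +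
      ((a * u $ l) * (herm u ((M ^\<^sub>m Suc i) *\<^sub>v v) - of_bool (Suc i = j)))"
      by (simp only: algebra_simps)
    then show ?thesis using nrm_add_lt[OF 1 2] by (simp only:)
  qed
  \<comment> \<open>Below j the reflection fixes every vector it meets modulo p, so N and M have the
    same Krylov vectors there.\<close>
  have cl: "close_vec n (lv 1) ((N ^\<^sub>m i) *\<^sub>v v) ((M ^\<^sub>m i) *\<^sub>v v)" if "i < j" for i
    using that
  proof (induction i)
    case 0
    have "(N ^\<^sub>m 0) *\<^sub>v v = (M ^\<^sub>m 0) *\<^sub>v v" using carrier_matD[OF Nc] carrier_matD[OF Mc] by simp
    then show ?case using close_vec_refl[OF lv_nonneg] by (simp only:)
  next
    case (Suc i)
    have "nrm (((N ^\<^sub>m Suc i) *\<^sub>v v) $ l - ((M ^\<^sub>m Suc i) *\<^sub>v v) $ l) < 1" if "l < n" for l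
      using push[of i l] Suc that by simp
    then show ?case unfolding close_vec_def using lv_1 by blast
  qed
  obtain j' where j': "j = Suc j'" using j by (cases j) auto
  have top: "nrm (((N ^\<^sub>m j) *\<^sub>v v) $ l - (((M ^\<^sub>m j) *\<^sub>v v) $ l + a * u $ l)) < 1" if "l < n" for l
    using push[of j' l] cl[of j'] that by (simp add: j')
  obtain \<beta> where \<beta>: "\<beta> \<in> Pi\<^sub>E {..<j} (\<lambda>_. residue_reps 1)"
    and dep: "\<And>l. l < n \<Longrightarrow> nrm (((M ^\<^sub>m j) *\<^sub>v v) $ l - (\<Sum>i<j. \<beta> i * ((M ^\<^sub>m i) *\<^sub>v v) $ l)) < 1"
    using first_dependence[of j "\<lambda>i. (M ^\<^sub>m i) *\<^sub>v v" n] pow_ivec[OF M v] esc unfolding escape_def by blast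
  have \<beta>1: "nrm (\<beta> i) \<le> 1" if "i < j" for i using PiE_mem[OF \<beta>, of i] that residue_reps_integral by simp
  \<comment> \<open>The coefficients \<beta> come from the dependence for M but are applied to the
    vectors of N; these agree modulo p below j, so only a u remains.\<close>
  define w where "w l = ((N ^\<^sub>m j) *\<^sub>v v) $ l - (\<Sum>i<j. \<beta> i * ((N ^\<^sub>m i) *\<^sub>v v) $ l)" for l
  have w1: "nrm (w l) \<le> 1" if "l < n" for l
    unfolding w_def using pow_ivec[OF N v] that \<beta>1
    by (intro nrm_diff_le nrm_sum_le nrm_mult_le_one) (simp_all add: ivec_def)
  have wa: "nrm (w l - a * u $ l) < 1" if "l < n" for l
  proof -
    have "nrm (\<Sum>i<j. \<beta> i * (((N ^\<^sub>m i) *\<^sub>v v) $ l - ((M ^\<^sub>m i) *\<^sub>v v) $ l)) < 1"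
    proof (intro nrm_sum_lt nrm_mult_lt)
      fix i assume i: "i \<in> {..<j}"
      show "nrm (\<beta> i) \<le> 1" using \<beta>1 i by simp
      show "nrm (((N ^\<^sub>m i) *\<^sub>v v) $ l - ((M ^\<^sub>m i) *\<^sub>v v) $ l) < 1"
        using cl[of i] i that lv_1 unfolding close_vec_def by blast
    qed
    from nrm_diff_lt[OF nrm_add_lt[OF top[OF that] dep[OF that]] this]
    show ?thesis by (simp add: w_def right_diff_distrib sum_subtractf algebra_simps)
  qed
  \<comment> \<open>The inverse of a depends on u; replacing it by a representative leaves a number
    of candidates that can be counted.\<close>
  obtain b where b: "b \<in> residue_reps 1" "nrm (inverse a - b) < 1"
    using residue_reps_ex[of "inverse a" 1] a1 lv_1 by (auto simp: nrm_inverse)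
  have "nrm (u $ l - b * w l) < 1" if "l < n" for l
  proof -
    have e: "u $ l - b * w l = w l * (inverse a - b) - inverse a * (w l - a * u $ l)"
      using anz by (simp add: algebra_simps)
    have "nrm (w l * (inverse a - b)) < 1" using w1[OF that] b(2) by (rule nrm_mult_lt)
    moreover have "nrm (inverse a * (w l - a * u $ l)) < 1"
      using wa[OF that] a1 by (intro nrm_mult_lt) (auto simp: nrm_inverse)
    ultimately show ?thesis unfolding e by (rule nrm_diff_lt)
  qed
  then show ?thesis using b(1) \<beta> unfolding w_def by blast
qed


lemma escape_close:
  assumes "M \<in> UU n" "N \<in> UU n" "v \<in> ivec n" "u \<in> ivec n" "close_mat n (lv 1) M N" "escape n v j M u"
  shows "escape n v j N u"
  unfolding escape_def
proof (intro conjI allI impI)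
  show "krylov n v N j" "\<not> krylov n v N (Suc j)"
    using assms(6) krylov_close[OF assms(1,2,3,5)] by (auto simp: escape_def)
  fix i assume i: "i < j"
  have "nrm (herm u ((N ^\<^sub>m Suc i) *\<^sub>v v) - herm u ((M ^\<^sub>m Suc i) *\<^sub>v v)) \<le> lv 1"
    by (rule herm_close[OF assms(4) pow_ivec[OF assms(2,3)] assms(4) pow_ivec[OF assms(1,3)] close_vec_refl[OF lv_nonneg]
        close_vec_sym[OF pow_close[OF assms(1,2,3,5) lv_nonneg]] lv_nonneg])
  moreover have "cong_lv 1 (herm u ((M ^\<^sub>m Suc i) *\<^sub>v v)) (of_bool (Suc i = j))"
    using assms(6) i by (simp add: escape_def)
  ultimately show "cong_lv 1 (herm u ((N ^\<^sub>m Suc i) *\<^sub>v v)) (of_bool (Suc i = j))" by (rule nrm_diff_trans)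
qed

text \<open>With N = h_u M held fixed, u is determined modulo p by one residue b and the j residues
  \<beta>.\<close>

lemma escape_card_le:
  assumes N: "N \<in> UU n" and v: "v \<in> ivec n" and j: "j > 0"
  shows "card {u \<in> vec_reps n 1. escape n v j (adj (refl_mat n u) * N) u} \<le> card (residue_reps 1) ^ Suc j"
proof -
  let ?S = "{u \<in> vec_reps n 1. escape n v j (adj (refl_mat n u) * N) u}"
  let ?W = "residue_reps 1 \<times> Pi\<^sub>E {..<j} (\<lambda>_. residue_reps 1)"
  let ?R = "\<lambda>u x. \<forall>l<n. nrm (u $ l - fst x * (((N ^\<^sub>m j) *\<^sub>v v) $ l - (\<Sum>i<j. snd x i * ((N ^\<^sub>m i) *\<^sub>v v) $ l))) < 1"
  have ex: "\<exists>x. x \<in> ?W \<and> ?R u x" if u: "u \<in> ?S" for u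
  proof -
    let ?M = "adj (refl_mat n u) * N"
    have uV: "u \<in> ivec n" using u vec_reps_ivec by blast
    note h = refl_mat_unitary[OF uV]
    have M: "?M \<in> UU n" by (rule unitary_group_mult[OF unitary_group_adj[OF h] N])
    have NM: "refl_mat n u * ?M = N"
      using assoc_mult_mat[OF unitary_groupD(2)[OF h] adj_carrier[OF unitary_groupD(2)[OF h]] unitary_groupD(2)[OF N]]
        left_mult_one_mat[OF unitary_groupD(2)[OF N]] unitary_groupD(3)[OF h] by simp
    have "escape n v j ?M u" using u by blast
    from escape_determines[OF uV M v j this, unfolded NM]
    obtain b \<beta> where "b \<in> residue_reps 1" "\<beta> \<in> Pi\<^sub>E {..<j} (\<lambda>_. residue_reps 1)" "?R u (b, \<beta>)" by auto
    then show ?thesis by (intro exI[of _ "(b, \<beta>)"]) simp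
  qed
  define g where "g u = (SOME x. x \<in> ?W \<and> ?R u x)" for u
  have g: "g u \<in> ?W" "?R u (g u)" if "u \<in> ?S" for u
    using someI_ex[OF ex[OF that]] unfolding g_def by blast+
  have inj: "inj_on g ?S"
  proof (rule inj_onI)
    fix u u' assume u: "u \<in> ?S" "u' \<in> ?S" "g u = g u'"
    have "cong_lv 1 (u $ l) (u' $ l)" if "l < n" for l
    proof -
      have 1: "nrm (u $ l - fst (g u) * (((N ^\<^sub>m j) *\<^sub>v v) $ l - (\<Sum>i<j. snd (g u) i * ((N ^\<^sub>m i) *\<^sub>v v) $ l))) < 1"
        using g(2)[OF u(1)] that by blast
      have 2: "nrm (u' $ l - fst (g u) * (((N ^\<^sub>m j) *\<^sub>v v) $ l - (\<Sum>i<j. snd (g u) i * ((N ^\<^sub>m i) *\<^sub>v v) $ l))) < 1"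
        using g(2)[OF u(2)] that unfolding u(3) by blast
      from nrm_diff_lt[OF 1 2] have "nrm (u $ l - u' $ l) < 1" by simp
      then show ?thesis using lv_1 by blast
    qed
    then have "close_vec n (lv 1) u u'" unfolding close_vec_def by blast
    then show "u = u'" using u by (intro vec_reps_unique[of _ n 1]) blast+
  qed
  have "finite ?W" using finite_residue_reps by (intro finite_cartesian_product finite_PiE) auto
  then have "card ?S \<le> card ?W" using inj g(1) by (intro card_inj_on_le[of g]) blast+
  also have "card ?W = card (residue_reps 1) ^ Suc j" by (simp add: card_cartesian_product card_PiE)
  finally show ?thesis .
qed

text \<open>Escaping pairs (M, u) are counted in two ways. With q the number of residues modulo p,
  each M with first dependence at j has q^(n-j) escaping vectors u modulo p, whereas each product
  h_u M arises from at most q^(j+1) of them.\<close>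

lemma card_first_dependence:
  assumes v: "v \<in> ivec n" and j: "j > 0" and k: "k \<ge> 1"
  shows "real (card {M \<in> unitary_reps n k. krylov n v M j \<and> \<not> krylov n v M (Suc j)}) * real (card (residue_reps 1)) ^ n
    \<le> real (card (unitary_reps n k)) * real (card (residue_reps 1)) ^ (2 * j + 1)"
proof -
  let ?G = "unitary_reps n k" and ?V = "vec_reps n 1" and ?Q = "real (card (residue_reps 1))"
  let ?E = "\<lambda>M. krylov n v M j \<and> \<not> krylov n v M (Suc j)"
  have close1: "close_mat n (lv 1) M N" if "close_mat n (lv k) M N" for M N
    using that lv_le_lv1[OF k] unfolding close_mat_def by (meson order_trans)
  have fin: "finite ?G" "finite ?V" by (rule finite_unitary_reps, rule finite_vec_reps)
  have cnt: "(\<Sum>u\<in>?V. of_bool (escape n v j M u)) * ?Q ^ j = of_bool (?E M) * ?Q ^ n" if M: "M \<in> ?G" for M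
  proof (cases "?E M")
    case True
    have MU: "M \<in> UU n" using M by (rule unitary_reps_UU)
    have "card {u \<in> ?V. \<forall>i<j. cong_lv 1 (herm u ((M ^\<^sub>m Suc i) *\<^sub>v v)) (of_bool (Suc i = j))} * card (residue_reps 1) ^ j = card ?V"
      using True by (intro indep_fibre_card krylov_shift MU v pow_ivec) auto
    moreover have "{u \<in> ?V. \<forall>i<j. cong_lv 1 (herm u ((M ^\<^sub>m Suc i) *\<^sub>v v)) (of_bool (Suc i = j))} = ?V \<inter> {u. escape n v j M u}"
      using True by (auto simp: escape_def)
    ultimately have "real (card (?V \<inter> {u. escape n v j M u}) * card (residue_reps 1) ^ j) = real (card (residue_reps 1) ^ n)"
      using card_vec_reps by (simp only:)
    then show ?thesis using True fin by simp
  next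
    case False
    then have "\<not> escape n v j M u" for u by (simp add: escape_def)
    then show ?thesis using False by simp
  qed
  have "real (card {M \<in> ?G. ?E M}) * ?Q ^ n = (\<Sum>M\<in>?G. of_bool (?E M) * ?Q ^ n)"
    using fin by (simp add: sum_distrib_right[symmetric] Int_def)
  also have "\<dots> = (\<Sum>M\<in>?G. (\<Sum>u\<in>?V. of_bool (escape n v j M u)) * ?Q ^ j)"
    using cnt by (intro sum.cong) simp_all
  also have "\<dots> = (\<Sum>u\<in>?V. \<Sum>M\<in>?G. of_bool (escape n v j M u)) * ?Q ^ j"
    unfolding sum_distrib_right[symmetric] by (subst sum.swap) simp
  \<comment> \<open>For each u, translation invariance changes the summation variable from M to h_u
    M, so that the inner sum over u can be taken with the product fixed.\<close>
  also have "(\<Sum>u\<in>?V. \<Sum>M\<in>?G. of_bool (escape n v j M u)) =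
      (\<Sum>u\<in>?V. \<Sum>M\<in>?G. of_bool (escape n v j (adj (refl_mat n u) * M) u) :: real)"
  proof (rule sum.cong[OF refl])
    fix u assume u: "u \<in> ?V"
    have uV: "u \<in> ivec n" using u by (rule vec_reps_ivec)
    show "(\<Sum>M\<in>?G. of_bool (escape n v j M u)) = (\<Sum>M\<in>?G. of_bool (escape n v j (adj (refl_mat n u) * M) u) :: real)"
    proof (rule sum_unitary_reps_translate[symmetric])
      show "adj (refl_mat n u) \<in> UU n" using uV by (intro unitary_group_adj refl_mat_unitary)
      fix M N assume MN: "M \<in> UU n" "N \<in> UU n" "close_mat n (lv k) M N"
      have c: "close_mat n (lv 1) M N" using MN(3) by (rule close1)
      have c': "close_mat n (lv 1) N M" using c equivp_symp[OF equivp_close_mat] by blast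
      show "of_bool (escape n v j M u) = (of_bool (escape n v j N u) :: real)"
        using escape_close[OF MN(1,2) v uV c] escape_close[OF MN(2,1) v uV c'] by auto
    qed
  qed
  also have "\<dots> = (\<Sum>M\<in>?G. \<Sum>u\<in>?V. of_bool (escape n v j (adj (refl_mat n u) * M) u))"
    by (rule sum.swap)
  also have "\<dots> \<le> (\<Sum>M\<in>?G. ?Q ^ Suc j)"
  proof (rule sum_mono)
    fix M assume "M \<in> ?G"
    then have "card {u \<in> ?V. escape n v j (adj (refl_mat n u) * M) u} \<le> card (residue_reps 1) ^ Suc j"
      by (intro escape_card_le unitary_reps_UU v j)
    then have "real (card (?V \<inter> {u. escape n v j (adj (refl_mat n u) * M) u})) \<le> real (card (residue_reps 1) ^ Suc j)"
      by (simp only: Int_def mem_Collect_eq of_nat_le_iff)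
    then show "(\<Sum>u\<in>?V. of_bool (escape n v j (adj (refl_mat n u) * M) u)) \<le> ?Q ^ Suc j"
      using fin by simp
  qed
  finally have "real (card {M \<in> ?G. ?E M}) * ?Q ^ n \<le> real (card ?G) * ?Q ^ Suc j * ?Q ^ j"
    by (simp add: mult_right_mono)
  also have "\<dots> = real (card ?G) * ?Q ^ (2 * j + 1)" by (simp add: power_add[symmetric] mult.assoc mult_2)
  finally show ?thesis .
qed

lemma krylov_1:
  assumes "v \<in> ivec n" "M \<in> UU n" "l < n" "nrm (v $ l) = 1"
  shows "krylov n v M 1"
  unfolding indep_def
proof (intro allI impI)
  fix \<alpha> i assume a: "\<forall>l<n. nrm (\<Sum>i<1. \<alpha> i * ((M ^\<^sub>m i) *\<^sub>v v) $ l) < 1" "i < (1::nat)"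
  have "(M ^\<^sub>m 0) *\<^sub>v v = v" using carrier_matD[OF unitary_groupD(2)[OF assms(2)]] ivec_carrier[OF assms(1)] by simp
  then have "nrm (\<alpha> 0 * v $ l) < 1" using a(1)[rule_format, OF assms(3)] by simp
  then show "nrm (\<alpha> i) < 1" using a(2) assms(4) by (simp add: nrm_mult)
qed

text \<open>A vector with a unit coordinate is independent by itself, so a first dependence occurs
  at some index from 1 to D; the largest index dominates all the bounds.\<close>

lemma card_dependent_le:
  assumes v: "v \<in> ivec n" "l < n" "nrm (v $ l) = 1" and k: "k \<ge> 1"
  shows "real (card {M \<in> unitary_reps n k. \<not> krylov n v M (Suc D)}) * real (card (residue_reps 1)) ^ n
    \<le> real D * (real (card (unitary_reps n k)) * real (card (residue_reps 1)) ^ (2 * D + 1))"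
proof -
  let ?Q = "real (card (residue_reps 1))"
  let ?B = "\<lambda>j. {M \<in> unitary_reps n k. krylov n v M j \<and> \<not> krylov n v M (Suc j)}"
  have Q1: "1 \<le> ?Q" using card_residue_reps_ge[of 1] by simp
  have sub: "{M \<in> unitary_reps n k. \<not> krylov n v M (Suc D)} \<subseteq> (\<Union>j\<in>{1..D}. ?B j)"
  proof (induction D)
    case 0
    then show ?case using krylov_1[OF v(1) unitary_reps_UU v(2,3)] by auto
  next
    case (Suc D)
    show ?case
    proof
      fix M assume M: "M \<in> {M \<in> unitary_reps n k. \<not> krylov n v M (Suc (Suc D))}"
      show "M \<in> (\<Union>j\<in>{1..Suc D}. ?B j)"
      proof (cases "krylov n v M (Suc D)")
        case True
        then have "M \<in> ?B (Suc D)" using M by blast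
        then show ?thesis by (intro UN_I[of "Suc D"]) auto
      next
        case False
        then have "M \<in> (\<Union>j\<in>{1..D}. ?B j)" using Suc M by blast
        then show ?thesis by (rule rev_subsetD) (intro UN_mono, auto)
      qed
    qed
  qed
  have "card {M \<in> unitary_reps n k. \<not> krylov n v M (Suc D)} \<le> card (\<Union>j\<in>{1..D}. ?B j)"
    using finite_unitary_reps by (intro card_mono sub finite_UN_I) auto
  also have "\<dots> \<le> (\<Sum>j\<in>{1..D}. card (?B j))" by (rule card_UN_le) simp
  finally have "real (card {M \<in> unitary_reps n k. \<not> krylov n v M (Suc D)}) \<le> real (\<Sum>j\<in>{1..D}. card (?B j))"
    by (simp only: of_nat_le_iff)
  then have "real (card {M \<in> unitary_reps n k. \<not> krylov n v M (Suc D)}) * ?Q ^ n \<le> (\<Sum>j\<in>{1..D}. real (card (?B j)) * ?Q ^ n)"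
    by (simp add: sum_distrib_right[symmetric] mult_right_mono)
  also have "\<dots> \<le> (\<Sum>j\<in>{1..D}. real (card (unitary_reps n k)) * ?Q ^ (2 * D + 1))"
  proof (rule sum_mono)
    fix j assume j: "j \<in> {1..D}"
    have "real (card (?B j)) * ?Q ^ n \<le> real (card (unitary_reps n k)) * ?Q ^ (2 * j + 1)"
      using v(1) j k by (intro card_first_dependence) auto
    also have "\<dots> \<le> real (card (unitary_reps n k)) * ?Q ^ (2 * D + 1)"
      using j Q1 by (intro mult_left_mono power_increasing) auto
    finally show "real (card (?B j)) * ?Q ^ n \<le> real (card (unitary_reps n k)) * ?Q ^ (2 * D + 1)" .
  qed
  finally show ?thesis by simp
qed

end

subsection \<open>Quadratic forms of a unitary matrix\<close>

lemma equivp_cong: "equivp E \<Longrightarrow> E x y \<Longrightarrow> E x z \<longleftrightarrow> E y z"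
  by (simp add: equivp_def)

context unramified_quadratic
begin

lemma form_space_iff: "a \<in> form_space d \<longleftrightarrow> \<tau> (a 0) = a 0 \<and> (\<forall>j\<le>d. nrm (a j) \<le> 1)"
proof
  assume "a \<in> form_space d"
  then have a: "\<And>j. j \<in> {0..d} \<Longrightarrow> a j \<in> (if j = 0 then {x. nrm x \<le> 1 \<and> \<tau> x = x} else {x. nrm x \<le> 1})"
    unfolding form_space_def by blast
  show "\<tau> (a 0) = a 0 \<and> (\<forall>j\<le>d. nrm (a j) \<le> 1)"
  proof (intro conjI allI impI)
    show "\<tau> (a 0) = a 0" using a[of 0] by simp
    show "nrm (a j) \<le> 1" if "j \<le> d" for j using a[of j] that by (cases "j = 0") auto
  qed
qed (auto simp: form_space_def)

lemma adj_pow: "M \<in> carrier_mat n n \<Longrightarrow> adj (M ^\<^sub>m k) = adj M ^\<^sub>m k"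
proof (induction k)
  case 0
  then show ?case by (intro eq_matI) (auto simp: adj_def tau_hom)
next
  case (Suc k)
  have "adj (M ^\<^sub>m Suc k) = adj M * adj (M ^\<^sub>m k)" using Suc(2) by (simp add: adj_mult[where n = n])
  then show ?case using Suc pow_mat_Suc2[OF adj_carrier[OF Suc(2)]] by simp
qed

lemma herm_pow:
  assumes "M \<in> carrier_mat n n" "u \<in> carrier_vec n" "v \<in> carrier_vec n"
  shows "herm u ((M ^\<^sub>m k) *\<^sub>v v) = herm ((adj M ^\<^sub>m k) *\<^sub>v u) v"
proof -
  have "M ^\<^sub>m k \<in> carrier_mat n n" using assms(1) by simp
  from herm_adj[OF this assms(2,3)] show ?thesis by (simp add: adj_pow[OF assms(1)])
qed

text \<open>For unitary M the adjoint is the inverse, so this is M^j M^(-(j+e)) = M^(-e).\<close>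

lemma pow_adj_cancel:
  assumes M: "M \<in> UU n" and u: "u \<in> carrier_vec n"
  shows "(M ^\<^sub>m j) *\<^sub>v ((adj M ^\<^sub>m (j + e)) *\<^sub>v u) = (adj M ^\<^sub>m e) *\<^sub>v u"
proof (induction j)
  case 0
  have "(adj M ^\<^sub>m e) *\<^sub>v u \<in> carrier_vec n"
    using adj_carrier[OF unitary_groupD(2)[OF M]] u by (intro mult_mat_vec_carrier) auto
  then show ?case using carrier_matD[OF unitary_groupD(2)[OF M]] by simp
next
  case (Suc j)
  note Mc = unitary_groupD(2)[OF M] and Ac = adj_carrier[OF unitary_groupD(2)[OF M]]
  let ?y = "(adj M ^\<^sub>m (j + e)) *\<^sub>v u"
  have y: "?y \<in> carrier_vec n" using Ac u by (intro mult_mat_vec_carrier) auto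
  have Ay: "adj M *\<^sub>v ?y \<in> carrier_vec n" using Ac y by (rule mult_mat_vec_carrier)
  have "(adj M ^\<^sub>m (Suc j + e)) *\<^sub>v u = adj M *\<^sub>v ?y"
    using pow_Suc_mult_vec(1)[OF Ac u, of "j + e"] by simp
  then have "(M ^\<^sub>m Suc j) *\<^sub>v ((adj M ^\<^sub>m (Suc j + e)) *\<^sub>v u) = (M ^\<^sub>m j) *\<^sub>v (M *\<^sub>v (adj M *\<^sub>v ?y))"
    using pow_Suc_mult_vec(2)[OF Mc Ay] by simp
  also have "M *\<^sub>v (adj M *\<^sub>v ?y) = ?y" by (rule unitary_cancel_vec(2)[OF M y])
  finally show ?case using Suc by simp
qed

section \<open>Values of the forms and their cross terms\<close>

definition qform :: "'k mat \<Rightarrow> 'k vec \<Rightarrow> nat \<Rightarrow> 'k" where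
  "qform M u j = herm u ((M ^\<^sub>m j) *\<^sub>v u)"

text \<open>The cross term of \<open>qform\<close> at u + w. It is additive in u but mixes linear
  and conjugate-linear parts, so fibres are compared by translation rather than by linear algebra
  over R.\<close>

definition qpolar :: "'k mat \<Rightarrow> 'k vec \<Rightarrow> 'k vec \<Rightarrow> nat \<Rightarrow> 'k" where
  "qpolar M w u j = herm u ((M ^\<^sub>m j) *\<^sub>v w) + herm w ((M ^\<^sub>m j) *\<^sub>v u)"

lemma qform_add:
  assumes M: "M \<in> UU n" and u: "u \<in> ivec n" and w: "w \<in> ivec n"
  shows "qform M (u + w) j = qform M u j + qpolar M w u j + qform M w j"
proof -
  have p: "M ^\<^sub>m j \<in> carrier_mat n n" using unitary_groupD(2)[OF M] by simp
  note uc = ivec_carrier[OF u] and wc = ivec_carrier[OF w]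
  have c: "(M ^\<^sub>m j) *\<^sub>v u \<in> carrier_vec n" "(M ^\<^sub>m j) *\<^sub>v w \<in> carrier_vec n"
    using p uc wc by (auto intro: mult_mat_vec_carrier)
  have "(M ^\<^sub>m j) *\<^sub>v (u + w) = (M ^\<^sub>m j) *\<^sub>v u + (M ^\<^sub>m j) *\<^sub>v w" by (rule mult_add_distrib_mat_vec[OF p uc wc])
  then have "qform M (u + w) j = herm (u + w) ((M ^\<^sub>m j) *\<^sub>v u) + herm (u + w) ((M ^\<^sub>m j) *\<^sub>v w)"
    unfolding qform_def using herm_add_right[OF add_carrier_vec[OF uc wc] c(2,1)] by simp
  also have "\<dots> = (herm u ((M ^\<^sub>m j) *\<^sub>v u) + herm w ((M ^\<^sub>m j) *\<^sub>v u)) + (herm u ((M ^\<^sub>m j) *\<^sub>v w) + herm w ((M ^\<^sub>m j) *\<^sub>v w))"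
    unfolding herm_add_left[OF uc wc c(1)] herm_add_left[OF uc wc c(2)] ..
  finally show ?thesis by (simp add: qform_def qpolar_def)
qed

lemma qpolar_add:
  assumes M: "M \<in> UU n" and u: "u \<in> ivec n" and w: "w \<in> ivec n" and x: "x \<in> ivec n"
  shows "qpolar M w (u + x) j = qpolar M w u j + qpolar M w x j"
proof -
  have p: "M ^\<^sub>m j \<in> carrier_mat n n" using unitary_groupD(2)[OF M] by simp
  note uc = ivec_carrier[OF u] and wc = ivec_carrier[OF w] and xc = ivec_carrier[OF x]
  have c: "(M ^\<^sub>m j) *\<^sub>v u \<in> carrier_vec n" "(M ^\<^sub>m j) *\<^sub>v w \<in> carrier_vec n" "(M ^\<^sub>m j) *\<^sub>v x \<in> carrier_vec n"
    using p uc wc xc by (auto intro: mult_mat_vec_carrier)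
  have "(M ^\<^sub>m j) *\<^sub>v (u + x) = (M ^\<^sub>m j) *\<^sub>v u + (M ^\<^sub>m j) *\<^sub>v x" by (rule mult_add_distrib_mat_vec[OF p uc xc])
  then show ?thesis
    unfolding qpolar_def using herm_add_right[OF wc c(3,1)] herm_add_left[OF uc xc c(2)] by simp
qed

lemma pow_0_vec: "M \<in> UU n \<Longrightarrow> v \<in> ivec n \<Longrightarrow> (M ^\<^sub>m 0) *\<^sub>v v = v"
  using carrier_matD[OF unitary_groupD(2)] ivec_carrier by simp

lemma qform_form_space: "M \<in> UU n \<Longrightarrow> u \<in> ivec n \<Longrightarrow> qform M u \<in> form_space d"
  using herm_self[of u n] herm_integral[of u n] pow_ivec[of M n u] pow_0_vec[of M n u]
  by (auto simp: form_space_iff qform_def)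

lemma qpolar_form_space:
  assumes "M \<in> UU n" "u \<in> ivec n" "w \<in> ivec n"
  shows "qpolar M w u \<in> form_space d"
proof -
  have "nrm (qpolar M w u j) \<le> 1" for j
    unfolding qpolar_def using assms by (intro nrm_add_le herm_integral[where n = n] pow_ivec)
  moreover have "\<tau> (qpolar M w u 0) = qpolar M w u 0"
    unfolding qpolar_def pow_0_vec[OF assms(1,2)] pow_0_vec[OF assms(1,3)]
    using assms by (simp add: tau_hom tau_herm[OF ivec_carrier ivec_carrier] add.commute)
  ultimately show ?thesis by (auto simp: form_space_iff)
qed

lemma pow_vec_close:
  assumes "M \<in> UU n" "u \<in> ivec n" "u' \<in> ivec n" "close_vec n (lv k) u u'"
  shows "close_vec n (lv k) ((M ^\<^sub>m j) *\<^sub>v u) ((M ^\<^sub>m j) *\<^sub>v u')"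
  by (rule close_mult_mat_vec[OF mat_over_pow[OF unitary_groupD(1)[OF assms(1)]] assms(2) mat_over_pow[OF unitary_groupD(1)[OF assms(1)]] assms(3)
      close_mat_refl[OF lv_nonneg] assms(4) lv_nonneg])

lemma qform_close:
  assumes "M \<in> UU n" "u \<in> ivec n" "u' \<in> ivec n" "close_vec n (lv k) u u'"
  shows "cong_lv k (qform M u j) (qform M u' j)"
  unfolding qform_def
  by (rule herm_close[OF assms(2) pow_ivec[OF assms(1,2)] assms(3) pow_ivec[OF assms(1,3)] assms(4) pow_vec_close[OF assms] lv_nonneg])

lemma qpolar_close:
  assumes "M \<in> UU n" "u \<in> ivec n" "u' \<in> ivec n" "close_vec n (lv k) u u'" "w \<in> ivec n"
  shows "cong_lv k (qpolar M w u j) (qpolar M w u' j)"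
proof -
  have 1: "nrm (herm u ((M ^\<^sub>m j) *\<^sub>v w) - herm u' ((M ^\<^sub>m j) *\<^sub>v w)) \<le> lv k"
    by (rule herm_close[OF assms(2) pow_ivec[OF assms(1,5)] assms(3) pow_ivec[OF assms(1,5)] assms(4) close_vec_refl[OF lv_nonneg] lv_nonneg])
  have 2: "nrm (herm w ((M ^\<^sub>m j) *\<^sub>v u) - herm w ((M ^\<^sub>m j) *\<^sub>v u')) \<le> lv k"
    by (rule herm_close[OF assms(5) pow_ivec[OF assms(1,2)] assms(5) pow_ivec[OF assms(1,3)] close_vec_refl[OF lv_nonneg]
          pow_vec_close[OF assms(1-4)] lv_nonneg])
  from nrm_add_le[OF 1 2] show ?thesis by (simp add: qpolar_def algebra_simps)
qed

text \<open>Write u = M^(-d) u'. Then the two parts of the cross term at j are the product of u'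
  with M^(d+j) w and the conjugate of its product with M^(d-j) w, and the 2d + 1 products with u'
  can be prescribed freely.\<close>

lemma qpolar_surj:
  assumes M: "M \<in> UU n" and w: "w \<in> ivec n" and ind: "krylov n w M (2 * d + 1)" and z: "z \<in> form_space d"
  shows "\<exists>u\<in>ivec n. \<forall>j\<in>{0..d}. qpolar M w u j = z j"
proof -
  \<comment> \<open>The exponents below d are switched off, so for j > 0 only the first part
    contributes. At j = 0 both parts use \<open>t d\<close>, hence the half, which is fixed by
    \<tau>.\<close>
  define t where "t i = (if i < d then 0 else if i = d then z 0 / 2 else z (i - d))" for i
  have zi: "nrm (z j) \<le> 1" if "j \<le> d" for j using z that by (auto simp: form_space_iff split: if_splits)
  have z0: "\<tau> (z 0) = z 0" using z by (auto simp: form_space_iff)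
  have "nrm (t i) \<le> 1" if "i < 2 * d + 1" for i
    using that zi[of 0] zi[of "i - d"] by (auto simp: t_def nrm_divide nrm_2)
  then have "\<exists>u\<in>ivec n. \<forall>i<2 * d + 1. herm u ((M ^\<^sub>m i) *\<^sub>v w) = t i"
    by (intro indep_surj ind pow_ivec M w)
  then obtain u' where u': "u' \<in> ivec n" "\<And>i. i < 2 * d + 1 \<Longrightarrow> herm u' ((M ^\<^sub>m i) *\<^sub>v w) = t i" by blast
  note Mc = unitary_groupD(2)[OF M] and wc = ivec_carrier[OF w] and uc = ivec_carrier[OF u'(1)]
  have A: "adj M \<in> UU n" using M by (rule unitary_group_adj)
  define u where "u = (adj M ^\<^sub>m d) *\<^sub>v u'"
  have u: "u \<in> ivec n" unfolding u_def using A u'(1) by (rule pow_ivec)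
  have pow_add: "(M ^\<^sub>m d) *\<^sub>v ((M ^\<^sub>m j) *\<^sub>v w) = (M ^\<^sub>m (d + j)) *\<^sub>v w" for j
  proof (induction d)
    case 0
    then show ?case using pow_0_vec[OF M pow_ivec[OF M w]] by simp
  next
    case (Suc d)
    have c: "(M ^\<^sub>m j) *\<^sub>v w \<in> carrier_vec n" using pow_ivec[OF M w] by (rule ivec_carrier)
    show ?case using Suc pow_Suc_mult_vec(1)[OF Mc c, of d] pow_Suc_mult_vec(1)[OF Mc wc, of "d + j"] by simp
  qed
  have h1: "herm u ((M ^\<^sub>m j) *\<^sub>v w) = t (d + j)" if "j \<le> d" for j
  proof -
    have "herm u ((M ^\<^sub>m j) *\<^sub>v w) = herm u' ((M ^\<^sub>m d) *\<^sub>v ((M ^\<^sub>m j) *\<^sub>v w))"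
      unfolding u_def by (rule herm_pow[OF Mc uc ivec_carrier[OF pow_ivec[OF M w]], symmetric])
    also have "\<dots> = t (d + j)" using u'(2)[of "d + j"] that by (simp add: pow_add)
    finally show ?thesis .
  qed
  have h2: "herm w ((M ^\<^sub>m j) *\<^sub>v u) = \<tau> (t (d - j))" if "j \<le> d" for j
  proof -
    have "(M ^\<^sub>m j) *\<^sub>v u = (adj M ^\<^sub>m (d - j)) *\<^sub>v u'"
      unfolding u_def using pow_adj_cancel[OF M uc, of j "d - j"] that by simp
    then have "herm w ((M ^\<^sub>m j) *\<^sub>v u) = \<tau> (herm ((adj M ^\<^sub>m (d - j)) *\<^sub>v u') w)"
      using tau_herm[OF ivec_carrier[OF pow_ivec[OF A u'(1)]] wc, of "d - j"] by simp
    also have "herm ((adj M ^\<^sub>m (d - j)) *\<^sub>v u') w = herm u' ((M ^\<^sub>m (d - j)) *\<^sub>v w)"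
      by (rule herm_pow[OF Mc uc wc, symmetric])
    also have "\<dots> = t (d - j)" using that by (intro u'(2)) simp
    finally show ?thesis .
  qed
  have "qpolar M w u j = z j" if "j \<in> {0..d}" for j
  proof (cases "j = 0")
    case True
    have half: "\<tau> (z 0 / 2) = z 0 / 2" using z0 by (simp only: divide_inverse tau_hom(2,7) tau_2)
    have td: "t d = z 0 / 2" by (simp add: t_def)
    have "qpolar M w u 0 = t d + \<tau> (t d)"
      unfolding qpolar_def h1[OF le0] h2[OF le0] by (simp only: add_0_right diff_zero)
    also have "\<dots> = z 0 / 2 + z 0 / 2" by (simp only: td half)
    finally show ?thesis using True by (simp add: add_divide_distrib[symmetric])
  next
    case False
    then show ?thesis using h1[of j] h2[of j] that by (simp add: qpolar_def t_def tau_hom)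
  qed
  then show ?thesis using u by blast
qed

lemma qpolar_fibre_card:
  assumes M: "M \<in> UU n" and w: "w \<in> ivec n" and ind: "krylov n w M (2 * d + 1)" and y: "y \<in> form_space d"
  shows "card {u \<in> vec_reps n k. close_fun {0..d} k (qpolar M w u) y} * card (form_reps d k) = card (vec_reps n k)"
proof (rule transversal_fibres[OF equivp_close_vec transversal_vec_reps equivp_close_fun transversal_form_reps _ _ _ y])
  show "qpolar M w x \<in> form_space d" if "x \<in> ivec n" for x by (rule qpolar_form_space[OF M that w])
  show "close_fun {0..d} k (qpolar M w x) (qpolar M w x')" if "x \<in> ivec n" "x' \<in> ivec n" "close_vec n (lv k) x x'" for x x'
    using qpolar_close[OF M that w] by blast
  fix y y' assume yy: "y \<in> form_space d" "y' \<in> form_space d"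
  have "(\<lambda>j. y' j - y j) \<in> form_space d" using yy by (auto simp: form_space_iff tau_hom intro!: nrm_diff_le)
  then obtain x0 where x0: "x0 \<in> ivec n" "\<forall>j\<in>{0..d}. qpolar M w x0 j = y' j - y j"
    using qpolar_surj[OF M w ind] by blast
  show "\<exists>\<phi>. (\<forall>x\<in>ivec n. \<phi> x \<in> ivec n \<and>
        (close_fun {0..d} k (qpolar M w (\<phi> x)) y' \<longleftrightarrow> close_fun {0..d} k (qpolar M w x) y)) \<and>
      (\<forall>x\<in>ivec n. \<forall>x'\<in>ivec n. close_vec n (lv k) (\<phi> x) (\<phi> x') \<longrightarrow> close_vec n (lv k) x x')"
  proof (intro exI[of _ "\<lambda>x. x + x0"] conjI ballI impI)
    fix x assume x: "x \<in> ivec n"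
    show "x + x0 \<in> ivec n" using x x0(1) by (rule ivec_add)
    have "qpolar M w (x + x0) j - y' j = qpolar M w x j - y j" if "j \<in> {0..d}" for j
      using qpolar_add[OF M x w x0(1), of j] x0(2) that by simp
    then show "close_fun {0..d} k (qpolar M w (x + x0)) y' \<longleftrightarrow> close_fun {0..d} k (qpolar M w x) y" by simp
  next
    fix x x' assume "x \<in> ivec n" "x' \<in> ivec n" "close_vec n (lv k) (x + x0) (x' + x0)"
    then show "close_vec n (lv k) x x'" using close_vec_add_cancel(1) x0(1) by blast
  qed
qed

lemma card_form_reps_pos: "card (form_reps d k) > 0"
proof -
  have "(\<lambda>_. 0) \<in> form_space d" by (simp add: form_space_iff tau_hom)
  then have "form_reps d k \<noteq> {}" using transversal_form_reps[of d k] unfolding transversal_def by blast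
  moreover have "finite (form_reps d k)" using transversal_form_reps[of d k] unfolding transversal_def by blast
  ultimately show ?thesis by (simp add: card_gt_0_iff)
qed

text \<open>Put t' = t + w. A collision means that the cross term of t and w is congruent to minus
  the value at w, which for independent Krylov vectors of w holds for exactly one in
  \<open>card (form_reps d k)\<close> of the t. For the other w all t are allowed.\<close>

lemma qform_collisions:
  assumes M: "M \<in> UU n"
  shows "(\<Sum>t\<in>vec_reps n k. real (card {t' \<in> vec_reps n k. close_fun {0..d} k (qform M t') (qform M t)}))
    \<le> (real (card (vec_reps n k)))\<^sup>2 / real (card (form_reps d k)) +
      real (card (vec_reps n k)) * real (card {w \<in> vec_reps n k. \<not> krylov n w M (2 * d + 1)})"
proof -
  let ?V = "vec_reps n k" and ?N = "real (card (vec_reps n k))" and ?m = "real (card (form_reps d k))"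
  let ?C = "\<lambda>a b. close_fun {0..d} k a b"
  have fin: "finite ?V" by (rule finite_vec_reps)
  have tr: "real (card {t' \<in> ?V. ?C (qform M t') (qform M t)}) = (\<Sum>w\<in>?V. of_bool (?C (qform M (t + w)) (qform M t)))"
    if t: "t \<in> ?V" for t
  proof -
    have tV: "t \<in> ivec n" using t by (rule vec_reps_ivec)
    have "(\<Sum>w\<in>?V. of_bool (?C (qform M (t + w)) (qform M t)) :: real) = (\<Sum>w\<in>?V. of_bool (?C (qform M w) (qform M t)))"
    proof (rule transversal_sum_reindex[OF equivp_close_vec transversal_vec_reps, where \<phi> = "\<lambda>w. t + w" and g = "\<lambda>w. of_bool (?C (qform M w) (qform M t))"])
      show "t + x \<in> ivec n" if "x \<in> ivec n" for x using tV that by (rule ivec_add)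
      show "close_vec n (lv k) x y" if "x \<in> ivec n" "y \<in> ivec n" "close_vec n (lv k) (t + x) (t + y)" for x y
        using that close_vec_add_cancel(2) tV by blast
      show "of_bool (?C (qform M x) (qform M t)) = (of_bool (?C (qform M y) (qform M t)) :: real)"
        if "x \<in> ivec n" "y \<in> ivec n" "close_vec n (lv k) x y" for x y
      proof -
        have "?C (qform M x) (qform M y)" using qform_close[OF M that] by blast
        then have "?C (qform M x) (qform M t) \<longleftrightarrow> ?C (qform M y) (qform M t)"
          by (rule equivp_cong[OF equivp_close_fun[of "{0..d}" k], of "qform M x" "qform M y" "qform M t"])
        then show ?thesis by (simp only:)
      qed
    qed
    then show ?thesis using fin by (simp add: Int_def)
  qed
  have cnt: "(\<Sum>t\<in>?V. of_bool (?C (qform M (t + w)) (qform M t))) \<le> ?N / ?m + of_bool (\<not> krylov n w M (2 * d + 1)) * ?N"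
    if w: "w \<in> ?V" for w
  proof (cases "krylov n w M (2 * d + 1)")
    case True
    have wV: "w \<in> ivec n" using w by (rule vec_reps_ivec)
    let ?y = "\<lambda>j. - qform M w j"
    have y: "?y \<in> form_space d" using qform_form_space[OF M wV, of d] by (auto simp: form_space_iff tau_hom)
    have eq: "?C (qform M (t + w)) (qform M t) \<longleftrightarrow> ?C (qpolar M w t) ?y" if "t \<in> ?V" for t
      using qform_add[OF M vec_reps_ivec[OF that] wV] by simp
    have "card {t \<in> ?V. ?C (qpolar M w t) ?y} * card (form_reps d k) = card ?V"
      by (rule qpolar_fibre_card[OF M wV True y])
    from arg_cong[OF this, of real]
    have c: "real (card {t \<in> ?V. ?C (qpolar M w t) ?y}) * ?m = ?N" by (simp only: of_nat_mult)
    have m0: "?m > 0" using card_form_reps_pos by simp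
    have "(\<Sum>t\<in>?V. of_bool (?C (qform M (t + w)) (qform M t)) :: real) = (\<Sum>t\<in>?V. of_bool (?C (qpolar M w t) ?y))"
      using eq by (intro sum.cong) simp_all
    also have "\<dots> = real (card {t \<in> ?V. ?C (qpolar M w t) ?y})" using fin by (simp add: Int_def)
    also have "\<dots> = ?N / ?m" using c m0 by (simp add: field_simps)
    finally show ?thesis using True by simp
  next
    case False
    have "(\<Sum>t\<in>?V. of_bool (?C (qform M (t + w)) (qform M t)) :: real) \<le> (\<Sum>t\<in>?V. 1)"
      by (intro sum_mono) simp
    also have "\<dots> = ?N" by simp
    finally have le: "(\<Sum>t\<in>?V. of_bool (?C (qform M (t + w)) (qform M t)) :: real) \<le> ?N" .
    have o: "of_bool (\<not> krylov n w M (2 * d + 1)) = (1::real)" using False by simp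
    have "0 \<le> ?N / ?m" by simp
    then show ?thesis unfolding o using le by linarith
  qed
  have "(\<Sum>t\<in>?V. real (card {t' \<in> ?V. ?C (qform M t') (qform M t)})) =
      (\<Sum>t\<in>?V. \<Sum>w\<in>?V. of_bool (?C (qform M (t + w)) (qform M t)))"
    using tr by (intro sum.cong) simp_all
  also have "\<dots> = (\<Sum>w\<in>?V. \<Sum>t\<in>?V. of_bool (?C (qform M (t + w)) (qform M t)))" by (rule sum.swap)
  also have "\<dots> \<le> (\<Sum>w\<in>?V. ?N / ?m + of_bool (\<not> krylov n w M (2 * d + 1)) * ?N)"
    using cnt by (intro sum_mono)
  also have "\<dots> = ?N * (?N / ?m) + (\<Sum>w\<in>?V. of_bool (\<not> krylov n w M (2 * d + 1))) * ?N"
    by (simp only: sum.distrib sum_constant sum_distrib_right[symmetric])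
  also have "(\<Sum>w\<in>?V. of_bool (\<not> krylov n w M (2 * d + 1))) = real (card {w \<in> ?V. \<not> krylov n w M (2 * d + 1)})"
    using fin by (simp add: Int_def)
  finally show ?thesis by (simp add: power2_eq_square mult.commute)
qed

subsection \<open>Equidistribution\<close>


text \<open>The values at hand are integral only up to index d, so entries outside 1..i are replaced
  by 0.\<close>

lemma frob_newton_congruence':
  assumes "\<And>j. j \<in> {1..i} \<Longrightarrow> nrm (\<phi> j) \<le> 1" "i > 0"
  shows "nrm (frob_newton \<phi> i) \<le> nrm (of_nat i)"
proof -
  let ?\<phi> = "\<lambda>j. if j \<in> {1..i} then \<phi> j else 0"
  have "frob_newton \<phi> i = frob_newton ?\<phi> i" by (rule frob_newton_cong) simp
  moreover have "nrm (?\<phi> j) \<le> 1" for j using assms(1)[of j] by simp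
  then have "nrm (frob_newton ?\<phi> i) \<le> nrm (of_nat i)" using assms(2) by (rule frob_newton_congruence)
  ultimately show ?thesis by (simp only:)
qed

lemma frob_newton_close':
  assumes "\<And>j. j \<in> {1..i} \<Longrightarrow> nrm (\<phi> j) \<le> 1" "\<And>j. j \<in> {1..i} \<Longrightarrow> nrm (\<phi>' j) \<le> 1"
    "\<And>j. j \<in> {1..i} \<Longrightarrow> cong_lv k (\<phi> j) (\<phi>' j)"
  shows "cong_lv k (frob_newton \<phi> i) (frob_newton \<phi>' i)"
proof -
  let ?t = "\<lambda>\<phi> j. if j \<in> {1..i} then \<phi> j else 0"
  have e: "frob_newton \<phi> i = frob_newton (?t \<phi>) i" "frob_newton \<phi>' i = frob_newton (?t \<phi>') i"
    by (rule frob_newton_cong, simp)+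
  have "cong_lv k (frob_newton (?t \<phi>) i) (frob_newton (?t \<phi>') i)"
  proof (rule frob_newton_close)
    show "nrm (?t \<phi> j) \<le> 1" "nrm (?t \<phi>' j) \<le> 1" for j using assms(1,2)[of j] by simp_all
    show "cong_lv k (?t \<phi> j) (?t \<phi>' j)" if "j \<in> {1..i}" for j using assms(3)[OF that] that by simp
  qed
  then show ?thesis by (simp only: e)
qed

lemma sum_residue_reps_affine:
  fixes g :: "'k \<Rightarrow> real"
  assumes r: "nrm r = 1" and c: "nrm c \<le> 1"
    and g: "\<And>x y. nrm x \<le> 1 \<Longrightarrow> nrm y \<le> 1 \<Longrightarrow> cong_lv k x y \<Longrightarrow> g x = g y"
  shows "(\<Sum>t\<in>residue_reps k. g (r * t + c)) = (\<Sum>t\<in>residue_reps k. g t)"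
proof (rule transversal_sum_reindex[OF equivp_cong_lv transversal_residue_reps])
  show "r * x + c \<in> {x. nrm x \<le> 1}" if "x \<in> {x. nrm x \<le> 1}" for x
    using that r c by (auto intro!: nrm_add_le nrm_mult_le_one)
  show "cong_lv k x y" if "cong_lv k (r * x + c) (r * y + c)" for x y
  proof -
    have "r * x + c - (r * y + c) = r * (x - y)" by (simp add: algebra_simps)
    then show ?thesis using that r by (simp add: nrm_mult)
  qed
qed (use g in blast)

definition saturated :: "nat \<Rightarrow> 'k set \<Rightarrow> bool" where
  "saturated k B \<longleftrightarrow> (\<forall>x y. nrm x \<le> 1 \<longrightarrow> nrm y \<le> 1 \<longrightarrow> cong_lv k x y \<longrightarrow> x \<in> B \<longrightarrow> y \<in> B)"

lemma saturated_iff: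
  "saturated k B \<Longrightarrow> nrm x \<le> 1 \<Longrightarrow> nrm y \<le> 1 \<Longrightarrow> cong_lv k x y \<Longrightarrow> x \<in> B \<longleftrightarrow> y \<in> B"
  unfolding saturated_def using nrm_minus_commute by metis

text \<open>The argument a stands for the values u^* M^j u. They determine the scalar of the
  reflection and all corrected traces of h_u M up to index m, so the event becomes a function of a
  alone.\<close>

definition event_fun :: "'k mat \<Rightarrow> (nat \<Rightarrow> 'k set) \<Rightarrow> nat \<Rightarrow> (nat \<Rightarrow> 'k) \<Rightarrow> real" where
  "event_fun M B m a = of_bool (\<forall>i\<in>{1..m}. frob_trace i M + frob_newton (\<lambda>j. refl_coeff (a 0) * a j) i \<in> B i)"

text \<open>Divided by \<open>card (residue_reps k)\<close>, this is the probability that i times a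
  uniform integer lies in \<open>B i\<close>. The factor i comes from Newton's identities; it
  differs from 1/|i|_p by a unit.\<close>

definition limit_count :: "nat \<Rightarrow> (nat \<Rightarrow> 'k set) \<Rightarrow> nat \<Rightarrow> real" where
  "limit_count k B i = (\<Sum>t\<in>residue_reps k. of_bool (of_nat i * t \<in> B i))"

lemma card_form_reps: "card (form_reps m k) = card (fixed_reps k) * card (residue_reps k) ^ m"
proof (induction m)
  case (Suc m)
  have "card (form_reps (Suc m) k) = (\<Prod>j\<in>{0..Suc m}. card (if j = 0 then fixed_reps k else residue_reps k))"
    unfolding form_reps_def by (rule card_PiE) simp
  also have "\<dots> = (\<Prod>j\<in>{0..m}. card (if j = 0 then fixed_reps k else residue_reps k)) * card (residue_reps k)"
    by (simp add: prod.atLeast0_atMost_Suc)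
  also have "(\<Prod>j\<in>{0..m}. card (if j = 0 then fixed_reps k else residue_reps k)) = card (form_reps m k)"
    unfolding form_reps_def by (rule card_PiE[symmetric]) simp
  finally show ?case using Suc by simp
qed (simp add: form_reps_def card_PiE)

text \<open>Induction on m. The last coordinate y occurs only in the last condition, where it enters
  as (m+1)(r y + c) with r a unit and c integral. Summing over y therefore gives the same number
  whatever the other coordinates are. The coordinate at 0 contributes only the factor
  \<open>card (fixed_reps k)\<close>.\<close>

lemma sum_event_fun:
  assumes M: "M \<in> mat_over n RR" and B: "\<And>i. i \<in> {1..m} \<Longrightarrow> saturated k (B i)"
  shows "(\<Sum>a\<in>form_reps m k. event_fun M B m a) = real (card (fixed_reps k)) * (\<Prod>i\<in>{1..m}. limit_count k B i)"
  using B
proof (induction m)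
  case 0
  then show ?case using card_form_reps[of 0 k] by (simp add: event_fun_def)
next
  case (Suc m)
  let ?T = "\<lambda>j. if j = 0 then fixed_reps k else residue_reps k"
  let ?f = "\<lambda>(y, g). g(Suc m := y)"
  have fin: "finite (form_reps m k)" "finite (residue_reps k)"
    using transversal_form_reps[of m k] finite_residue_reps[of k] unfolding transversal_def by auto
  have im: "form_reps (Suc m) k = ?f ` (residue_reps k \<times> form_reps m k)"
    unfolding form_reps_def atLeast0_atMost_Suc by (subst PiE_insert_eq) simp
  have inj: "inj_on ?f (residue_reps k \<times> form_reps m k)"
    unfolding form_reps_def using inj_combinator[of "Suc m" "{0..m}" ?T] by simp
  have split: "event_fun M B (Suc m) (g(Suc m := y)) = event_fun M B m g *
      of_bool (frob_trace (Suc m) M + frob_newton (\<lambda>j. refl_coeff (g 0) * (g(Suc m := y)) j) (Suc m) \<in> B (Suc m))"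
    (is "_ = _ * of_bool (?P g y)") for g y
  proof -
    have "frob_newton (\<lambda>j. refl_coeff (g 0) * (g(Suc m := y)) j) i = frob_newton (\<lambda>j. refl_coeff (g 0) * g j) i"
      if "i \<in> {1..m}" for i
      using that by (intro frob_newton_cong) auto
    then have c: "(\<forall>i\<in>{1..m}. frob_trace i M + frob_newton (\<lambda>j. refl_coeff (g 0) * (g(Suc m := y)) j) i \<in> B i) \<longleftrightarrow>
        (\<forall>i\<in>{1..m}. frob_trace i M + frob_newton (\<lambda>j. refl_coeff (g 0) * g j) i \<in> B i)"
      by (intro ball_cong[OF refl]) (simp only:)
    have ivl: "{1..Suc m} = insert (Suc m) {1..m}" by auto
    have z: "(g(Suc m := y)) 0 = g 0" by simp
    have ins: "(\<forall>i\<in>insert (Suc m) {1..m}. Q i) \<longleftrightarrow> Q (Suc m) \<and> (\<forall>i\<in>{1..m}. Q i)" for Q by blast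
    show ?thesis
      unfolding event_fun_def z ivl c[symmetric] ins by (simp only: of_bool_conj mult.commute)
  qed
  have inner: "(\<Sum>y\<in>residue_reps k. of_bool (?P g y)) = limit_count k B (Suc m)" if g: "g \<in> form_reps m k" for g
  proof -
    have gA: "g \<in> form_space m" using g transversal_form_reps[of m k] unfolding transversal_def by blast
    define r where "r = refl_coeff (g 0)"
    have r1: "nrm r = 1" unfolding r_def using gA by (intro refl_coeff_unit) (auto simp: form_space_iff)
    \<comment> \<open>Zeroing the top entry makes \<psi>, and hence c, independent of y.\<close>
    define \<psi> where "\<psi> = (\<lambda>j. r * g j)(Suc m := 0)"
    have p1: "nrm (\<psi> j) \<le> 1" if "j \<in> {1..Suc m}" for j
      using gA that r1 by (auto simp: \<psi>_def form_space_iff nrm_mult)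
    \<comment> \<open>Both summands are divisible by m + 1, by the congruences for traces and for
      Newton sums; without them the shift c could fail to be integral.\<close>
    define c where "c = (frob_trace (Suc m) M + frob_newton \<psi> (Suc m)) / of_nat (Suc m)"
    have "nrm (frob_trace (Suc m) M + frob_newton \<psi> (Suc m)) \<le> nrm (of_nat (Suc m))"
      using frob_trace_congruence[OF M, of "Suc m"] frob_newton_congruence'[of "Suc m" \<psi>, OF p1]
      by (intro nrm_add_le) (simp_all del: of_nat_Suc)
    then have c1: "nrm c \<le> 1"
      unfolding c_def nrm_divide using nrm_pos[of "of_nat (Suc m)"] by (simp del: of_nat_Suc)
    have mc: "of_nat (Suc m) * c = frob_trace (Suc m) M + frob_newton \<psi> (Suc m)"
      unfolding c_def by (simp del: of_nat_Suc)
    have "frob_trace (Suc m) M + frob_newton (\<lambda>j. refl_coeff (g 0) * (g(Suc m := y)) j) (Suc m) = of_nat (Suc m) * (r * y + c)" for y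
    proof -
      have "(\<lambda>j. r * (g(Suc m := y)) j)(Suc m := 0) = \<psi>" by (auto simp: \<psi>_def)
      then have "frob_newton (\<lambda>j. r * (g(Suc m := y)) j) (Suc m) = of_nat (Suc m) * (r * y) + frob_newton \<psi> (Suc m)"
        using frob_newton_top[of "Suc m" "\<lambda>j. r * (g(Suc m := y)) j"] by (simp del: of_nat_Suc)
      then show ?thesis unfolding r_def[symmetric] distrib_left mc by simp
    qed
    then have "(\<Sum>y\<in>residue_reps k. of_bool (?P g y)) = (\<Sum>y\<in>residue_reps k. of_bool (of_nat (Suc m) * (r * y + c) \<in> B (Suc m)) :: real)"
      by (simp only:)
    also have "\<dots> = (\<Sum>y\<in>residue_reps k. of_bool (of_nat (Suc m) * y \<in> B (Suc m)))"
    proof (rule sum_residue_reps_affine[OF r1 c1, where g = "\<lambda>y. of_bool (of_nat (Suc m) * y \<in> B (Suc m))"])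
      fix x y assume xy: "nrm x \<le> 1" "nrm y \<le> 1" "cong_lv k x y"
      have "nrm (of_nat (Suc m) * x) \<le> 1" "nrm (of_nat (Suc m) * y) \<le> 1"
        using xy nrm_of_nat_le by (auto intro!: nrm_mult_le_one simp del: of_nat_Suc)
      moreover have "cong_lv k (of_nat (Suc m) * x) (of_nat (Suc m) * y)"
        unfolding right_diff_distrib[symmetric] using xy(3) nrm_of_nat_le by (intro nrm_mult_le)
      ultimately have "of_nat (Suc m) * x \<in> B (Suc m) \<longleftrightarrow> of_nat (Suc m) * y \<in> B (Suc m)"
        using Suc.prems[of "Suc m"] by (intro saturated_iff[of k]) auto
      then show "of_bool (of_nat (Suc m) * x \<in> B (Suc m)) = (of_bool (of_nat (Suc m) * y \<in> B (Suc m)) :: real)"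
        by (simp only:)
    qed
    finally show ?thesis unfolding limit_count_def .
  qed
  have "(\<Sum>a\<in>form_reps (Suc m) k. event_fun M B (Suc m) a) = (\<Sum>x\<in>residue_reps k \<times> form_reps m k. event_fun M B (Suc m) (?f x))"
    unfolding im using sum.reindex[OF inj, of "event_fun M B (Suc m)"] by (simp only: o_def)
  also have "\<dots> = (\<Sum>y\<in>residue_reps k. \<Sum>g\<in>form_reps m k. event_fun M B (Suc m) (g(Suc m := y)))"
    unfolding sum.cartesian_product by (rule sum.cong) auto
  also have "\<dots> = (\<Sum>g\<in>form_reps m k. \<Sum>y\<in>residue_reps k. event_fun M B m g * of_bool (?P g y))"
    unfolding split by (rule sum.swap)
  also have "\<dots> = (\<Sum>g\<in>form_reps m k. event_fun M B m g * limit_count k B (Suc m))"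
    using inner by (intro sum.cong refl) (simp only: sum_distrib_left[symmetric])
  also have "\<dots> = real (card (fixed_reps k)) * (\<Prod>i\<in>{1..m}. limit_count k B i) * limit_count k B (Suc m)"
    unfolding sum_distrib_right[symmetric] using Suc by simp
  finally show ?case by (simp add: prod.nat_ivl_Suc')
qed

lemma event_fun_close:
  assumes M: "M \<in> mat_over n RR" and B: "\<And>i. i \<in> {1..d} \<Longrightarrow> saturated k (B i)"
    and ab: "a \<in> form_space d" "b \<in> form_space d" "close_fun {0..d} k a b"
  shows "event_fun M B d a = event_fun M B d b"
proof -
  have u: "nrm (refl_coeff (a 0)) = 1" "nrm (refl_coeff (b 0)) = 1"
    using ab by (auto intro!: refl_coeff_unit simp: form_space_iff)
  have r: "nrm (refl_coeff (a 0) - refl_coeff (b 0)) \<le> lv k"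
    using ab by (intro refl_coeff_close) (auto simp: form_space_iff)
  have "frob_trace i M + frob_newton (\<lambda>j. refl_coeff (a 0) * a j) i \<in> B i \<longleftrightarrow>
      frob_trace i M + frob_newton (\<lambda>j. refl_coeff (b 0) * b j) i \<in> B i" if i: "i \<in> {1..d}" for i
  proof (rule saturated_iff[OF B[OF i]])
    have ij: "nrm (refl_coeff (a 0) * a j) \<le> 1" "nrm (refl_coeff (b 0) * b j) \<le> 1"
      "cong_lv k (refl_coeff (a 0) * a j) (refl_coeff (b 0) * b j)" if j: "j \<in> {1..i}" for j
    proof -
      have j': "j \<in> {0..d}" using i j by simp
      have *: "nrm (a j) \<le> 1" "nrm (b j) \<le> 1" using ab(1,2) j' by (auto simp: form_space_iff)
      show "nrm (refl_coeff (a 0) * a j) \<le> 1" "nrm (refl_coeff (b 0) * b j) \<le> 1"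
        using * u by (auto simp: nrm_mult)
      have "cong_lv k (a j) (b j)" using ab(3) j' by blast
      then show "cong_lv k (refl_coeff (a 0) * a j) (refl_coeff (b 0) * b j)"
        using * u r by (intro nrm_mult_diff_le) auto
    qed
    have ft: "nrm (frob_trace i M) \<le> 1" using frob_trace_congruence[OF M, of i] nrm_of_nat_le[of i] i by simp
    have le1: "nrm (frob_newton (\<lambda>j. refl_coeff (a 0) * a j) i) \<le> nrm (of_nat i)"
      "nrm (frob_newton (\<lambda>j. refl_coeff (b 0) * b j) i) \<le> nrm (of_nat i)"
      using frob_newton_congruence'[of i "\<lambda>j. refl_coeff (a 0) * a j", OF ij(1)]
        frob_newton_congruence'[of i "\<lambda>j. refl_coeff (b 0) * b j", OF ij(2)] i by simp_all
    show "nrm (frob_trace i M + frob_newton (\<lambda>j. refl_coeff (a 0) * a j) i) \<le> 1"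
      "nrm (frob_trace i M + frob_newton (\<lambda>j. refl_coeff (b 0) * b j) i) \<le> 1"
      using ft le1 nrm_of_nat_le[of i] by (auto intro!: nrm_add_le)
    have "cong_lv k (frob_newton (\<lambda>j. refl_coeff (a 0) * a j) i) (frob_newton (\<lambda>j. refl_coeff (b 0) * b j) i)"
      by (rule frob_newton_close') (use ij in blast)+
    then show "cong_lv k (frob_trace i M + frob_newton (\<lambda>j. refl_coeff (a 0) * a j) i)
        (frob_trace i M + frob_newton (\<lambda>j. refl_coeff (b 0) * b j) i)" by simp
  qed
  then have "(\<forall>i\<in>{1..d}. frob_trace i M + frob_newton (\<lambda>j. refl_coeff (a 0) * a j) i \<in> B i) \<longleftrightarrow>
      (\<forall>i\<in>{1..d}. frob_trace i M + frob_newton (\<lambda>j. refl_coeff (b 0) * b j) i \<in> B i)"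
    by (rule ball_cong[OF refl])
  then show ?thesis unfolding event_fun_def by (simp only:)
qed


section \<open>Averaging over the unitary group\<close>

definition in_event :: "(nat \<Rightarrow> 'k set) \<Rightarrow> nat \<Rightarrow> 'k mat \<Rightarrow> bool" where
  "in_event B d M \<longleftrightarrow> (\<forall>i\<in>{1..d}. frob_trace i M \<in> B i)"

lemma in_event_close:
  assumes B: "\<And>i. i \<in> {1..d} \<Longrightarrow> saturated k (B i)"
    and M: "M \<in> UU n" and N: "N \<in> UU n" and c: "close_mat n (lv k) M N"
  shows "in_event B d M \<longleftrightarrow> in_event B d N"
  unfolding in_event_def
proof (rule ball_cong[OF refl])
  fix i assume i: "i \<in> {1..d}"
  note MN = unitary_groupD(1)[OF M] unitary_groupD(1)[OF N]
  show "frob_trace i M \<in> B i \<longleftrightarrow> frob_trace i N \<in> B i"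
    using frob_trace_congruence[OF MN(1), of i] frob_trace_congruence[OF MN(2), of i] nrm_of_nat_le[of i] i
      frob_trace_close[OF MN c, of i]
    by (intro saturated_iff[OF B[OF i]]) auto
qed

lemma in_event_refl_mult:
  assumes M: "M \<in> UU n" and u: "u \<in> ivec n"
  shows "of_bool (in_event B d (refl_mat n u * M)) = event_fun M B d (qform M u)"
proof -
  have "qform M u 0 = herm u u" unfolding qform_def pow_0_vec[OF M u] ..
  then show ?thesis
    unfolding in_event_def event_fun_def frob_trace_refl_mult[OF u unitary_groupD(2)[OF M]] by (simp only: qform_def)
qed

text \<open>The representative of the class of 1 is a unit, so it cannot occur as a coordinate.
  Excluding a single residue per coordinate is crude but already exponentially small in n.\<close>

lemma card_small_vectors:
  assumes k: "k \<ge> 1"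
  shows "card {w \<in> vec_reps n k. \<forall>l<n. nrm (w $ l) < 1} \<le> (card (residue_reps k) - 1) ^ n"
proof -
  obtain t1 where t1: "t1 \<in> residue_reps k" "cong_lv k 1 t1" using residue_reps_ex[of 1 k] by auto
  have lt: "nrm (1 - t1) < 1" using t1(2) lv_le_lv1[OF k] lv_1 by fastforce
  have nt: "\<not> nrm t1 < 1" using nrm_add_lt[OF lt, of t1] by auto
  let ?P = "Pi\<^sub>E {..<n} (\<lambda>_. residue_reps k - {t1})"
  have "{w \<in> vec_reps n k. \<forall>l<n. nrm (w $ l) < 1} \<subseteq> (\<lambda>f. vec n f) ` ?P"
  proof
    fix w assume w: "w \<in> {w \<in> vec_reps n k. \<forall>l<n. nrm (w $ l) < 1}"
    then obtain f where f: "f \<in> Pi\<^sub>E {..<n} (\<lambda>_. residue_reps k)" "w = vec n f" unfolding vec_reps_def by blast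
    have "f i \<in> residue_reps k - {t1}" if "i \<in> {..<n}" for i
      using PiE_mem[OF f(1) that] w that nt by (auto simp: f(2))
    then have "f \<in> ?P" using f(1) by (intro PiE_I) (auto dest: PiE_arb)
    then show "w \<in> (\<lambda>f. vec n f) ` ?P" unfolding f(2) by (rule imageI)
  qed
  moreover have fin: "finite ?P" using finite_residue_reps by (intro finite_PiE) auto
  ultimately have "card {w \<in> vec_reps n k. \<forall>l<n. nrm (w $ l) < 1} \<le> card ((\<lambda>f. vec n f) ` ?P)"
    by (intro card_mono) auto
  also have "\<dots> \<le> card ?P" using fin by (rule card_image_le)
  also have "\<dots> = (card (residue_reps k) - 1) ^ n" using t1(1) finite_residue_reps[of k] by (simp add: card_PiE card_Diff_singleton)
  finally show ?thesis .
qed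

text \<open>For each M the average over u deviates from the limit by a quantity governed by the
  number of w with dependent Krylov vectors. The mean over M is handled by Cauchy-Schwarz, and the
  two error terms separate w with all coordinates in the maximal ideal from the remaining w.\<close>

lemma equidistribution_bound:
  assumes B: "\<And>i. i \<in> {1..d} \<Longrightarrow> saturated k (B i)" and k: "k \<ge> 1"
  shows "((\<Sum>M\<in>unitary_reps n k. of_bool (in_event B d M)) / card (unitary_reps n k) - (\<Prod>i\<in>{1..d}. limit_count k B i / card (residue_reps k)))\<^sup>2
    \<le> card (form_reps d k) * (((real (card (residue_reps k)) - 1) / card (residue_reps k)) ^ n +
        2 * d * real (card (residue_reps 1)) ^ (4 * d + 1) / real (card (residue_reps 1)) ^ n)"
proof -
  define NG where "NG = real (card (unitary_reps n k))"
  define NV where "NV = real (card (vec_reps n k))"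
  define NA where "NA = real (card (form_reps d k))"
  define q1 where "q1 = real (card (residue_reps 1))"
  define \<gamma> where "\<gamma> = (\<Prod>i\<in>{1..d}. limit_count k B i / card (residue_reps k))"
  define \<delta> where "\<delta> = 2 * real d * q1 ^ (4 * d + 1) / q1 ^ n"
  have Q: "card (residue_reps k) \<ge> 2" "q1 \<ge> 2" using card_residue_reps_ge[OF k] card_residue_reps_ge[of 1] by (auto simp: q1_def)
  have NVeq: "NV = real (card (residue_reps k)) ^ n" by (simp add: NV_def card_vec_reps)
  have "real (card (residue_reps k)) > 0" using Q(1) by simp
  then have "NV > 0" by (simp only: NVeq zero_less_power)
  moreover have "NG > 0" unfolding NG_def using finite_unitary_reps[of n k] unitary_reps_nonempty[of n k] by (simp add: card_gt_0_iff)
  moreover have "NA > 0" using card_form_reps_pos[of d k] by (simp add: NA_def)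
  ultimately have pos: "NG > 0" "NV > 0" "NA > 0" by blast+
  have fin: "finite (unitary_reps n k)" "finite (vec_reps n k)" by (rule finite_unitary_reps, rule finite_vec_reps)
  have TVne: "vec_reps n k \<noteq> {}" using pos by (auto simp: NV_def)
  define x where "x M = (\<Sum>u\<in>vec_reps n k. event_fun M B d (qform M u)) / NV" for M
  define bad where "bad M = {w \<in> vec_reps n k. \<not> krylov n w M (2 * d + 1)}" for M
  have xb: "(x M - \<gamma>)\<^sup>2 \<le> NA * real (card (bad M)) / NV" if M: "M \<in> unitary_reps n k" for M
  proof -
    have MU: "M \<in> UU n" using M by (rule unitary_reps_UU)
    have "(\<Sum>s\<in>form_reps d k. event_fun M B d s) / real (card (form_reps d k)) = \<gamma>"
    proof -
      have fixed_reps: "real (card (fixed_reps k)) > 0" using card_form_reps_pos[of 0 k] by (simp add: card_form_reps)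
      have "\<gamma> = (\<Prod>i\<in>{1..d}. limit_count k B i) / real (card (residue_reps k)) ^ d"
        by (simp add: \<gamma>_def prod_dividef)
      moreover have "(\<Sum>s\<in>form_reps d k. event_fun M B d s) = real (card (fixed_reps k)) * (\<Prod>i\<in>{1..d}. limit_count k B i)"
        using unitary_groupD(1)[OF MU] B by (rule sum_event_fun)
      ultimately show ?thesis using fixed_reps by (simp add: card_form_reps)
    qed
    moreover have "((\<Sum>t\<in>vec_reps n k. event_fun M B d (qform M t)) / real (card (vec_reps n k)) -
        (\<Sum>s\<in>form_reps d k. event_fun M B d s) / real (card (form_reps d k)))\<^sup>2 \<le> real (card (form_reps d k)) * real (card (bad M)) / real (card (vec_reps n k))"
    proof (rule collision_equidistribution[OF equivp_close_fun transversal_form_reps fin(2) TVne])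
      show "qform M t \<in> form_space d" if "t \<in> vec_reps n k" for t by (rule qform_form_space[OF MU vec_reps_ivec[OF that]])
      show "event_fun M B d a = event_fun M B d b" if "a \<in> form_space d" "b \<in> form_space d" "close_fun {0..d} k a b" for a b
        using unitary_groupD(1)[OF MU] B that by (rule event_fun_close)
      show "0 \<le> event_fun M B d a \<and> event_fun M B d a \<le> 1" for a by (simp add: event_fun_def)
      show "(\<Sum>t\<in>vec_reps n k. real (card {t' \<in> vec_reps n k. close_fun {0..d} k (qform M t') (qform M t)}))
          \<le> (real (card (vec_reps n k)))\<^sup>2 / real (card (form_reps d k)) + real (card (vec_reps n k)) * real (card (bad M))"
        unfolding bad_def by (rule qform_collisions[OF MU])
    qed
    ultimately show ?thesis by (simp add: x_def NV_def NA_def)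
  qed
  \<comment> \<open>Translating by h_u does not change the sum over M, for any u; averaging this
    over u replaces the indicator by \<open>x M\<close>.\<close>
  have avg: "(\<Sum>M\<in>unitary_reps n k. of_bool (in_event B d M)) = (\<Sum>M\<in>unitary_reps n k. x M)"
  proof -
    have "(\<Sum>M\<in>unitary_reps n k. of_bool (in_event B d (refl_mat n u * M)) :: real) = (\<Sum>M\<in>unitary_reps n k. of_bool (in_event B d M))"
      if "u \<in> vec_reps n k" for u
    proof (rule sum_unitary_reps_translate[OF refl_mat_unitary[OF vec_reps_ivec[OF that]]])
      fix M N assume "M \<in> UU n" "N \<in> UU n" "close_mat n (lv k) M N"
      from in_event_close[where B = B and d = d, OF B this] show "of_bool (in_event B d M) = (of_bool (in_event B d N) :: real)" by (simp only:)
    qed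
    then have "NV * (\<Sum>M\<in>unitary_reps n k. of_bool (in_event B d M)) =
        (\<Sum>u\<in>vec_reps n k. \<Sum>M\<in>unitary_reps n k. of_bool (in_event B d (refl_mat n u * M)))"
      by (simp add: NV_def)
    also have "\<dots> = (\<Sum>u\<in>vec_reps n k. \<Sum>M\<in>unitary_reps n k. event_fun M B d (qform M u))"
      by (intro sum.cong refl in_event_refl_mult unitary_reps_UU vec_reps_ivec)
    also have "\<dots> = (\<Sum>M\<in>unitary_reps n k. \<Sum>u\<in>vec_reps n k. event_fun M B d (qform M u))" by (rule sum.swap)
    also have "\<dots> = NV * (\<Sum>M\<in>unitary_reps n k. x M)"
      using pos by (simp add: x_def sum_divide_distrib[symmetric])
    finally show ?thesis using pos by simp
  qed
  \<comment> \<open>The bad pairs (M, w) are counted by w: the trivial bound is used when all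
    coordinates of w are in the maximal ideal, the dependence bound otherwise.\<close>
  have badsum: "(\<Sum>M\<in>unitary_reps n k. real (card (bad M))) \<le> NG * (real (card (residue_reps k)) - 1) ^ n + NV * (NG * \<delta>)"
  proof -
    let ?Z = "{w \<in> vec_reps n k. \<forall>l<n. nrm (w $ l) < 1}"
    let ?b = "\<lambda>w. real (card {M \<in> unitary_reps n k. \<not> krylov n w M (2 * d + 1)})"
    have bw: "?b w \<le> of_bool (w \<in> ?Z) * NG + NG * \<delta>" if w: "w \<in> vec_reps n k" for w
    proof (cases "w \<in> ?Z")
      case True
      have "card {M \<in> unitary_reps n k. \<not> krylov n w M (2 * d + 1)} \<le> card (unitary_reps n k)" using fin by (intro card_mono) auto
      then have "?b w \<le> NG" unfolding NG_def by (simp only: of_nat_le_iff)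
      moreover have "0 \<le> NG * \<delta>" using pos Q by (simp add: \<delta>_def)
      moreover have "of_bool (w \<in> ?Z) * NG = NG" using True by simp
      ultimately show ?thesis by linarith
    next
      case False
      then obtain l where l: "l < n" "\<not> nrm (w $ l) < 1" using w by blast
      have wV: "w \<in> ivec n" using w by (rule vec_reps_ivec)
      then have "nrm (w $ l) = 1" using l by (simp add: ivec_def) (meson antisym_conv1)
      \<comment> \<open>Taking D = 2d concerns 2d + 1 Krylov vectors and produces the exponent 2(2d)
        + 1 = 4d + 1.\<close>
      from card_dependent_le[OF wV l(1) this k, of "2 * d"]
      have "?b w * q1 ^ n \<le> real (2 * d) * (NG * q1 ^ (2 * (2 * d) + 1))"
        by (simp only: q1_def NG_def Suc_eq_plus1)
      then have "?b w * q1 ^ n \<le> (NG * \<delta>) * q1 ^ n" using Q by (simp add: \<delta>_def mult_ac)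
      then have "?b w \<le> NG * \<delta>" using Q by simp
      moreover have "of_bool (w \<in> ?Z) * NG = 0" using False by simp
      ultimately show ?thesis by linarith
    qed
    have "(\<Sum>M\<in>unitary_reps n k. real (card (bad M))) = (\<Sum>M\<in>unitary_reps n k. \<Sum>w\<in>vec_reps n k. of_bool (\<not> krylov n w M (2 * d + 1)))"
      using fin by (simp add: bad_def Int_def)
    also have "\<dots> = (\<Sum>w\<in>vec_reps n k. \<Sum>M\<in>unitary_reps n k. of_bool (\<not> krylov n w M (2 * d + 1)))" by (rule sum.swap)
    also have "\<dots> = (\<Sum>w\<in>vec_reps n k. ?b w)" using fin by (simp add: Int_def)
    also have "\<dots> \<le> (\<Sum>w\<in>vec_reps n k. of_bool (w \<in> ?Z) * NG + NG * \<delta>)" using bw by (rule sum_mono)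
    also have "\<dots> = (\<Sum>w\<in>vec_reps n k. of_bool (w \<in> ?Z)) * NG + NV * (NG * \<delta>)"
      by (simp only: sum.distrib sum_distrib_right[symmetric] sum_constant NV_def)
    also have "(\<Sum>w\<in>vec_reps n k. of_bool (w \<in> ?Z)) = real (card ?Z)"
    proof -
      have "(\<Sum>w\<in>vec_reps n k. of_bool (w \<in> ?Z)) = real (card (vec_reps n k \<inter> {w. w \<in> ?Z}))" by (subst sum_of_bool_eq) (use fin in simp_all)
      also have "vec_reps n k \<inter> {w. w \<in> ?Z} = ?Z" by blast
      finally show ?thesis .
    qed
    also have "real (card ?Z) \<le> real ((card (residue_reps k) - 1) ^ n)"
      using card_small_vectors[OF k, of n] by (simp only: of_nat_le_iff)
    also have "real ((card (residue_reps k) - 1) ^ n) = (real (card (residue_reps k)) - 1) ^ n" using Q by (simp add: of_nat_diff)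
    finally show ?thesis using pos by (simp add: mult.commute mult_right_mono)
  qed
  have alg: "NA * (NG * y + NV * (NG * z)) / (NV * NG) = NA * (y / NV + z)" for y z :: real
  proof -
    define w where "w = y / NV"
    have y: "y = w * NV" using pos(2) by (simp add: w_def)
    have nz: "NV * NG \<noteq> 0" using pos(1,2) by simp
    have "NA * (NG * y + NV * (NG * z)) = NA * (w + z) * (NV * NG)" unfolding y by (simp only: algebra_simps)
    then have "NA * (NG * y + NV * (NG * z)) / (NV * NG) = NA * (w + z) * (NV * NG) / (NV * NG)" by (rule arg_cong)
    also have "\<dots> = NA * (w + z)" using nz by (rule nonzero_mult_div_cancel_right)
    finally show ?thesis unfolding w_def .
  qed
  \<comment> \<open>The factor 1 fits the shape of Cauchy-Schwarz, which bounds the square of the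
    mean deviation by the mean of the squares.\<close>
  have "((\<Sum>M\<in>unitary_reps n k. of_bool (in_event B d M)) / NG - \<gamma>) = (\<Sum>M\<in>unitary_reps n k. (x M - \<gamma>) * 1) / NG"
    using pos by (simp add: avg sum_subtractf diff_divide_distrib NG_def)
  then have "((\<Sum>M\<in>unitary_reps n k. of_bool (in_event B d M)) / NG - \<gamma>)\<^sup>2 = (\<Sum>M\<in>unitary_reps n k. (x M - \<gamma>) * 1)\<^sup>2 / NG\<^sup>2"
    by (simp only: power_divide)
  also have "\<dots> \<le> ((\<Sum>M\<in>unitary_reps n k. (x M - \<gamma>)\<^sup>2) * (\<Sum>M\<in>unitary_reps n k. 1\<^sup>2)) / NG\<^sup>2"
    by (intro divide_right_mono Cauchy_Schwarz_ineq_sum) simp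
  also have "\<dots> = (\<Sum>M\<in>unitary_reps n k. (x M - \<gamma>)\<^sup>2) / NG"
    using pos by (simp add: NG_def power2_eq_square)
  also have "\<dots> \<le> (\<Sum>M\<in>unitary_reps n k. NA * real (card (bad M)) / NV) / NG"
    using pos xb by (intro divide_right_mono sum_mono) auto
  also have "\<dots> = NA * (\<Sum>M\<in>unitary_reps n k. real (card (bad M))) / (NV * NG)"
    by (simp add: sum_divide_distrib[symmetric] sum_distrib_left[symmetric])
  also have "\<dots> \<le> NA * (NG * (real (card (residue_reps k)) - 1) ^ n + NV * (NG * \<delta>)) / (NV * NG)"
    using pos by (intro divide_right_mono mult_left_mono badsum) auto
  also have "\<dots> = NA * ((real (card (residue_reps k)) - 1) ^ n / NV + \<delta>)" by (rule alg)
  also have "(real (card (residue_reps k)) - 1) ^ n / NV = ((real (card (residue_reps k)) - 1) / card (residue_reps k)) ^ n"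
    by (simp add: NVeq power_divide)
  finally show ?thesis by (simp only: NG_def \<gamma>_def NA_def \<delta>_def q1_def)
qed

lemma equidistribution_limit:
  assumes B: "\<And>i. i \<in> {1..d} \<Longrightarrow> saturated k (B i)" and k: "k \<ge> 1"
  shows "(\<lambda>n. (\<Sum>M\<in>unitary_reps n k. of_bool (in_event B d M)) / card (unitary_reps n k)) \<longlonglongrightarrow> (\<Prod>i\<in>{1..d}. limit_count k B i / card (residue_reps k))"
proof -
  define e where "e n = (\<Sum>M\<in>unitary_reps n k. of_bool (in_event B d M)) / real (card (unitary_reps n k))" for n
  define \<gamma> where "\<gamma> = (\<Prod>i\<in>{1..d}. limit_count k B i / card (residue_reps k))"
  define r where "r = (real (card (residue_reps k)) - 1) / card (residue_reps k)"
  define q1 where "q1 = real (card (residue_reps 1))"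
  have Q: "real (card (residue_reps k)) \<ge> 2" "q1 \<ge> 2" using card_residue_reps_ge[OF k] card_residue_reps_ge[of 1] by (auto simp: q1_def)
  have r0: "(\<lambda>n. r ^ n) \<longlonglongrightarrow> 0" using Q by (intro LIMSEQ_power_zero) (auto simp: r_def field_simps)
  have q0: "(\<lambda>n. (1 / q1) ^ n) \<longlonglongrightarrow> 0" using Q by (intro LIMSEQ_power_zero) (auto simp: field_simps)
  have "(\<lambda>n. real (card (form_reps d k)) * (r ^ n + 2 * d * q1 ^ (4 * d + 1) * (1 / q1) ^ n)) \<longlonglongrightarrow>
      real (card (form_reps d k)) * (0 + 2 * d * q1 ^ (4 * d + 1) * 0)"
    by (rule tendsto_mult[OF tendsto_const tendsto_add[OF r0 tendsto_mult[OF tendsto_const q0]]])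
  then have lim: "(\<lambda>n. real (card (form_reps d k)) * (r ^ n + 2 * d * q1 ^ (4 * d + 1) * (1 / q1) ^ n)) \<longlonglongrightarrow> 0" by simp
  have "(\<lambda>n. (e n - \<gamma>)\<^sup>2) \<longlonglongrightarrow> 0"
  proof (rule tendsto_sandwich[OF _ _ tendsto_const lim])
    show "\<forall>\<^sub>F n in sequentially. 0 \<le> (e n - \<gamma>)\<^sup>2" by simp
    have "(e n - \<gamma>)\<^sup>2 \<le> real (card (form_reps d k)) * (r ^ n + 2 * d * q1 ^ (4 * d + 1) * (1 / q1) ^ n)" for n
      using equidistribution_bound[where B = B and d = d and n = n, OF B k] by (simp add: e_def \<gamma>_def r_def q1_def power_divide)
    then show "\<forall>\<^sub>F n in sequentially. (e n - \<gamma>)\<^sup>2 \<le> real (card (form_reps d k)) * (r ^ n + 2 * d * q1 ^ (4 * d + 1) * (1 / q1) ^ n)"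
      by simp
  qed
  then have "(\<lambda>n. sqrt ((e n - \<gamma>)\<^sup>2)) \<longlonglongrightarrow> sqrt 0" by (rule tendsto_real_sqrt)
  then have "(\<lambda>n. \<bar>e n - \<gamma>\<bar>) \<longlonglongrightarrow> 0" by simp
  then have "(\<lambda>n. e n - \<gamma>) \<longlonglongrightarrow> 0" by (rule tendsto_rabs_zero_cancel)
  then have "e \<longlonglongrightarrow> \<gamma>" by (rule LIM_zero_cancel)
  then show ?thesis unfolding e_def[abs_def] \<gamma>_def .
qed

subsection \<open>Haar measure\<close>


lemma mat_dist_le_iff: "0 \<le> c \<Longrightarrow> mat_dist nrm n A B \<le> c \<longleftrightarrow> close_mat n c A B"
  by (simp add: mat_dist_def close_mat_def split_beta) blast

lemma mat_dist_nonneg: "0 \<le> mat_dist nrm n A B"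
  unfolding mat_dist_def by (rule Max_ge) auto

lemma close_mat_dist: "close_mat n (mat_dist nrm n A B) A B"
  using mat_dist_le_iff[OF mat_dist_nonneg, of n A B n A B] by simp

lemma Metric_space_mat: "Metric_space (UU n) (mat_dist nrm n)"
proof
  show "0 \<le> mat_dist nrm n A B" for A B by (rule mat_dist_nonneg)
  show "mat_dist nrm n A B = mat_dist nrm n B A" for A B
    unfolding mat_dist_def by (simp add: nrm_minus_commute)
  show "mat_dist nrm n A B = 0 \<longleftrightarrow> A = B" if "A \<in> UU n" "B \<in> UU n" for A B
  proof
    assume "mat_dist nrm n A B = 0"
    then have c: "close_mat n 0 A B" using close_mat_dist[of n A B] by simp
    show "A = B"
    proof (rule eq_matI)
      fix i j assume "i < dim_row B" "j < dim_col B"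
      then have "i < n" "j < n" using unitary_groupD(2)[OF that(2)] by auto
      then have "nrm (A $$ (i, j) - B $$ (i, j)) \<le> 0" using c by (simp add: close_mat_def)
      then have "nrm (A $$ (i, j) - B $$ (i, j)) = 0" using nrm_nonneg[of "A $$ (i, j) - B $$ (i, j)"] by linarith
      then show "A $$ (i, j) = B $$ (i, j)" by simp
    qed (use unitary_groupD(2)[OF that(1)] unitary_groupD(2)[OF that(2)] in auto)
  next
    assume "A = B"
    then have "mat_dist nrm n A B \<le> 0" using mat_dist_le_iff[of 0 n A B] close_mat_refl[of 0 n A] by simp
    then show "mat_dist nrm n A B = 0" using mat_dist_nonneg[of n A B] by linarith
  qed
  show "mat_dist nrm n A C \<le> mat_dist nrm n A B + mat_dist nrm n B C" for A B C
  proof -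
    have "close_mat n (mat_dist nrm n A B + mat_dist nrm n B C) A C"
      unfolding close_mat_def
    proof (intro allI impI)
      fix i j assume ij: "i < n" "j < n"
      have "nrm (A $$ (i, j) - B $$ (i, j)) \<le> mat_dist nrm n A B" "nrm (B $$ (i, j) - C $$ (i, j)) \<le> mat_dist nrm n B C"
        using close_mat_dist ij unfolding close_mat_def by blast+
      then have "nrm (A $$ (i, j) - B $$ (i, j)) \<le> mat_dist nrm n A B + mat_dist nrm n B C"
        "nrm (B $$ (i, j) - C $$ (i, j)) \<le> mat_dist nrm n A B + mat_dist nrm n B C"
        using mat_dist_nonneg[of n A B] mat_dist_nonneg[of n B C] by linarith+
      then show "nrm (A $$ (i, j) - C $$ (i, j)) \<le> mat_dist nrm n A B + mat_dist nrm n B C"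
        by (rule nrm_diff_trans)
    qed
    then show ?thesis
      by (rule mat_dist_le_iff[THEN iffD2, OF add_nonneg_nonneg[OF mat_dist_nonneg mat_dist_nonneg]])
  qed
qed

lemma openin_borel_sigma: "openin T A \<Longrightarrow> A \<in> sets (borel_sigma T)"
proof -
  assume "openin T A"
  moreover have "{S. openin T S} \<subseteq> Pow (topspace T)" using openin_subset by blast
  ultimately show ?thesis unfolding borel_sigma_def by simp
qed

lemma lv_pos: "0 < lv k"
  using p_pos by simp

lemma openin_mat_saturated:
  assumes "\<And>M N. M \<in> UU n \<Longrightarrow> N \<in> UU n \<Longrightarrow> close_mat n (lv k) M N \<Longrightarrow> Q M \<Longrightarrow> Q N"
  shows "openin (mat_topology nrm n (UU n)) {M \<in> UU n. Q M}"
proof -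
  interpret MS: Metric_space "UU n" "mat_dist nrm n" by (rule Metric_space_mat)
  show ?thesis
    unfolding mat_topology_def MS.openin_mtopology
  proof (intro conjI allI impI)
    fix M assume M: "M \<in> {M \<in> UU n. Q M}"
    have "MS.mball M (lv k) \<subseteq> {M \<in> UU n. Q M}"
    proof
      fix N assume "N \<in> MS.mball M (lv k)"
      then have N: "N \<in> UU n" "mat_dist nrm n M N < lv k" by simp_all
      then have "close_mat n (lv k) M N" using mat_dist_le_iff[OF lv_nonneg, of n M N k] by simp
      then show "N \<in> {M \<in> UU n. Q M}" using assms[of M N] M N by blast
    qed
    then show "\<exists>r>0. MS.mball M r \<subseteq> {M \<in> UU n. Q M}" using lv_pos by blast
  qed blast
qed

lemma openin_integers_saturated:
  assumes "\<And>x y. nrm x \<le> 1 \<Longrightarrow> nrm y \<le> 1 \<Longrightarrow> cong_lv k x y \<Longrightarrow> Q x \<Longrightarrow> Q y"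
  shows "openin (abs_topology nrm RR) {x \<in> RR. Q x}"
proof -
  interpret MS: Metric_space RR "abs_dist nrm" by (rule Metric_space_abs)
  show ?thesis
    unfolding abs_topology_def MS.openin_mtopology
  proof (intro conjI allI impI)
    fix x assume x: "x \<in> {x \<in> RR. Q x}"
    have "MS.mball x (lv k) \<subseteq> {x \<in> RR. Q x}"
    proof
      fix y assume "y \<in> MS.mball x (lv k)"
      then have y: "y \<in> RR" "nrm (x - y) < lv k" by (simp_all add: abs_dist_def)
      then have "cong_lv k x y" by (rule_tac order_less_imp_le)
      then show "y \<in> {x \<in> RR. Q x}" using assms[of x y] x y(1) integers_UNIV by blast
    qed
    then show "\<exists>r>0. MS.mball x r \<subseteq> {x \<in> RR. Q x}" using lv_pos by blast
  qed blast
qed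

lemma topspace_mat: "topspace (mat_topology nrm n (UU n)) = UU n"
  unfolding mat_topology_def by (rule Metric_space.topspace_mtopology[OF Metric_space_mat])

lemma topspace_integers: "topspace (abs_topology nrm RR) = RR"
  unfolding abs_topology_def by (rule Metric_space.topspace_mtopology[OF Metric_space_abs])

text \<open>Congruence classes are open, hence measurable, and \<open>N * adj M\<close> carries the
  class of M onto that of N; so all classes have equal probability.\<close>

lemma haar_unitary_prob:
  assumes haar: "haar_probability (mat_topology nrm n (UU n)) (*) P"
    and Q: "\<And>M N. M \<in> UU n \<Longrightarrow> N \<in> UU n \<Longrightarrow> close_mat n (lv k) M N \<Longrightarrow> Q M \<longleftrightarrow> Q N"
  shows "measure P {M \<in> UU n. Q M} = (\<Sum>M\<in>unitary_reps n k. of_bool (Q M)) / card (unitary_reps n k)"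
proof -
  have prob: "prob_space P" and space: "space P = UU n"
    and sets: "sets P = sets (borel_sigma (mat_topology nrm n (UU n)))"
    and inv: "\<And>g A. g \<in> UU n \<Longrightarrow> A \<in> sets P \<Longrightarrow> emeasure P ((*) g ` A) = emeasure P A"
    using haar by (auto simp: haar_probability_def topspace_mat)
  interpret prob_space P by (rule prob)
  note sym = equivp_symp[OF equivp_close_mat] and trans = equivp_transp[OF equivp_close_mat]
  have meas: "{N \<in> UU n. close_mat n (lv k) M N} \<in> sets P" for M
    unfolding sets by (intro openin_borel_sigma openin_mat_saturated[of n k]) (rule trans)
  have "prob {M \<in> space P. Q M} = (\<Sum>M\<in>unitary_reps n k. of_bool (Q M)) / card (unitary_reps n k)"
  proof (rule transversal_prob[OF equivp_close_mat])
    show "transversal (space P) (close_mat n (lv k)) (unitary_reps n k)" unfolding space by (rule transversal_unitary_reps)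
    show "{N \<in> space P. close_mat n (lv k) M N} \<in> sets P" for M unfolding space by (rule meas)
    show "Q M \<longleftrightarrow> Q N" if "M \<in> space P" "N \<in> space P" "close_mat n (lv k) M N" for M N
      using that Q unfolding space by blast
    fix M N assume "M \<in> space P" "N \<in> space P"
    then have M: "M \<in> UU n" and N: "N \<in> UU n" unfolding space by auto
    define g where "g = N * adj M"
    have g: "g \<in> UU n" unfolding g_def by (rule unitary_group_mult[OF N unitary_group_adj[OF M]])
    note Mc = unitary_groupD[OF M] and Nc = unitary_groupD[OF N] and gc = unitary_groupD[OF g]
    have gM: "g * M = N"
      unfolding g_def assoc_mult_mat[OF Nc(2) adj_carrier[OF Mc(2)] Mc(2)] Mc(4) by (rule right_mult_one_mat[OF Nc(2)])
    have ag: "adj g * (g * A) = A" "g * (adj g * A) = A" if "A \<in> carrier_mat n n" for A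
      using assoc_mult_mat[OF adj_carrier[OF gc(2)] gc(2) that] assoc_mult_mat[OF gc(2) adj_carrier[OF gc(2)] that]
        left_mult_one_mat[OF that] gc(3,4) by simp_all
    have "(*) g ` {L \<in> UU n. close_mat n (lv k) M L} = {L \<in> UU n. close_mat n (lv k) N L}"
    proof (intro equalityI subsetI)
      fix L assume "L \<in> (*) g ` {L \<in> UU n. close_mat n (lv k) M L}"
      then obtain L' where L': "L' \<in> UU n" "close_mat n (lv k) M L'" "L = g * L'" by blast
      have "close_mat n (lv k) (g * M) (g * L')"
        by (rule close_mat_mult[OF gc(1) Mc(1) gc(1) unitary_groupD(1)[OF L'(1)] close_mat_refl[OF lv_nonneg] L'(2) lv_nonneg])
      then show "L \<in> {L \<in> UU n. close_mat n (lv k) N L}"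
        using unitary_group_mult[OF g L'(1)] by (simp add: gM L'(3))
    next
      fix L assume "L \<in> {L \<in> UU n. close_mat n (lv k) N L}"
      then have L: "L \<in> UU n" "close_mat n (lv k) N L" by blast+
      have "close_mat n (lv k) (adj g * N) (adj g * L)"
        by (rule close_mat_mult[OF adj_mat_over[OF gc(1)] Nc(1) adj_mat_over[OF gc(1)] unitary_groupD(1)[OF L(1)]
              close_mat_refl[OF lv_nonneg] L(2) lv_nonneg])
      moreover have "adj g * N = M" using ag(1)[OF Mc(2)] by (simp add: gM)
      ultimately have "adj g * L \<in> {L \<in> UU n. close_mat n (lv k) M L}"
        using unitary_group_mult[OF unitary_group_adj[OF g] L(1)] by simp
      then have "g * (adj g * L) \<in> (*) g ` {L \<in> UU n. close_mat n (lv k) M L}" by (rule imageI)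
      then show "L \<in> (*) g ` {L \<in> UU n. close_mat n (lv k) M L}"
        by (simp only: ag(2)[OF unitary_groupD(2)[OF L(1)]])
    qed
    then have "emeasure P {L \<in> UU n. close_mat n (lv k) N L} = emeasure P {L \<in> UU n. close_mat n (lv k) M L}"
      using inv[OF g meas[of M]] by simp
    then show "prob {L \<in> space P. close_mat n (lv k) M L} = prob {L \<in> space P. close_mat n (lv k) N L}"
      unfolding space measure_def by simp
  qed
  then show ?thesis unfolding space .
qed

lemma haar_integers_prob:
  assumes haar: "haar_probability (abs_topology nrm RR) (+) P"
    and Q: "\<And>x y. nrm x \<le> 1 \<Longrightarrow> nrm y \<le> 1 \<Longrightarrow> cong_lv k x y \<Longrightarrow> Q x \<longleftrightarrow> Q y"
  shows "measure P {x \<in> RR. Q x} = (\<Sum>t\<in>residue_reps k. of_bool (Q t)) / card (residue_reps k)"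
proof -
  have prob: "prob_space P" and space: "space P = RR"
    and sets: "sets P = sets (borel_sigma (abs_topology nrm RR))"
    and inv: "\<And>g A. g \<in> RR \<Longrightarrow> A \<in> sets P \<Longrightarrow> emeasure P ((+) g ` A) = emeasure P A"
    using haar by (auto simp: haar_probability_def topspace_integers)
  interpret prob_space P by (rule prob)
  have RR: "RR = {x. nrm x \<le> 1}" by (simp add: integers_def)
  have meas: "{y \<in> RR. cong_lv k x y} \<in> sets P" for x
    unfolding sets by (intro openin_borel_sigma openin_integers_saturated[of k]) (rule nrm_diff_trans)
  have "prob {x \<in> space P. Q x} = (\<Sum>t\<in>residue_reps k. of_bool (Q t)) / card (residue_reps k)"
  proof (rule transversal_prob[OF equivp_cong_lv])
    show "transversal (space P) (cong_lv k) (residue_reps k)" unfolding space RR by (rule transversal_residue_reps)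
    show "{y \<in> space P. cong_lv k x y} \<in> sets P" for x unfolding space by (rule meas)
    show "Q x \<longleftrightarrow> Q y" if "x \<in> space P" "y \<in> space P" "cong_lv k x y" for x y
      using that Q unfolding space RR by blast
    fix x y assume "x \<in> space P" "y \<in> space P"
    then have xy: "nrm x \<le> 1" "nrm y \<le> 1" unfolding space RR by auto
    define g where "g = y - x"
    have g: "g \<in> RR" unfolding RR g_def using xy by (simp add: nrm_diff_le)
    have "(+) g ` {z \<in> RR. cong_lv k x z} = {z \<in> RR. cong_lv k y z}"
    proof (intro equalityI subsetI)
      fix z assume "z \<in> (+) g ` {z \<in> RR. cong_lv k x z}"
      then obtain z' where z': "z' \<in> RR" "cong_lv k x z'" "z = g + z'" by blast
      then show "z \<in> {z \<in> RR. cong_lv k y z}" using g unfolding RR by (simp add: g_def nrm_add_le)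
    next
      fix z assume "z \<in> {z \<in> RR. cong_lv k y z}"
      then have z: "z \<in> RR" "cong_lv k y z" by blast+
      have "z - g \<in> {z \<in> RR. cong_lv k x z}"
        using z g unfolding RR by (simp add: nrm_diff_le) (simp add: g_def)
      then have "g + (z - g) \<in> (+) g ` {z \<in> RR. cong_lv k x z}" by (rule imageI)
      then show "z \<in> (+) g ` {z \<in> RR. cong_lv k x z}" by simp
    qed
    then have "emeasure P {z \<in> RR. cong_lv k y z} = emeasure P {z \<in> RR. cong_lv k x z}"
      using inv[OF g meas[of x]] by simp
    then show "prob {z \<in> space P. cong_lv k x z} = prob {z \<in> space P. cong_lv k y z}"
      unfolding space measure_def by simp
  qed
  then show ?thesis unfolding space .
qed

text \<open>In an ultrametric, two points at distance less than the radius are both in the ball or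
  both outside it; the strict inequality covers open and closed balls alike.\<close>

lemma saturated_ball:
  assumes "is_ball nrm RR B"
  shows "\<exists>r>0. \<forall>k. lv k < r \<longrightarrow> saturated k B"
proof -
  interpret MS: Metric_space RR "abs_dist nrm" by (rule Metric_space_abs)
  obtain a r where a: "a \<in> RR" "r > 0" and B: "B = MS.mball a r \<or> B = MS.mcball a r"
    using assms unfolding is_ball_def by blast
  have "saturated k B" if k: "lv k < r" for k
    unfolding saturated_def
  proof (intro allI impI)
    fix x y assume xy: "nrm x \<le> 1" "nrm y \<le> 1" "cong_lv k x y" "x \<in> B"
    have "nrm (a - y) \<le> max (nrm (a - x)) (nrm (x - y))" using nrm_add[of "a - x" "x - y"] by simp
    then show "y \<in> B" using B xy k a(1) integers_UNIV[of y] by (auto simp: abs_dist_def)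
  qed
  then show ?thesis using a(2) by blast
qed

lemma common_saturation_level:
  fixes d :: nat
  assumes "\<And>i. i \<in> {1..d} \<Longrightarrow> is_ball nrm RR (B i)"
  shows "\<exists>k\<ge>1. \<forall>i\<in>{1..d}. saturated k (B i)"
proof -
  have lim: "(\<lambda>k. lv k) \<longlonglongrightarrow> 0" using p_gt_1 by (intro LIMSEQ_power_zero) simp
  have "\<forall>\<^sub>F k in sequentially. saturated k (B i)" if i: "i \<in> {1..d}" for i
  proof -
    obtain r where r: "r > 0" "\<forall>k. lv k < r \<longrightarrow> saturated k (B i)"
      using saturated_ball[OF assms[OF i]] by blast
    from order_tendstoD(2)[OF lim r(1)] show ?thesis by (rule eventually_mono) (use r(2) in blast)
  qed
  then have "\<forall>\<^sub>F k in sequentially. \<forall>i\<in>{1..d}. saturated k (B i)"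
    by (intro eventually_ball_finite) auto
  then have "\<forall>\<^sub>F k in sequentially. (\<forall>i\<in>{1..d}. saturated k (B i)) \<and> k \<ge> 1"
    by (intro eventually_conj eventually_ge_at_top)
  then show ?thesis using eventually_happens'[OF sequentially_bot] by fastforce
qed

lemma nrm_inverse_padic_abs:
  assumes "i > 0"
  shows "nrm (of_rat (1 / padic_abs p (of_nat i))) = nrm (of_nat i)"
proof -
  let ?v = "multiplicity p i"
  have "1 / padic_abs p (of_nat i) = of_nat (p ^ ?v)"
    unfolding padic_abs_of_nat[OF assms] by (simp add: power_int_minus divide_inverse)
  then have "of_rat (1 / padic_abs p (of_nat i)) = (of_nat (p ^ ?v) :: 'k)" by (simp only: of_rat_of_nat_eq)
  then show ?thesis using nrm_of_nat[OF assms] by (simp add: nrm_power nrm_p)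
qed

end

theorem theorem1p6:
  fixes p q d :: nat
    and nrm :: "'k::field_char_0 \<Rightarrow> real"
    and Qp F R :: "'k set"
    and \<pi> :: 'k
    and \<tau> \<sigma> :: "'k \<Rightarrow> 'k"
    and B :: "nat \<Rightarrow> 'k set"
    and \<Omega> :: "'w measure"
    and U Z :: "nat \<Rightarrow> 'w \<Rightarrow> 'k"
    and P :: "nat \<Rightarrow> 'k mat measure"
  assumes KF: "unramified_quadratic p q nrm Qp F \<pi> \<tau> \<sigma>"
    and R: "R = integers nrm UNIV"
    and d: "d > 0"
    and B: "\<And>i. i \<in> {1..d} \<Longrightarrow> is_ball nrm R (B i)"
    and \<Omega>: "prob_space \<Omega>"
    and U_indep: "prob_space.indep_vars \<Omega> (\<lambda>_. borel_sigma (abs_topology nrm R)) U {1..d}"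
    and U_haar: "\<And>i. i \<in> {1..d} \<Longrightarrow>
          haar_probability (abs_topology nrm R) (+)
            (distr \<Omega> (borel_sigma (abs_topology nrm R)) (U i))"
    and Z: "\<And>i \<omega>. i \<in> {1..d} \<Longrightarrow> Z i \<omega> = of_rat (1 / padic_abs p (of_nat i)) * U i \<omega>"
    and P: "\<And>n. n > 0 \<Longrightarrow>
          haar_probability (mat_topology nrm n (unitary_group n R \<tau>)) (*) (P n)"
  shows "(\<lambda>n. measure (P n)
            {M \<in> unitary_group n R \<tau>. \<forall>i \<in> {1..d}.
               mat_trace (M ^\<^sub>m i) - of_bool (p dvd i) * \<sigma> (mat_trace (M ^\<^sub>m (i div p))) \<in> B i})
         \<longlonglongrightarrow> (\<Prod>i = 1..d. measure \<Omega> {\<omega> \<in> space \<Omega>. Z i \<omega> \<in> B i})"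
proof -
  interpret unramified_quadratic p q nrm Qp F \<pi> \<tau> \<sigma> by (rule KF)
  interpret \<Omega>: prob_space \<Omega> by (rule \<Omega>)
  obtain k where k: "k \<ge> 1" and sat: "\<And>i. i \<in> {1..d} \<Longrightarrow> saturated k (B i)"
    using common_saturation_level[of d B] B unfolding R by blast
  have lhs: "measure (P n) {M \<in> unitary_group n R \<tau>. \<forall>i \<in> {1..d}.
        mat_trace (M ^\<^sub>m i) - of_bool (p dvd i) * \<sigma> (mat_trace (M ^\<^sub>m (i div p))) \<in> B i} =
      (\<Sum>M\<in>unitary_reps n k. of_bool (in_event B d M)) / card (unitary_reps n k)" if "n > 0" for n
  proof -
    have "measure (P n) {M \<in> UU n. in_event B d M} = (\<Sum>M\<in>unitary_reps n k. of_bool (in_event B d M)) / card (unitary_reps n k)"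
    proof (rule haar_unitary_prob)
      show "haar_probability (mat_topology nrm n (UU n)) (*) (P n)" using P[OF that] unfolding R .
      show "in_event B d M \<longleftrightarrow> in_event B d N" if "M \<in> UU n" "N \<in> UU n" "close_mat n (lv k) M N" for M N
        using sat that by (rule in_event_close)
    qed
    then show ?thesis unfolding R in_event_def frob_trace_def .
  qed
  have rhs: "measure \<Omega> {\<omega> \<in> space \<Omega>. Z i \<omega> \<in> B i} = limit_count k B i / card (residue_reps k)" if i: "i \<in> {1..d}" for i
  proof -
    let ?N = "borel_sigma (abs_topology nrm RR)"
    define c where "c = (of_rat (1 / padic_abs p (of_nat i)) :: 'k)"
    have i0: "i > 0" using i by simp
    have nc: "nrm c = nrm (of_nat i)" unfolding c_def by (rule nrm_inverse_padic_abs[OF i0])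
    have cle: "nrm c \<le> 1" unfolding nc by (rule nrm_of_nat_le)
    have Qc: "c * x \<in> B i \<longleftrightarrow> c * y \<in> B i" if "nrm x \<le> 1" "nrm y \<le> 1" "cong_lv k x y" for x y
    proof (rule saturated_iff[OF sat[OF i]])
      show "nrm (c * x) \<le> 1" "nrm (c * y) \<le> 1" using that cle by (auto intro: nrm_mult_le_one)
      show "cong_lv k (c * x) (c * y)" unfolding right_diff_distrib[symmetric] using cle that(3) by (rule nrm_mult_le)
    qed
    have U: "U i \<in> measurable \<Omega> ?N"
      using U_indep i unfolding R \<Omega>.indep_vars_def by blast
    have spN: "space ?N = RR" unfolding borel_sigma_def using topspace_integers by (simp add: space_measure_of_conv)
    have "{x \<in> RR. c * x \<in> B i} \<in> sets ?N"
      using Qc by (intro openin_borel_sigma openin_integers_saturated[of k]) blast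
    then have "measure (distr \<Omega> ?N (U i)) {x \<in> RR. c * x \<in> B i} = measure \<Omega> (U i -` {x \<in> RR. c * x \<in> B i} \<inter> space \<Omega>)"
      by (rule measure_distr[OF U])
    also have "U i -` {x \<in> RR. c * x \<in> B i} \<inter> space \<Omega> = {\<omega> \<in> space \<Omega>. Z i \<omega> \<in> B i}"
      using measurable_space[OF U] unfolding spN by (auto simp: Z[OF i] c_def)
    finally have "measure \<Omega> {\<omega> \<in> space \<Omega>. Z i \<omega> \<in> B i} = measure (distr \<Omega> ?N (U i)) {x \<in> RR. c * x \<in> B i}" by simp
    also have "\<dots> = (\<Sum>t\<in>residue_reps k. of_bool (c * t \<in> B i)) / card (residue_reps k)"
      using U_haar[OF i] Qc unfolding R by (rule haar_integers_prob)
    also have "(\<Sum>t\<in>residue_reps k. of_bool (c * t \<in> B i)) = limit_count k B i"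
    proof -
      \<comment> \<open>The factor 1/|i|_p of \<open>Z i\<close> and the factor i of the count have
        the same absolute value. Their quotient r is a unit, and multiplication by it permutes the
        residue classes; the added 0 is the shift in \<open>sum_residue_reps_affine\<close>.\<close>
      define r where "r = c / of_nat i"
      have ni: "nrm (of_nat i) \<noteq> 0" using i0 by simp
      have r: "nrm r = 1" unfolding r_def nrm_divide nc using ni by (rule divide_self)
      have cr: "c * t = of_nat i * (r * t + 0)" for t using i0 by (simp add: r_def)
      have "(\<Sum>t\<in>residue_reps k. of_bool (c * t \<in> B i) :: real) = (\<Sum>t\<in>residue_reps k. of_bool (of_nat i * (r * t + 0) \<in> B i))"
        by (simp only: cr)
      also have "\<dots> = (\<Sum>t\<in>residue_reps k. of_bool (of_nat i * t \<in> B i))"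
      proof (rule sum_residue_reps_affine[OF r, where g = "\<lambda>t. of_bool (of_nat i * t \<in> B i)"])
        fix x y assume xy: "nrm x \<le> 1" "nrm y \<le> 1" "cong_lv k x y"
        have "of_nat i * x \<in> B i \<longleftrightarrow> of_nat i * y \<in> B i"
        proof (rule saturated_iff[OF sat[OF i]])
          show "nrm (of_nat i * x) \<le> 1" "nrm (of_nat i * y) \<le> 1" using xy nrm_of_nat_le by (auto intro: nrm_mult_le_one)
          show "cong_lv k (of_nat i * x) (of_nat i * y)"
            unfolding right_diff_distrib[symmetric] using nrm_of_nat_le xy(3) by (rule nrm_mult_le)
        qed
        then show "of_bool (of_nat i * x \<in> B i) = (of_bool (of_nat i * y \<in> B i) :: real)" by (simp only:)
      qed simp
      finally show ?thesis unfolding limit_count_def .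
    qed
    finally show ?thesis .
  qed
  have "(\<lambda>n. (\<Sum>M\<in>unitary_reps n k. of_bool (in_event B d M)) / card (unitary_reps n k)) \<longlonglongrightarrow> (\<Prod>i\<in>{1..d}. limit_count k B i / card (residue_reps k))"
    using sat k by (rule equidistribution_limit)
  moreover have "(\<Prod>i\<in>{1..d}. limit_count k B i / card (residue_reps k)) = (\<Prod>i = 1..d. measure \<Omega> {\<omega> \<in> space \<Omega>. Z i \<omega> \<in> B i})"
    using rhs by (intro prod.cong) simp_all
  \<comment> \<open>Haar measures are given for n > 0 only, so the two sequences agree from 1
    on.\<close>
  moreover have "\<forall>\<^sub>F n in sequentially. (\<Sum>M\<in>unitary_reps n k. of_bool (in_event B d M)) / card (unitary_reps n k) =
      measure (P n) {M \<in> unitary_group n R \<tau>. \<forall>i \<in> {1..d}.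
        mat_trace (M ^\<^sub>m i) - of_bool (p dvd i) * \<sigma> (mat_trace (M ^\<^sub>m (i div p))) \<in> B i}"
    using eventually_gt_at_top[of 0] by (rule eventually_mono) (simp only: lhs)
  ultimately show ?thesis by (simp only: Lim_transform_eventually)
qed

end
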